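(* Let $\mathscr S=(\mathcal S,\mathbf g,\mathcal Q,\mathbf s_{\mathsf i},\mathcal L)$ be a controllable, trivialized, unconstrained swimmer and let $\mathcal K$ be a compact subset of $\mathcal S$ such that $\mathbf s_{\mathsf i}\in\mathring{\mathcal K}$ (the interior of $\mathcal K$). Then there exists $\varepsilon>0$ such that the function $\delta\mapsto\Phi_{\mathscr S,\mathcal K}(\delta)$ is increasing on $[0,\varepsilon[$.
   Context: A swimmer is a 5-tuple $\mathscr S=(\mathcal S,\mathbf g,\mathcal Q,\mathbf s_{\mathsf i},\mathcal L)$ where $(\mathcal S,\mathbf g)$ is a connected real-analytic manifold of dimension $N\ge1$ with an analytic Riemannian metric $\mathbf g$; $\mathcal Q:T\mathcal S\to\mathbb R^n$ is an analytic $\mathbb R^n$-valued 1-form on $\mathcal S$; $\mathbf s_{\mathsf i}\in\mathcal S$; and $\mathcal L$ is an analytic real-valued 1-form on $\mathcal S$. For $\mathbf s\in\mathcal S$ put $\Delta^{\mathcal S}_{\mathbf s}=\ker\mathcal Q_{\mathbf s}\subset T_{\mathbf s}\mathcal S$. An analytic spanning family of $\Delta^{\mathcal S}$ is a finite family $\mathcal X=\{\mathbf X_1,\dots,\mathbf X_p\}$ of analytic vector fields on $\mathcal S$ with $\mathrm{span}\{\mathbf X_j(\mathbf s)\}=\Delta^{\mathcal S}_{\mathbf s}$ for all $\mathbf s$. The swimmer is unconstrained if $\mathcal Q=\mathbf 0$ (so $\Delta^{\mathcal S}=T\mathcal S$). Let $\mathcal M=\mathcal S\times\mathbb R$, with projections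 $\Pi_{\mathcal S}(\mathbf s,r)=\mathbf s$, $\Pi_{\mathbb R}(\mathbf s,r)=r$. For $\boldsymbol\xi=(\mathbf s,r)\in\mathcal M$ let $\mathbf Z_j(\boldsymbol\xi)=(\mathbf X_j(\mathbf s),\mathcal L_{\mathbf s}\mathbf X_j(\mathbf s))\in T_{\boldsymbol\xi}\mathcal M$, $\mathcal Z=\{\mathbf Z_1,\dots,\mathbf Z_p\}$, $\Delta^{\mathcal M}_{\boldsymbol\xi}=\mathrm{span}\,\mathcal Z(\boldsymbol\xi)$. $\mathrm{Lie}_{\mathbf s}\Delta^{\mathcal S}$ (resp. $\mathrm{Lie}_{\boldsymbol\xi}\Delta^{\mathcal M}$) is the evaluation at $\mathbf s$ (resp. $\boldsymbol\xi$) of the Lie algebra of vector fields generated by $\mathcal X$ (resp. $\mathcal Z$); it does not depend on the choice of $\mathcal X$. The swimmer is controllable if (1) $\dim\mathrm{Lie}_{\mathbf s}\Delta^{\mathcal S}=\dim\mathcal S$ for all $\mathbf s\in\mathcal S$, and (2) there exists $\boldsymbol\xi\in\mathcal M$ with $\dim\mathrm{Lie}_{\boldsymbol\xi}\Delta^{\mathcal M}=\dim\mathcal M$. It is trivialized if there is an analytic spanning family $\{\mathbf X_1,\dots,\mathbf X_p\}$ which is a basis of $\Delta^{\mathcal S}_{\mathbf s}$ at every $\mathbf s\in\mathcal S$; by Gram–Schmidt it may be taken $\mathbf g$-orthonormal at each point, and is then called an (analytic) orthonormal basis $\mathcal X$ of $\Delta^{\mathcal S}$. Fix such an orthonormal basis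 $\mathcal X$, $T>0$ and $\boldsymbol\xi_{\mathsf i}=(\mathbf s_{\mathsf i},0)$. For $\mathbf u=(u_1,\dots,u_p)\in L^\infty([0,T],\mathbb R^p)$, let $\boldsymbol\xi^{\mathcal X}_{\mathscr S}(\cdot,\mathbf u)$ denote the (Carathéodory) solution of $\dot{\boldsymbol\xi}=\sum_{j=1}^p u_j\mathbf Z_j(\boldsymbol\xi)$, $\boldsymbol\xi(0)=\boldsymbol\xi_{\mathsf i}$. For $\delta\in\mathbb R$, $\mathcal B^{\mathcal X}_{\mathscr S,\mathcal K}((\mathbf s_{\mathsf i},\delta),T)$ is the set of those $\mathbf u$ for which this solution is defined on $[0,T]$, $\Pi_{\mathcal S}\boldsymbol\xi^{\mathcal X}_{\mathscr S}(t,\mathbf u)\in\mathcal K$ for all $t\in[0,T]$, and $\boldsymbol\xi^{\mathcal X}_{\mathscr S}(T,\mathbf u)=(\mathbf s_{\mathsf i},\delta)$. Define $$\Phi_{\mathscr S,\mathcal K}(\delta)=\inf\Big\{\int_0^T\|\mathbf u(t)\|_{\mathbb R^p}dt:\mathbf u\in\mathcal B^{\mathcal X}_{\mathscr S,\mathcal K}((\mathbf s_{\mathsf i},\delta),T)\Big\},$$ which does not depend on $\mathcal X$ or on $T>0$. "Increasing" means strictly increasing. *)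

theory Defs
  imports "HOL-Analysis.Analysis"
begin

section \<open>Real-analytic functions of several variables\<close>

text \<open>
  Multi-indices are functions \<open>Basis \<rightarrow> nat\<close>, extended by \<open>undefined\<close> outside of \<open>Basis\<close>.
  The domain \<open>U\<close> is always open in what follows.
\<close>

definition real_analytic_on ::
    "('a::euclidean_space \<Rightarrow> 'b::real_normed_vector) \<Rightarrow> 'a set \<Rightarrow> bool"
    (infix "real'_analytic'_on" 50) where
  "f real_analytic_on U \<longleftrightarrow>
     (\<forall>x0\<in>U. \<exists>r>0. \<exists>c :: ('a \<Rightarrow> nat) \<Rightarrow> 'b. \<forall>x\<in>ball x0 r.
        ((\<lambda>\<alpha>. (\<Prod>b\<in>Basis. ((x - x0) \<bullet> b) ^ \<alpha> b) *\<^sub>R c \<alpha>) has_sum f x)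
          (Basis \<rightarrow>\<^sub>E UNIV))"


section \<open>Analytic manifolds and tensor fields\<close>

text \<open>
  An atlas is a family of charts \<open>chart_map A i : chart_dom A i \<rightarrow> 'e\<close>, \<open>i \<in> charts A\<close>; the
  manifold is the whole type \<open>'s\<close>, with the topology of that type, and its dimension is
  \<open>DIM('e)\<close>.  A function such as \<open>chart_map A i\<close> is only meaningful on \<open>chart_dom A i\<close>.
\<close>

record ('i, 's, 'e) atlas =
  charts :: "'i set"
  chart_dom :: "'i \<Rightarrow> 's set"
  chart_map :: "'i \<Rightarrow> 's \<Rightarrow> 'e"

definition chart_inv :: "('i, 's, 'e) atlas \<Rightarrow> 'i \<Rightarrow> 'e \<Rightarrow> 's" where
  "chart_inv A i = inv_into (chart_dom A i) (chart_map A i)"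

definition transition :: "('i, 's, 'e) atlas \<Rightarrow> 'i \<Rightarrow> 'i \<Rightarrow> 'e \<Rightarrow> 'e" where
  "transition A i j = chart_map A j \<circ> chart_inv A i"

definition analytic_manifold ::
    "('i, 's::{t2_space, second_countable_topology}, 'e::euclidean_space) atlas \<Rightarrow> bool" where
  "analytic_manifold A \<longleftrightarrow>
     (\<Union>i\<in>charts A. chart_dom A i) = UNIV \<and>
     (\<forall>i\<in>charts A.
        open (chart_dom A i) \<and> open (chart_map A i ` chart_dom A i) \<and>
        homeomorphism (chart_dom A i) (chart_map A i ` chart_dom A i)
          (chart_map A i) (chart_inv A i)) \<and>
     (\<forall>i\<in>charts A. \<forall>j\<in>charts A.
        transition A i j real_analytic_on chart_map A i ` (chart_dom A i \<inter> chart_dom A j))"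

text \<open>
  A tangent vector at \<open>s\<close> is the family of its coordinate vectors in the charts around \<open>s\<close>,
  related by the differentials of the transition maps.  Accordingly, a vector field is a function
  \<open>X\<close> such that \<open>X i s\<close> is the coordinate vector of \<open>X(s)\<close> in the chart \<open>i\<close>, and for a 1-form
  \<open>\<omega>\<close> and a metric \<open>g\<close> the values \<open>\<omega> i s v\<close> and \<open>g i s v w\<close> are taken at the tangent vectors
  with coordinates \<open>v\<close>, \<open>w\<close> in the chart \<open>i\<close>.
\<close>

definition change_coords ::
    "('i, 's, 'e::euclidean_space) atlas \<Rightarrow> 'i \<Rightarrow> 'i \<Rightarrow> 's \<Rightarrow> 'e \<Rightarrow> 'e" where
  "change_coords A i j s = frechet_derivative (transition A i j) (at (chart_map A i s))"

type_synonym ('i, 's, 'e) vfield = "'i \<Rightarrow> 's \<Rightarrow> 'e"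

definition analytic_vector_field ::
    "('i, 's, 'e::euclidean_space) atlas \<Rightarrow> ('i, 's, 'e) vfield \<Rightarrow> bool" where
  "analytic_vector_field A X \<longleftrightarrow>
     (\<forall>i\<in>charts A. \<forall>j\<in>charts A. \<forall>s\<in>chart_dom A i \<inter> chart_dom A j.
        X j s = change_coords A i j s (X i s)) \<and>
     (\<forall>i\<in>charts A.
        (\<lambda>x. X i (chart_inv A i x)) real_analytic_on chart_map A i ` chart_dom A i)"

definition analytic_one_form ::
    "('i, 's, 'e::euclidean_space) atlas \<Rightarrow> ('i \<Rightarrow> 's \<Rightarrow> 'e \<Rightarrow> 'f::real_normed_vector) \<Rightarrow> bool" where
  "analytic_one_form A \<omega> \<longleftrightarrow>
     (\<forall>i\<in>charts A. \<forall>s\<in>chart_dom A i. linear (\<omega> i s)) \<and>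
     (\<forall>i\<in>charts A. \<forall>j\<in>charts A. \<forall>s\<in>chart_dom A i \<inter> chart_dom A j. \<forall>v.
        \<omega> j s (change_coords A i j s v) = \<omega> i s v) \<and>
     (\<forall>i\<in>charts A. \<forall>v.
        (\<lambda>x. \<omega> i (chart_inv A i x) v) real_analytic_on chart_map A i ` chart_dom A i)"

definition analytic_riemannian_metric ::
    "('i, 's, 'e::euclidean_space) atlas \<Rightarrow> ('i \<Rightarrow> 's \<Rightarrow> 'e \<Rightarrow> 'e \<Rightarrow> real) \<Rightarrow> bool" where
  "analytic_riemannian_metric A g \<longleftrightarrow>
     (\<forall>i\<in>charts A. \<forall>s\<in>chart_dom A i.
        bilinear (g i s) \<and> (\<forall>v w. g i s v w = g i s w v) \<and> (\<forall>v. v \<noteq> 0 \<longrightarrow> g i s v v > 0)) \<and>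
     (\<forall>i\<in>charts A. \<forall>j\<in>charts A. \<forall>s\<in>chart_dom A i \<inter> chart_dom A j. \<forall>v w.
        g j s (change_coords A i j s v) (change_coords A i j s w) = g i s v w) \<and>
     (\<forall>i\<in>charts A. \<forall>v w.
        (\<lambda>x. g i (chart_inv A i x) v w) real_analytic_on chart_map A i ` chart_dom A i)"


section \<open>Lie algebras of vector fields\<close>

text \<open>\<open>[X, Y] = DY \<cdot> X - DX \<cdot> Y\<close> in every chart.\<close>

definition lie_bracket ::
    "('i, 's, 'e::euclidean_space) atlas \<Rightarrow> ('i, 's, 'e) vfield \<Rightarrow> ('i, 's, 'e) vfield
       \<Rightarrow> ('i, 's, 'e) vfield" where
  "lie_bracket A X Y = (\<lambda>i s.
     frechet_derivative (\<lambda>x. Y i (chart_inv A i x)) (at (chart_map A i s)) (X i s) -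
     frechet_derivative (\<lambda>x. X i (chart_inv A i x)) (at (chart_map A i s)) (Y i s))"

inductive_set lie_algebra ::
    "('i, 's, 'e::euclidean_space) atlas \<Rightarrow> ('i, 's, 'e) vfield set \<Rightarrow> ('i, 's, 'e) vfield set"
    for A :: "('i, 's, 'e) atlas" and F :: "('i, 's, 'e) vfield set" where
  gen: "X \<in> F \<Longrightarrow> X \<in> lie_algebra A F"
| zero: "(\<lambda>i s. 0) \<in> lie_algebra A F"
| add: "X \<in> lie_algebra A F \<Longrightarrow> Y \<in> lie_algebra A F \<Longrightarrow> (\<lambda>i s. X i s + Y i s) \<in> lie_algebra A F"
| scale: "X \<in> lie_algebra A F \<Longrightarrow> (\<lambda>i s. a *\<^sub>R X i s) \<in> lie_algebra A F"
| bracket: "X \<in> lie_algebra A F \<Longrightarrow> Y \<in> lie_algebra A F \<Longrightarrow> lie_bracket A X Y \<in> lie_algebra A F"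

text \<open>The evaluation at \<open>s\<close>, expressed in the chart \<open>i\<close>.\<close>

definition lie_at ::
    "('i, 's, 'e::euclidean_space) atlas \<Rightarrow> ('i, 's, 'e) vfield set \<Rightarrow> 'i \<Rightarrow> 's \<Rightarrow> 'e set" where
  "lie_at A F i s = (\<lambda>X. X i s) ` lie_algebra A F"


section \<open>Swimmers\<close>

record ('i, 's, 'e, 'n) swimmer =
  shape :: "('i, 's, 'e) atlas"
  metric :: "'i \<Rightarrow> 's \<Rightarrow> 'e \<Rightarrow> 'e \<Rightarrow> real"
  constraint :: "'i \<Rightarrow> 's \<Rightarrow> 'e \<Rightarrow> real ^ 'n"
  init :: "'s"
  displ :: "'i \<Rightarrow> 's \<Rightarrow> 'e \<Rightarrow> real"

definition is_swimmer ::
    "('i, 's::{t2_space, second_countable_topology}, 'e::euclidean_space, 'n::finite) swimmer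
       \<Rightarrow> bool" where
  "is_swimmer S \<longleftrightarrow>
     analytic_manifold (shape S) \<and> connected (UNIV :: 's set) \<and>
     analytic_riemannian_metric (shape S) (metric S) \<and>
     analytic_one_form (shape S) (constraint S) \<and>
     analytic_one_form (shape S) (displ S)"

definition unconstrained :: "('i, 's, 'e::euclidean_space, 'n::finite) swimmer \<Rightarrow> bool" where
  "unconstrained S \<longleftrightarrow>
     (\<forall>i\<in>charts (shape S). \<forall>s\<in>chart_dom (shape S) i. \<forall>v. constraint S i s v = 0)"

text \<open>\<open>\<Delta>\<^sub>s = ker Q\<^sub>s\<close>, expressed in the chart \<open>i\<close>.\<close>

definition distr ::
    "('i, 's, 'e::euclidean_space, 'n::finite) swimmer \<Rightarrow> 'i \<Rightarrow> 's \<Rightarrow> 'e set" where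
  "distr S i s = {v. constraint S i s v = 0}"

text \<open>The finite family \<open>X\<^sub>1, \<dots>, X\<^sub>p\<close> is indexed by \<open>j < p\<close>.\<close>

definition spanning_family ::
    "('i, 's, 'e::euclidean_space, 'n::finite) swimmer \<Rightarrow> nat \<Rightarrow> (nat \<Rightarrow> ('i, 's, 'e) vfield)
       \<Rightarrow> bool" where
  "spanning_family S p X \<longleftrightarrow>
     (\<forall>j<p. analytic_vector_field (shape S) (X j)) \<and>
     (\<forall>i\<in>charts (shape S). \<forall>s\<in>chart_dom (shape S) i.
        span ((\<lambda>j. X j i s) ` {..<p}) = distr S i s)"

definition basis_family ::
    "('i, 's, 'e::euclidean_space, 'n::finite) swimmer \<Rightarrow> nat \<Rightarrow> (nat \<Rightarrow> ('i, 's, 'e) vfield)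
       \<Rightarrow> bool" where
  "basis_family S p X \<longleftrightarrow>
     spanning_family S p X \<and>
     (\<forall>i\<in>charts (shape S). \<forall>s\<in>chart_dom (shape S) i.
        inj_on (\<lambda>j. X j i s) {..<p} \<and> independent ((\<lambda>j. X j i s) ` {..<p}))"

definition trivialized :: "('i, 's, 'e::euclidean_space, 'n::finite) swimmer \<Rightarrow> bool" where
  "trivialized S \<longleftrightarrow> (\<exists>p X. basis_family S p X)"

definition orthonormal_basis ::
    "('i, 's, 'e::euclidean_space, 'n::finite) swimmer \<Rightarrow> nat \<Rightarrow> (nat \<Rightarrow> ('i, 's, 'e) vfield)
       \<Rightarrow> bool" where
  "orthonormal_basis S p X \<longleftrightarrow>
     basis_family S p X \<and>
     (\<forall>i\<in>charts (shape S). \<forall>s\<in>chart_dom (shape S) i. \<forall>j<p. \<forall>k<p.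
        metric S i s (X j i s) (X k i s) = (if j = k then 1 else 0))"

text \<open>The manifold \<open>M = S \<times> \<real>\<close>, with charts indexed like those of \<open>S\<close>.\<close>

definition times_real :: "('i, 's, 'e) atlas \<Rightarrow> ('i, 's \<times> real, 'e \<times> real) atlas" where
  "times_real A =
     \<lparr> charts = charts A,
       chart_dom = (\<lambda>i. chart_dom A i \<times> UNIV),
       chart_map = (\<lambda>i (s, r). (chart_map A i s, r)) \<rparr>"

definition lift_field ::
    "('i, 's, 'e::euclidean_space, 'n::finite) swimmer \<Rightarrow> ('i, 's, 'e) vfield
       \<Rightarrow> ('i, 's \<times> real, 'e \<times> real) vfield" where
  "lift_field S X = (\<lambda>i (s, r). (X i s, displ S i s (X i s)))"

text \<open>
  The spaces \<open>Lie\<^sub>s \<Delta>\<^sup>S\<close> and \<open>Lie\<^sub>\<xi> \<Delta>\<^sup>M\<close> do not depend on the spanning family used to compute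
  them, hence the existential quantifier.  Nor does their dimension depend on the chart.
\<close>

definition controllable :: "('i, 's, 'e::euclidean_space, 'n::finite) swimmer \<Rightarrow> bool" where
  "controllable S \<longleftrightarrow>
     (\<exists>p X. spanning_family S p X \<and>
        (\<forall>i\<in>charts (shape S). \<forall>s\<in>chart_dom (shape S) i.
           dim (lie_at (shape S) (X ` {..<p}) i s) = DIM('e)) \<and>
        (\<exists>i\<in>charts (shape S). \<exists>\<xi>\<in>chart_dom (times_real (shape S)) i.
           dim (lie_at (times_real (shape S)) ((\<lambda>j. lift_field S (X j)) ` {..<p}) i \<xi>)
             = DIM('e \<times> real)))"


section \<open>Controlled trajectories and the optimal cost\<close>

definition Linf_control :: "nat \<Rightarrow> real \<Rightarrow> (real \<Rightarrow> nat \<Rightarrow> real) \<Rightarrow> bool" where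
  "Linf_control p T u \<longleftrightarrow>
     (\<forall>j<p. (\<lambda>t. u t j) \<in> borel_measurable (lebesgue_on {0..T}) \<and>
        (\<exists>C. AE t in lebesgue_on {0..T}. \<bar>u t j\<bar> \<le> C))"

text \<open>
  Caratheodory solutions of \<open>\<xi>' = \<Sum>j<p. u\<^sub>j Z\<^sub>j(\<xi>)\<close> on \<open>[0,T]\<close> are continuous curves
  that satisfy the integral equation in each chart, on each time interval spent in that chart.
\<close>

definition caratheodory_solution ::
    "('i, 'm::topological_space, 'e::euclidean_space) atlas \<Rightarrow> nat \<Rightarrow> (nat \<Rightarrow> ('i, 'm, 'e) vfield)
       \<Rightarrow> real \<Rightarrow> (real \<Rightarrow> nat \<Rightarrow> real) \<Rightarrow> 'm \<Rightarrow> (real \<Rightarrow> 'm) \<Rightarrow> bool" where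
  "caratheodory_solution A p Z T u \<xi>0 \<xi> \<longleftrightarrow>
     continuous_on {0..T} \<xi> \<and> \<xi> 0 = \<xi>0 \<and>
     (\<forall>i\<in>charts A. \<forall>a b. 0 \<le> a \<and> a \<le> b \<and> b \<le> T \<and> \<xi> ` {a..b} \<subseteq> chart_dom A i \<longrightarrow>
        (\<lambda>t. \<Sum>j<p. u t j *\<^sub>R Z j i (\<xi> t)) absolutely_integrable_on {a..b} \<and>
        (\<forall>t\<in>{a..b}. chart_map A i (\<xi> t) =
           chart_map A i (\<xi> a) + integral {a..t} (\<lambda>\<tau>. \<Sum>j<p. u \<tau> j *\<^sub>R Z j i (\<xi> \<tau>))))"

definition admissible_controls ::
    "('i, 's::topological_space, 'e::euclidean_space, 'n::finite) swimmer \<Rightarrow> nat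
       \<Rightarrow> (nat \<Rightarrow> ('i, 's, 'e) vfield) \<Rightarrow> real \<Rightarrow> 's set \<Rightarrow> real \<Rightarrow> (real \<Rightarrow> nat \<Rightarrow> real) set" where
  "admissible_controls S p X T K \<delta> =
     {u. Linf_control p T u \<and>
         (\<exists>\<xi>. caratheodory_solution (times_real (shape S)) p (\<lambda>j. lift_field S (X j)) T u
                 (init S, 0) \<xi> \<and>
              (\<forall>t\<in>{0..T}. fst (\<xi> t) \<in> K) \<and> \<xi> T = (init S, \<delta>))}"

text \<open>The value is \<open>\<infinity>\<close> when there is no admissible control.\<close>

definition optimal_cost ::
    "('i, 's::topological_space, 'e::euclidean_space, 'n::finite) swimmer \<Rightarrow> nat
       \<Rightarrow> (nat \<Rightarrow> ('i, 's, 'e) vfield) \<Rightarrow> real \<Rightarrow> 's set \<Rightarrow> real \<Rightarrow> ereal" where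
  "optimal_cost S p X T K \<delta> =
     (INF u\<in>admissible_controls S p X T K \<delta>.
        ereal (LINT t|lebesgue_on {0..T}. L2_set (u t) {..<p}))"

end

theory Submission
  imports Defs
begin

text \<open>
  In the unconstrained case every loop of shapes is allowed, and \<open>\<Phi>(\<delta>)\<close> is the infimum of the lengths
  of the loops \<open>c\<close> at \<open>s\<^sub>i\<close> inside \<open>K\<close> with \<open>\<integral>\<^sub>c L = \<delta>\<close>.  Short loops stay in a small coordinate ball
  around \<open>s\<^sub>i\<close>, where they can be shrunk by the homotheties of ratio \<open>\<mu> \<in> [0,1]\<close> centred at
  \<open>s\<^sub>i\<close>.  In a ball of radius \<open>\<rho>\<close> the metric varies by a factor \<open>1 + O((1 - \<mu>) \<rho>)\<close> between a point and
  its image, so a homothety multiplies the length by at most \<open>\<mu> (1 + (1 - \<mu>) / 2) \<le> 1 - (1 - \<mu>) / 2\<close>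
  once \<open>\<rho>\<close> is small (\<open>cost_scale\<close>).  The displacement \<open>\<integral>\<^sub>c L\<close> is Lipschitz in \<open>\<mu>\<close>, with a
  constant proportional to the length (\<open>holonomy_scale_lipschitz\<close>), and vanishes for \<open>\<mu> = 0\<close>.  By
  the intermediate value theorem a loop of displacement \<open>\<delta>\<^sub>2\<close> shrinks to one of displacement
  \<open>\<delta>\<^sub>1 < \<delta>\<^sub>2\<close> that is shorter by at least \<open>\<kappa> (\<delta>\<^sub>2 - \<delta>\<^sub>1)\<close>, where \<open>\<kappa> > 0\<close> does not depend on the loop
  (\<open>loop_shrink\<close>).  Because of this uniform saving the infima satisfy
  \<open>\<Phi>(\<delta>\<^sub>1) + \<kappa> (\<delta>\<^sub>2 - \<delta>\<^sub>1) \<le> \<Phi>(\<delta>\<^sub>2)\<close> (\<open>optimal_cost_gap\<close>).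

  The argument applies to those \<open>\<delta>\<close> for which \<open>\<Phi>(\<delta>)\<close> is small.  By shrinking again, it is enough to
  have one short loop of positive displacement.  Suppose that all small triangles at \<open>s\<^sub>i\<close> have
  displacement zero.  Then \<open>L\<close> has a primitive near \<open>s\<^sub>i\<close> (\<open>positive_loop_or_primitive\<close>), so \<open>dL = 0\<close>
  near \<open>s\<^sub>i\<close>, and by analyticity and connectedness \<open>dL = 0\<close> everywhere (\<open>closed_everywhere\<close>).  But then
  \<open>L [X, Y] = X (L Y) - Y (L X)\<close>, so that the vector fields of the form \<open>(X, L X)\<close> are stable under
  brackets, and the Lie algebra generated by the lifted fields has dimension at most \<open>dim S\<close> at every
  point (\<open>graph_field_lie_algebra\<close>).  This contradicts the second condition of controllability
  (\<open>controllable_imp_not_closed\<close>).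

  Two translations relate controls and loops.  A loop in the coordinate ball is the trajectory of the
  control whose components are those of its velocity in the frame; that it solves the equation
  in every other chart as well is the chain rule along Lipschitz curves (\<open>loop_admissible\<close>).
  Conversely, the trajectory of a control of small cost cannot leave the ball
  (\<open>admissible_imp_loop\<close>).
\<close>

section \<open>Power series in several variables\<close>

abbreviation multi_indices :: "('a::euclidean_space \<Rightarrow> nat) set" where
  "multi_indices \<equiv> Basis \<rightarrow>\<^sub>E UNIV"

definition monomial_at :: "'a::euclidean_space \<Rightarrow> ('a \<Rightarrow> nat) \<Rightarrow> 'a \<Rightarrow> real" where
  "monomial_at x0 \<alpha> x = (\<Prod>b\<in>Basis. ((x - x0) \<bullet> b) ^ \<alpha> b)"

definition monomial_partial :: "'a::euclidean_space \<Rightarrow> 'a \<Rightarrow> ('a \<Rightarrow> nat) \<Rightarrow> 'a \<Rightarrow> real" where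
  "monomial_partial x0 b \<alpha> x =
     real (\<alpha> b) * ((x - x0) \<bullet> b) ^ (\<alpha> b - 1) * (\<Prod>b'\<in>Basis - {b}. ((x - x0) \<bullet> b') ^ \<alpha> b')"

definition has_power_series ::
    "('a::euclidean_space \<Rightarrow> real) \<Rightarrow> (('a \<Rightarrow> nat) \<Rightarrow> real) \<Rightarrow> 'a \<Rightarrow> real \<Rightarrow> bool" where
  "has_power_series f c x0 r \<longleftrightarrow> r > 0 \<and>
     (\<forall>x\<in>ball x0 r. ((\<lambda>\<alpha>. monomial_at x0 \<alpha> x * c \<alpha>) has_sum f x) multi_indices)"

definition partial_coeffs :: "'a::euclidean_space \<Rightarrow> (('a \<Rightarrow> nat) \<Rightarrow> real) \<Rightarrow> ('a \<Rightarrow> nat) \<Rightarrow> real" where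
  "partial_coeffs b c \<beta> = real (Suc (\<beta> b)) * c (\<beta>(b := Suc (\<beta> b)))"

definition partial_deriv :: "'a::euclidean_space \<Rightarrow> ('a \<Rightarrow> real) \<Rightarrow> 'a \<Rightarrow> real" where
  "partial_deriv b f x = frechet_derivative f (at x) b"

lemma partial_deriv_eqI:
  assumes "(f has_derivative (\<lambda>h. \<Sum>b\<in>Basis. (h \<bullet> b) * G b)) (at x)" and "b \<in> Basis"
  shows "partial_deriv b f x = G b"
proof -
  have "partial_deriv b f x = (\<Sum>b'\<in>Basis. (b \<bullet> b') * G b')"
    unfolding partial_deriv_def frechet_derivative_at[OF assms(1), symmetric] ..
  also have "\<dots> = (\<Sum>b'\<in>Basis. if b' = b then G b' else 0)"
    using assms(2) by (intro sum.cong) (auto simp: inner_Basis)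
  also have "\<dots> = G b"
    using assms(2) by simp
  finally show ?thesis .
qed

lemma monomial_at_has_derivative:
  "(monomial_at x0 \<alpha> has_derivative (\<lambda>h. \<Sum>b\<in>Basis. (h \<bullet> b) * monomial_partial x0 b \<alpha> x)) (at x within S)"
  unfolding monomial_at_def[abs_def]
  by (rule derivative_eq_intros refl | simp)+
     (simp add: monomial_partial_def fun_eq_iff algebra_simps)

lemma infinite_multi_indices: "infinite (multi_indices :: ('a::euclidean_space \<Rightarrow> nat) set)"
proof -
  have "inj (\<lambda>n::nat. (\<lambda>b\<in>Basis. n) :: 'a \<Rightarrow> nat)"
    by (rule injI) (metis nonempty_Basis ex_in_conv restrict_apply')
  then have "infinite (range (\<lambda>n::nat. (\<lambda>b\<in>Basis. n) :: 'a \<Rightarrow> nat))"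
    by (rule range_inj_infinite)
  moreover have "range (\<lambda>n::nat. (\<lambda>b\<in>Basis. n) :: 'a \<Rightarrow> nat) \<subseteq> multi_indices"
    by auto
  ultimately show ?thesis
    using finite_subset by blast
qed

text \<open>
  Halving the radius absorbs the factor produced by differentiation, because \<open>n \<le> 2\<^sup>n\<close>.  Hence
  the differentiated series is dominated on the ball of radius \<open>\<rho>\<close> by the original series at the point
  with coordinates \<open>2 \<rho>\<close>.
\<close>

lemma monomial_partial_bound:
  assumes \<rho>: "\<rho> > 0" and b: "b \<in> Basis" and x: "x \<in> ball x0 \<rho>"
  shows "\<bar>monomial_partial x0 b \<alpha> x\<bar> \<le> (\<Prod>b'\<in>Basis. (2 * \<rho>) ^ \<alpha> b') / \<rho>"
proof -
  have c: "\<bar>(x - x0) \<bullet> b'\<bar> \<le> \<rho>" if "b' \<in> Basis" for b'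
    using Basis_le_norm[OF that, of "x - x0"] x by (simp add: dist_norm norm_minus_commute)
  have 1: "real n * \<rho> ^ (n - 1) \<le> (2 * \<rho>) ^ n / \<rho>" for n
  proof (cases n)
    case (Suc m)
    have "real n \<le> 2 ^ n"
      by (metis less_exp less_imp_le of_nat_le_iff of_nat_numeral of_nat_power)
    then have "real n * \<rho> ^ m \<le> 2 ^ n * \<rho> ^ m"
      using \<rho> by (intro mult_right_mono) auto
    also have "\<dots> = (2 * \<rho>) ^ n / \<rho>"
      using \<rho> Suc by (simp add: power_mult_distrib)
    finally show ?thesis
      using Suc by simp
  qed (use \<rho> in auto)
  have "\<bar>real (\<alpha> b) * ((x - x0) \<bullet> b) ^ (\<alpha> b - 1)\<bar> \<le> real (\<alpha> b) * \<rho> ^ (\<alpha> b - 1)"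
    using c[OF b] by (auto simp: abs_mult power_abs intro!: mult_left_mono power_mono)
  also have "\<dots> \<le> (2 * \<rho>) ^ \<alpha> b / \<rho>"
    by (rule 1)
  finally have A: "\<bar>real (\<alpha> b) * ((x - x0) \<bullet> b) ^ (\<alpha> b - 1)\<bar> \<le> (2 * \<rho>) ^ \<alpha> b / \<rho>" .
  have B: "\<bar>\<Prod>b'\<in>Basis - {b}. ((x - x0) \<bullet> b') ^ \<alpha> b'\<bar> \<le> (\<Prod>b'\<in>Basis - {b}. (2 * \<rho>) ^ \<alpha> b')"
    unfolding abs_prod
  proof (rule prod_mono, safe)
    fix b' :: 'a assume "b' \<in> Basis"
    then show "\<bar>((x - x0) \<bullet> b') ^ \<alpha> b'\<bar> \<le> (2 * \<rho>) ^ \<alpha> b'"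
      unfolding power_abs using c[of b'] \<rho> by (intro power_mono) auto
  qed auto
  have "\<bar>monomial_partial x0 b \<alpha> x\<bar> \<le> ((2 * \<rho>) ^ \<alpha> b / \<rho>) * (\<Prod>b'\<in>Basis - {b}. (2 * \<rho>) ^ \<alpha> b')"
    unfolding monomial_partial_def abs_mult[of "_ * _" "prod _ _"]
    using \<rho> by (intro mult_mono A B) auto
  also have "\<dots> = (\<Prod>b'\<in>Basis. (2 * \<rho>) ^ \<alpha> b') / \<rho>"
    using b by (subst (2) prod.remove[of _ b]) auto
  finally show ?thesis .
qed

lemma monomial_partial_shift:
  assumes "b \<in> Basis"
  shows "monomial_partial x0 b (\<beta>(b := Suc (\<beta> b))) x = real (Suc (\<beta> b)) * monomial_at x0 \<beta> x"
proof -
  have "(\<Prod>b'\<in>Basis - {b}. ((x - x0) \<bullet> b') ^ (\<beta>(b := Suc (\<beta> b))) b') =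
        (\<Prod>b'\<in>Basis - {b}. ((x - x0) \<bullet> b') ^ \<beta> b')"
    by (intro prod.cong) auto
  then show ?thesis
    unfolding monomial_partial_def monomial_at_def
    using assms by (subst (2) prod.remove[of _ b]) auto
qed

text \<open>
  Termwise differentiation.  The series converges absolutely at the corner \<open>z\<close> of a small cube, and
  \<open>monomial_partial_bound\<close> turns this into a summable majorant for the partial derivatives on a
  smaller ball.  Enumerating the multi-indices brings the sum into the form required by
  \<open>has_derivative_series\<close>; the shift \<open>\<beta> \<mapsto> \<beta> + e\<^sub>b\<close> turns the derivative into a power series again.
\<close>

lemma power_series_partials:
  fixes f :: "'a::euclidean_space \<Rightarrow> real"
  assumes f: "has_power_series f c x0 r"
  obtains \<rho> where "\<rho> > 0"
    and "\<And>x. x \<in> ball x0 \<rho> \<Longrightarrow>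
       (f has_derivative (\<lambda>h. \<Sum>b\<in>Basis. (h \<bullet> b) * partial_deriv b f x)) (at x)"
    and "\<And>b. b \<in> Basis \<Longrightarrow> has_power_series (partial_deriv b f) (partial_coeffs b c) x0 \<rho>"
proof -
  define I where "I = (multi_indices :: ('a \<Rightarrow> nat) set)"
  have r: "r > 0"
    and fI: "\<And>x. x \<in> ball x0 r \<Longrightarrow> ((\<lambda>\<alpha>. monomial_at x0 \<alpha> x * c \<alpha>) has_sum f x) I"
    using f by (simp_all add: has_power_series_def I_def)
  \<comment> \<open>The corner \<open>z\<close> of the cube of half side \<open>2 \<rho>\<close> is at distance at most \<open>2 \<rho> DIM('a) = r / 2\<close> from \<open>x0\<close>.\<close>
  define \<rho> where "\<rho> = r / (4 * real DIM('a))"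
  have N: "real DIM('a) \<ge> 1"
    using DIM_positive[where 'a='a] by linarith
  have \<rho>: "\<rho> > 0"
    using r N by (simp add: \<rho>_def)
  have "\<rho> * 1 \<le> \<rho> * (4 * real DIM('a))"
    using \<rho> N by (intro mult_left_mono) linarith+
  then have \<rho>r: "\<rho> \<le> r"
    using N by (simp add: \<rho>_def)
  define z where "z = x0 + (2 * \<rho>) *\<^sub>R (\<Sum>b\<in>Basis. b)"
  have "norm (\<Sum>b\<in>Basis. b :: 'a) \<le> (\<Sum>b\<in>(Basis :: 'a set). 1)"
    by (rule order_trans[OF norm_sum]) (auto intro: sum_mono)
  then have "norm (\<Sum>b\<in>Basis. b :: 'a) \<le> real DIM('a)"
    by simp
  then have "norm (z - x0) \<le> 2 * \<rho> * real DIM('a)"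
    unfolding z_def using \<rho> by (simp add: mult_left_mono)
  also have "\<dots> < r"
    using r N by (simp add: \<rho>_def)
  finally have z: "z \<in> ball x0 r"
    by (simp add: dist_norm norm_minus_commute)
  have zb: "(z - x0) \<bullet> b = 2 * \<rho>" if "b \<in> Basis" for b
    using that by (simp add: z_def inner_sum_left inner_Basis if_distrib sum.delta cong: if_cong)
  define M where "M \<alpha> = \<bar>(\<Prod>b\<in>Basis. (2 * \<rho>) ^ \<alpha> b) * c \<alpha>\<bar>" for \<alpha> :: "'a \<Rightarrow> nat"
  have "(\<lambda>\<alpha>. monomial_at x0 \<alpha> z * c \<alpha>) summable_on I"
    using fI[OF z] unfolding summable_on_def by blast
  then have "(\<lambda>\<alpha>. norm (monomial_at x0 \<alpha> z * c \<alpha>)) summable_on I"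
    by (rule summable_on_iff_abs_summable_on_real[THEN iffD1])
  moreover have "norm (monomial_at x0 \<alpha> z * c \<alpha>) = M \<alpha>" for \<alpha>
    by (simp add: M_def monomial_at_def zb)
  ultimately have M: "M summable_on I"
    by simp
  then have M': "(\<lambda>\<alpha>. M \<alpha> / \<rho>) summable_on I"
    by (simp add: divide_inverse summable_on_cmult_left)
  define D where "D b \<alpha> x = monomial_partial x0 b \<alpha> x * c \<alpha>" for b \<alpha> x
  have bound: "norm (D b \<alpha> x) \<le> M \<alpha> / \<rho>" if "b \<in> Basis" "x \<in> ball x0 \<rho>" for b \<alpha> x
  proof -
    have "norm (D b \<alpha> x) \<le> (\<Prod>b'\<in>Basis. (2 * \<rho>) ^ \<alpha> b') / \<rho> * \<bar>c \<alpha>\<bar>"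
      unfolding D_def real_norm_def abs_mult
      using monomial_partial_bound[OF \<rho> that] by (intro mult_right_mono) auto
    also have "\<dots> = M \<alpha> / \<rho>"
      using \<rho> by (simp add: M_def abs_mult abs_prod)
    finally show ?thesis .
  qed
  define g where "g b x = infsum (\<lambda>\<alpha>. D b \<alpha> x) I" for b x
  have g: "((\<lambda>\<alpha>. D b \<alpha> x) has_sum g b x) I" if "b \<in> Basis" "x \<in> ball x0 \<rho>" for b x
  proof -
    have "(\<lambda>\<alpha>. norm (D b \<alpha> x)) summable_on I"
      using M' bound[OF that] by (rule summable_on_comparison_test) auto
    then have "(\<lambda>\<alpha>. D b \<alpha> x) summable_on I"
      by (rule abs_summable_summable)
    then show ?thesis
      unfolding g_def by (rule has_sum_infsum)
  qed
  \<comment> \<open>Termwise differentiation needs a series indexed by the natural numbers.\<close>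
  obtain e :: "nat \<Rightarrow> 'a \<Rightarrow> nat" where e: "bij_betw e UNIV I"
    using countable_PiE[of "Basis :: 'a set" "\<lambda>_. UNIV :: nat set"] infinite_multi_indices[where 'a='a]
      bij_betw_from_nat_into unfolding I_def by auto
  have sums: "(\<lambda>n. h (e n)) sums s" if "(h has_sum s) I" for h :: "('a \<Rightarrow> nat) \<Rightarrow> real" and s
    using that by (intro has_sum_imp_sums) (simp add: has_sum_reindex_bij_betw[OF e])
  have der: "(f has_derivative (\<lambda>h. \<Sum>b\<in>Basis. (h \<bullet> b) * g b x)) (at x)" if x: "x \<in> ball x0 \<rho>" for x
  proof -
    have "\<exists>G. \<forall>x\<in>ball x0 \<rho>. (\<lambda>n. monomial_at x0 (e n) x * c (e n)) sums (G x) \<and>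
       (G has_derivative (\<lambda>h. \<Sum>b\<in>Basis. (h \<bullet> b) * g b x)) (at x within ball x0 \<rho>)"
    proof (rule has_derivative_series[where x=x0 and l="f x0" and
          f'="\<lambda>n x h. \<Sum>b\<in>Basis. (h \<bullet> b) * D b (e n) x"])
      fix n x
      show "((\<lambda>x. monomial_at x0 (e n) x * c (e n)) has_derivative
              (\<lambda>h. \<Sum>b\<in>Basis. (h \<bullet> b) * D b (e n) x)) (at x within ball x0 \<rho>)"
        by (rule derivative_eq_intros monomial_at_has_derivative refl)+
           (simp add: D_def sum_distrib_right mult.assoc)
    next
      fix \<epsilon> :: real assume \<epsilon>: "\<epsilon> > 0"
      have summ: "summable (\<lambda>n. M (e n) / \<rho>)"
        using sums[OF has_sum_infsum[OF M']] by (rule sums_summable)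
      have ul: "uniform_limit (ball x0 \<rho>) (\<lambda>n x. \<Sum>i<n. D b (e i) x) (g b) sequentially"
        if b: "b \<in> Basis" for b
      proof -
        have "uniform_limit (ball x0 \<rho>) (\<lambda>n x. \<Sum>i<n. D b (e i) x) (\<lambda>x. \<Sum>i. D b (e i) x) sequentially"
          by (rule Weierstrass_m_test[OF _ summ]) (rule bound[OF b])
        also have "?this \<longleftrightarrow> ?thesis"
          using sums[OF g[OF b]] by (intro uniform_limit_cong') (auto simp: sums_iff)
        finally show ?thesis .
      qed
      have "\<forall>\<^sub>F n in sequentially. \<forall>b\<in>Basis. \<forall>x\<in>ball x0 \<rho>.
          dist (\<Sum>i<n. D b (e i) x) (g b x) < \<epsilon> / DIM('a)"
        using uniform_limitD[OF ul, of _ "\<epsilon> / DIM('a)"] \<epsilon> N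
        by (subst eventually_ball_finite_distrib) (auto simp del: mem_ball)
      then show "\<forall>\<^sub>F n in sequentially. \<forall>x\<in>ball x0 \<rho>. \<forall>h.
          norm ((\<Sum>i<n. \<Sum>b\<in>Basis. h \<bullet> b * D b (e i) x) - (\<Sum>b\<in>Basis. h \<bullet> b * g b x)) \<le> \<epsilon> * norm h"
      proof eventually_elim
        case (elim n)
        show ?case
        proof (intro ballI allI)
          fix x h assume x: "x \<in> ball x0 \<rho>"
          have "norm ((\<Sum>i<n. \<Sum>b\<in>Basis. h \<bullet> b * D b (e i) x) - (\<Sum>b\<in>Basis. h \<bullet> b * g b x))
              = norm (\<Sum>b\<in>Basis. h \<bullet> b * ((\<Sum>i<n. D b (e i) x) - g b x))"
            by (subst sum.swap) (simp add: sum_subtractf[symmetric] sum_distrib_left right_diff_distrib)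
          also have "\<dots> \<le> (\<Sum>b\<in>(Basis::'a set). norm h * (\<epsilon> / DIM('a)))"
          proof (rule order_trans[OF norm_sum], rule sum_mono)
            fix b :: 'a assume b: "b \<in> Basis"
            have "norm ((\<Sum>i<n. D b (e i) x) - g b x) \<le> \<epsilon> / DIM('a)"
              using elim b x by (auto simp: dist_norm less_imp_le)
            then show "norm (h \<bullet> b * ((\<Sum>i<n. D b (e i) x) - g b x)) \<le> norm h * (\<epsilon> / DIM('a))"
              unfolding norm_mult using Basis_le_norm[OF b] by (intro mult_mono) auto
          qed
          also have "\<dots> = \<epsilon> * norm h"
            using N by simp
          finally show "norm ((\<Sum>i<n. \<Sum>b\<in>Basis. h \<bullet> b * D b (e i) x) - (\<Sum>b\<in>Basis. h \<bullet> b * g b x)) \<le> \<epsilon> * norm h" .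
        qed
      qed
    next
      show "(\<lambda>n. monomial_at x0 (e n) x0 * c (e n)) sums f x0"
        using sums[OF fI[of x0]] r by simp
    qed (use \<rho> in auto)
    then obtain G where G: "\<forall>x\<in>ball x0 \<rho>. (\<lambda>n. monomial_at x0 (e n) x * c (e n)) sums (G x) \<and>
       (G has_derivative (\<lambda>h. \<Sum>b\<in>Basis. (h \<bullet> b) * g b x)) (at x within ball x0 \<rho>)" ..
    have eq: "G y = f y" if "y \<in> ball x0 \<rho>" for y
    proof -
      have "y \<in> ball x0 r"
        using that \<rho>r by auto
      then show ?thesis
        using bspec[OF G that] sums[OF fI[of y]] sums_unique2 by blast
    qed
    have "(G has_derivative (\<lambda>h. \<Sum>b\<in>Basis. (h \<bullet> b) * g b x)) (at x)"
      using bspec[OF G x] at_within_open[OF x open_ball] by simp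
    then show ?thesis
      by (rule has_derivative_transform_within_open[OF _ open_ball x eq])
  qed
  have pd: "partial_deriv b f x = g b x" if "b \<in> Basis" "x \<in> ball x0 \<rho>" for b x
    by (rule partial_deriv_eqI[OF der]) (use that in auto)
  show ?thesis
  proof (rule that[OF \<rho>])
    show "(f has_derivative (\<lambda>h. \<Sum>b\<in>Basis. (h \<bullet> b) * partial_deriv b f x)) (at x)"
      if x: "x \<in> ball x0 \<rho>" for x
      using der[OF x] by (simp add: pd[OF _ x])
    fix b :: 'a assume b: "b \<in> Basis"
    have bij: "bij_betw (\<lambda>\<beta>. \<beta>(b := Suc (\<beta> b))) I {\<alpha>\<in>I. \<alpha> b > 0}"
      by (rule bij_betwI[where g="\<lambda>\<alpha>. \<alpha>(b := \<alpha> b - 1)"])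
         (use b in \<open>auto simp: I_def PiE_iff extensional_def\<close>)
    have "((\<lambda>\<beta>. monomial_at x0 \<beta> x * partial_coeffs b c \<beta>) has_sum partial_deriv b f x) I"
      if x: "x \<in> ball x0 \<rho>" for x
    proof -
      have "((\<lambda>\<alpha>. D b \<alpha> x) has_sum g b x) {\<alpha>\<in>I. \<alpha> b > 0}"
        using g[OF b x]
        by (rule has_sum_cong_neutral[THEN iffD1, rotated -1]) (auto simp: D_def monomial_partial_def)
      then have "((\<lambda>\<beta>. D b (\<beta>(b := Suc (\<beta> b))) x) has_sum g b x) I"
        by (subst has_sum_reindex_bij_betw[OF bij])
      then show ?thesis
        by (simp add: D_def monomial_partial_shift[OF b] pd[OF b x] partial_coeffs_def mult_ac)
    qed
    then show "has_power_series (partial_deriv b f) (partial_coeffs b c) x0 \<rho>"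
      using \<rho> by (simp add: has_power_series_def I_def)
  qed
qed

section \<open>Derivatives of analytic functions and the identity theorem\<close>

lemma real_analytic_on_iff_power_series:
  fixes f :: "'a::euclidean_space \<Rightarrow> real"
  shows "f real_analytic_on U \<longleftrightarrow> (\<forall>x0\<in>U. \<exists>r c. has_power_series f c x0 r)"
  unfolding real_analytic_on_def has_power_series_def monomial_at_def real_scaleR_def by blast

text \<open>
  Analyticity on \<open>U\<close> provides an expansion at every point of \<open>U\<close>; differentiating each one around its
  own centre gives the expansions of the partial derivatives.
\<close>

lemma real_analytic_on_partial_deriv:
  fixes f :: "'a::euclidean_space \<Rightarrow> real"
  assumes f: "f real_analytic_on U"
  shows real_analytic_on_has_derivative:
      "x \<in> U \<Longrightarrow> (f has_derivative (\<lambda>h. \<Sum>b\<in>Basis. (h \<bullet> b) * partial_deriv b f x)) (at x)"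
    and "b \<in> Basis \<Longrightarrow> partial_deriv b f real_analytic_on U"
proof -
  have local: "\<exists>\<rho>>0. \<exists>c. (\<forall>x\<in>ball x0 \<rho>.
      (f has_derivative (\<lambda>h. \<Sum>b\<in>Basis. (h \<bullet> b) * partial_deriv b f x)) (at x)) \<and>
      (\<forall>b\<in>Basis. has_power_series (partial_deriv b f) (partial_coeffs b c) x0 \<rho>)"
    if x0: "x0 \<in> U" for x0
  proof -
    obtain r c where c: "has_power_series f c x0 r"
      using f x0 unfolding real_analytic_on_iff_power_series by blast
    show ?thesis
      by (rule power_series_partials[OF c]) blast
  qed
  show "(f has_derivative (\<lambda>h. \<Sum>b\<in>Basis. (h \<bullet> b) * partial_deriv b f x)) (at x)" if "x \<in> U"
    using local[OF that] centre_in_ball by blast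
  show "partial_deriv b f real_analytic_on U" if "b \<in> Basis"
    unfolding real_analytic_on_iff_power_series using local that by blast
qed

lemma real_analytic_on_imp_continuous_on:
  fixes f :: "'a::euclidean_space \<Rightarrow> real"
  assumes "f real_analytic_on U"
  shows "continuous_on U f"
  using real_analytic_on_has_derivative[OF assms]
  by (meson continuous_at_imp_continuous_on has_derivative_continuous)

lemma real_analytic_on_fold_partial_deriv:
  fixes f :: "'a::euclidean_space \<Rightarrow> real"
  assumes "f real_analytic_on U" "set bs \<subseteq> Basis"
  shows "fold partial_deriv bs f real_analytic_on U"
  using assms by (induction bs arbitrary: f) (auto intro: real_analytic_on_partial_deriv)

lemma fold_partial_deriv_zero:
  fixes f :: "'a::euclidean_space \<Rightarrow> real"
  assumes "open V" "\<And>x. x \<in> V \<Longrightarrow> f x = 0" "x \<in> V"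
  shows "fold partial_deriv bs f x = 0"
  using assms(2)
proof (induction bs arbitrary: f)
  case (Cons b bs)
  have "partial_deriv b f y = 0" if "y \<in> V" for y
  proof -
    have "(f has_derivative (\<lambda>_. 0)) (at y)"
      by (rule has_derivative_transform_within_open[OF has_derivative_const[of 0] assms(1) that])
         (simp add: Cons.prems)
    then show ?thesis
      unfolding partial_deriv_def by (simp add: frechet_derivative_at[symmetric])
  qed
  then show ?case
    using Cons.IH by simp
qed (use assms(3) in simp)

text \<open>
  Induction on the degree of \<open>\<alpha>\<close>: the constant coefficient is the value at \<open>x0\<close>, and the
  coefficients of higher degree are, up to positive factors, coefficients of partial derivatives.
\<close>

lemma power_series_coeffs_eq_0:
  fixes f :: "'a::euclidean_space \<Rightarrow> real"
  assumes "has_power_series f c x0 r"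
    and "\<And>bs. set bs \<subseteq> Basis \<Longrightarrow> fold partial_deriv bs f x0 = 0"
    and "\<alpha> \<in> multi_indices"
  shows "c \<alpha> = 0"
  using assms
proof (induction "\<Sum>b\<in>Basis. \<alpha> b" arbitrary: f c r \<alpha>)
  case 0
  have \<alpha>0: "\<alpha> b = 0" if "b \<in> Basis" for b
    using 0(1) that by simp
  have mon: "monomial_at x0 \<beta> x0 = 0" if "\<beta> \<in> multi_indices - {\<alpha>}" for \<beta>
  proof -
    have "\<exists>b\<in>Basis. \<beta> b \<noteq> 0"
      using that \<alpha>0 0(4) by (metis DiffE PiE_ext insertCI)
    then show ?thesis
      unfolding monomial_at_def by (auto simp: power_0_left intro!: prod_zero)
  qed
  have "((\<lambda>\<beta>. monomial_at x0 \<beta> x0 * c \<beta>) has_sum f x0) multi_indices"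
    using 0(2) by (simp add: has_power_series_def)
  then have "((\<lambda>\<beta>. monomial_at x0 \<beta> x0 * c \<beta>) has_sum f x0) {\<alpha>}"
    by (rule has_sum_cong_neutral[THEN iffD1, rotated -1]) (use mon 0(4) in auto)
  moreover have "((\<lambda>\<beta>. monomial_at x0 \<beta> x0 * c \<beta>) has_sum (monomial_at x0 \<alpha> x0 * c \<alpha>)) {\<alpha>}"
    using has_sum_finite[of "{\<alpha>}" "\<lambda>\<beta>. monomial_at x0 \<beta> x0 * c \<beta>"] by simp
  ultimately have "f x0 = monomial_at x0 \<alpha> x0 * c \<alpha>"
    using has_sum_unique by blast
  moreover have "monomial_at x0 \<alpha> x0 = 1"
    by (simp add: monomial_at_def \<alpha>0)
  moreover have "f x0 = 0"
    using 0(3)[of "[]"] by simp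
  ultimately show ?case
    by simp
next
  case (Suc n)
  from Suc(2) obtain b where b: "b \<in> Basis" "\<alpha> b > 0"
    by (metis gr0I sum.neutral nat.distinct(1))
  define \<beta> where "\<beta> = \<alpha>(b := \<alpha> b - 1)"
  have \<alpha>: "\<alpha> = \<beta>(b := Suc (\<beta> b))"
    using b by (auto simp: \<beta>_def)
  have \<beta>: "\<beta> \<in> multi_indices"
    using Suc(5) b by (auto simp: \<beta>_def PiE_iff extensional_def)
  have "(\<Sum>b'\<in>Basis. \<alpha> b') = Suc (\<Sum>b'\<in>Basis. \<beta> b')"
    using b by (simp add: \<beta>_def sum.remove[of Basis b])
  then have n: "n = (\<Sum>b'\<in>Basis. \<beta> b')"
    using Suc(2) by simp
  obtain \<rho> where \<rho>: "has_power_series (partial_deriv b f) (partial_coeffs b c) x0 \<rho>"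
    by (rule power_series_partials[OF Suc(3)]) (use b in blast)
  have "fold partial_deriv bs (partial_deriv b f) x0 = 0" if "set bs \<subseteq> Basis" for bs
    using Suc(4)[of "b # bs"] b that by simp
  then have "partial_coeffs b c \<beta> = 0"
    by (rule Suc.hyps(1)[OF n \<rho> _ \<beta>])
  then show ?case
    by (simp add: partial_coeffs_def \<alpha>[symmetric])
qed

text \<open>
  The set of points at which all iterated partial derivatives vanish is closed by continuity and open
  because the power series at such a point is zero.
\<close>

lemma real_analytic_identity:
  fixes f :: "'a::euclidean_space \<Rightarrow> real"
  assumes f: "f real_analytic_on U" and U: "open U" "connected U"
    and V: "open V" "V \<noteq> {}" "V \<subseteq> U" and zero: "\<And>x. x \<in> V \<Longrightarrow> f x = 0"
    and x: "x \<in> U"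
  shows "f x = 0"
proof -
  define P where "P = {x\<in>U. \<forall>bs\<in>lists Basis. fold partial_deriv bs f x = 0}"
  have "closedin (top_of_set U) {x\<in>U. fold partial_deriv bs f x = 0}" if "bs \<in> lists Basis" for bs
    using that
    by (intro continuous_closedin_preimage_constant real_analytic_on_imp_continuous_on
        real_analytic_on_fold_partial_deriv f) auto
  then have "closedin (top_of_set U) (\<Inter>bs\<in>lists Basis. {x\<in>U. fold partial_deriv bs f x = 0})"
    by (intro closedin_INT) auto
  moreover have "(\<Inter>bs\<in>lists Basis. {x\<in>U. fold partial_deriv bs f x = 0}) = P"
    unfolding P_def by (auto intro: lists.Nil)
  ultimately have closed: "closedin (top_of_set U) P"
    by simp
  have "\<exists>e>0. ball x0 e \<subseteq> P" if x0: "x0 \<in> P" for x0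
  proof -
    have "x0 \<in> U"
      using x0 by (simp add: P_def)
    then obtain r c where ps: "has_power_series f c x0 r"
      using f unfolding real_analytic_on_iff_power_series by blast
    then have r: "r > 0"
      and c: "\<And>x. x \<in> ball x0 r \<Longrightarrow> ((\<lambda>\<alpha>. monomial_at x0 \<alpha> x * c \<alpha>) has_sum f x) multi_indices"
      by (simp_all add: has_power_series_def)
    obtain e where e: "e > 0" "ball x0 e \<subseteq> U"
      using U(1) \<open>x0 \<in> U\<close> open_contains_ball by blast
    have c0: "c \<alpha> = 0" if "\<alpha> \<in> multi_indices" for \<alpha>
      using x0 by (intro power_series_coeffs_eq_0[OF ps _ that]) (auto simp: P_def in_lists_conv_set)
    have "f x = 0" if "x \<in> ball x0 r" for x
    proof -
      have "((\<lambda>\<alpha>. monomial_at x0 \<alpha> x * c \<alpha>) has_sum 0) multi_indices"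
        by (rule has_sum_0) (simp add: c0)
      then show ?thesis
        using has_sum_unique c[OF that] by blast
    qed
    then have "fold partial_deriv bs f x = 0" if "x \<in> ball x0 (min e r)" for bs x
      by (rule fold_partial_deriv_zero[OF open_ball[of x0 "min e r"]]) (use that in auto)
    then have "ball x0 (min e r) \<subseteq> P"
      using e by (auto simp: P_def)
    then show ?thesis
      using e r by (intro exI[of _ "min e r"]) auto
  qed
  then have "open P"
    by (simp add: open_contains_ball)
  then have "openin (top_of_set U) P"
    by (rule open_openin_trans[OF U(1)]) (auto simp: P_def)
  moreover have "P \<noteq> {}"
  proof -
    obtain v where "v \<in> V"
      using V(2) by blast
    then have "v \<in> P"
      using V(3) fold_partial_deriv_zero[OF V(1) zero] by (auto simp: P_def)
    then show ?thesis
      by blast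
  qed
  ultimately have "P = U"
    using U(2) closed unfolding connected_clopen by blast
  then have "x \<in> P"
    using x by simp
  then show ?thesis
    by (auto simp: P_def dest!: bspec[where x="[]"])
qed

section \<open>The algebra generated by the analytic functions\<close>

lemma linear_basis_expansion:
  fixes F :: "'a::euclidean_space \<Rightarrow> 'b::real_vector"
  assumes "linear F"
  shows "(\<Sum>b\<in>Basis. (v \<bullet> b) *\<^sub>R F b) = F v"
proof -
  have "F (\<Sum>b\<in>Basis. (v \<bullet> b) *\<^sub>R b) = (\<Sum>b\<in>Basis. (v \<bullet> b) *\<^sub>R F b)"
    by (simp add: linear_sum[OF assms] linear_scale[OF assms])
  then show ?thesis
    by (simp add: euclidean_representation)
qed

lemma linear_norm_le_basis_sum:
  fixes F :: "'a::euclidean_space \<Rightarrow> 'b::real_normed_vector"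
  assumes F: "linear F" and c: "\<And>b. b \<in> Basis \<Longrightarrow> norm (F b) \<le> c b"
  shows "norm (F v) \<le> (\<Sum>b\<in>Basis. c b) * norm v"
proof -
  have "norm (F v) \<le> (\<Sum>b\<in>Basis. norm ((v \<bullet> b) *\<^sub>R F b))"
    unfolding linear_basis_expansion[OF F, of v, symmetric] by (rule norm_sum)
  also have "\<dots> \<le> (\<Sum>b\<in>Basis. norm v * c b)"
    unfolding norm_scaleR using Basis_le_norm[of _ v] c by (intro sum_mono mult_mono) auto
  finally show ?thesis
    by (simp add: sum_distrib_left mult.commute)
qed

text \<open>
  Iterated Lie brackets and metric coefficients in a frame are polynomials in analytic functions and
  their derivatives.  What they need is a class of differentiable functions that is stable under sums,
  products and partial derivatives; by the product rule, the functions generated from the analytic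
  ones by sums and products form such a class.
\<close>

inductive_set analytic_algebra :: "'a::euclidean_space set \<Rightarrow> ('a \<Rightarrow> real) set" for U where
  analytic: "f real_analytic_on U \<Longrightarrow> f \<in> analytic_algebra U"
| const: "(\<lambda>x. a) \<in> analytic_algebra U"
| add: "f \<in> analytic_algebra U \<Longrightarrow> g \<in> analytic_algebra U \<Longrightarrow> (\<lambda>x. f x + g x) \<in> analytic_algebra U"
| mult: "f \<in> analytic_algebra U \<Longrightarrow> g \<in> analytic_algebra U \<Longrightarrow> (\<lambda>x. f x * g x) \<in> analytic_algebra U"

lemma analytic_algebra_sum:
  "(\<And>i. i \<in> I \<Longrightarrow> f i \<in> analytic_algebra U) \<Longrightarrow> (\<lambda>x. \<Sum>i\<in>I. f i x) \<in> analytic_algebra U"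
  by (induction I rule: infinite_finite_induct)
     (auto intro: analytic_algebra.const[of 0] analytic_algebra.add)

lemma analytic_algebra_diff:
  assumes "f \<in> analytic_algebra U" "g \<in> analytic_algebra U"
  shows "(\<lambda>x. f x - g x) \<in> analytic_algebra U"
  using analytic_algebra.add[OF assms(1) analytic_algebra.mult[OF analytic_algebra.const[of "-1"] assms(2)]]
  by simp

lemma analytic_algebra_derivative:
  assumes "f \<in> analytic_algebra U"
  obtains F where "\<And>x. x \<in> U \<Longrightarrow> (f has_derivative F x) (at x)"
    and "\<And>v. (\<lambda>x. F x v) \<in> analytic_algebra U"
proof -
  have "\<exists>F. (\<forall>x\<in>U. (f has_derivative F x) (at x)) \<and> (\<forall>v. (\<lambda>x. F x v) \<in> analytic_algebra U)"
    using assms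
  proof induction
    case (analytic f)
    show ?case
      by (intro exI[of _ "\<lambda>x h. \<Sum>b\<in>Basis. (h \<bullet> b) * partial_deriv b f x"] conjI ballI allI
          real_analytic_on_has_derivative[OF analytic] analytic_algebra_sum
          analytic_algebra.mult analytic_algebra.const
          analytic_algebra.analytic real_analytic_on_partial_deriv[OF analytic])
  next
    case (const a)
    show ?case
      by (intro exI[of _ "\<lambda>x h. 0"] conjI ballI allI analytic_algebra.const) simp
  next
    case (add f g)
    then obtain F G where "\<forall>x\<in>U. (f has_derivative F x) (at x)" "\<forall>v. (\<lambda>x. F x v) \<in> analytic_algebra U"
      "\<forall>x\<in>U. (g has_derivative G x) (at x)" "\<forall>v. (\<lambda>x. G x v) \<in> analytic_algebra U"
      by blast
    then show ?case
      by (intro exI[of _ "\<lambda>x h. F x h + G x h"])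
         (auto intro!: derivative_intros analytic_algebra.add)
  next
    case (mult f g)
    then obtain F G where "\<forall>x\<in>U. (f has_derivative F x) (at x)" "\<forall>v. (\<lambda>x. F x v) \<in> analytic_algebra U"
      "\<forall>x\<in>U. (g has_derivative G x) (at x)" "\<forall>v. (\<lambda>x. G x v) \<in> analytic_algebra U"
      by blast
    then show ?case
      using mult.hyps
      by (intro exI[of _ "\<lambda>x h. f x * G x h + F x h * g x"])
         (auto intro!: derivative_intros analytic_algebra.add analytic_algebra.mult)
  qed
  then show ?thesis
    using that by blast
qed

lemma analytic_algebra_continuous_on:
  assumes "f \<in> analytic_algebra U"
  shows "continuous_on U f"
  using analytic_algebra_derivative[OF assms]
  by (metis continuous_at_imp_continuous_on has_derivative_continuous)

lemma analytic_algebra_lipschitz: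
  assumes f: "f \<in> analytic_algebra U" and B: "cball x0 R \<subseteq> U"
  obtains C where "C \<ge> 0"
    "\<And>x y. x \<in> cball x0 R \<Longrightarrow> y \<in> cball x0 R \<Longrightarrow> \<bar>f x - f y\<bar> \<le> C * norm (x - y)"
proof -
  obtain F where F: "\<And>x. x \<in> U \<Longrightarrow> (f has_derivative F x) (at x)"
    "\<And>v. (\<lambda>x. F x v) \<in> analytic_algebra U"
    using analytic_algebra_derivative[OF f] by blast
  have "\<exists>c. \<forall>x\<in>cball x0 R. \<bar>F x b\<bar> \<le> c" for b
  proof -
    have "continuous_on (cball x0 R) (\<lambda>x. F x b)"
      by (rule continuous_on_subset[OF analytic_algebra_continuous_on[OF F(2)] B])
    then have "bounded ((\<lambda>x. F x b) ` cball x0 R)"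
      by (intro compact_imp_bounded compact_continuous_image compact_cball)
    then show ?thesis
      unfolding bounded_iff by auto
  qed
  then obtain c where c: "\<And>b x. x \<in> cball x0 R \<Longrightarrow> \<bar>F x b\<bar> \<le> c b"
    by metis
  define C where "C = (\<Sum>b\<in>Basis. \<bar>c b\<bar>)"
  have "norm (f x - f y) \<le> C * norm (x - y)" if xy: "x \<in> cball x0 R" "y \<in> cball x0 R" for x y
  proof (rule differentiable_bound[OF convex_cball _ _ xy, of f F])
    fix z assume z: "z \<in> cball x0 R"
    then show "(f has_derivative F z) (at z within cball x0 R)"
      using F(1) B has_derivative_at_withinI by blast
    have "linear (F z)"
      using F(1)[of z] z B by (intro has_derivative_linear) blast
    moreover have "norm (F z b) \<le> \<bar>c b\<bar>" for b
      using c[OF z, of b] by simp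
    ultimately have "norm (F z h) \<le> C * norm h" for h
      unfolding C_def by (rule linear_norm_le_basis_sum)
    then show "onorm (F z) \<le> C"
      by (rule onorm_le)
  qed
  moreover have "C \<ge> 0"
    by (simp add: C_def sum_nonneg)
  ultimately show ?thesis
    using that by simp
qed

text \<open>
  Two applications of the mean value theorem, first in the direction \<open>v\<close> and then in the direction
  \<open>w\<close>.  The left-hand side is symmetric in \<open>v\<close> and \<open>w\<close>, which yields the symmetry of second
  derivatives below.
\<close>

lemma second_difference_mean_value:
  fixes f :: "'a::real_normed_vector \<Rightarrow> real"
  assumes h: "h > 0" and U: "cball x (h * (norm v + norm w)) \<subseteq> U"
    and f: "\<And>y. y \<in> U \<Longrightarrow> (f has_derivative f' y) (at y)"
    and f': "\<And>y. y \<in> U \<Longrightarrow> ((\<lambda>y. f' y v) has_derivative F y) (at y)"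
  shows "\<exists>z\<in>cball x (h * (norm v + norm w)).
     f (x + h *\<^sub>R v + h *\<^sub>R w) - f (x + h *\<^sub>R v) - f (x + h *\<^sub>R w) + f x = h * h * F z w"
proof -
  have inU: "x + s *\<^sub>R v + t *\<^sub>R w \<in> cball x (h * (norm v + norm w))" if "0 \<le> s" "s \<le> h" "0 \<le> t" "t \<le> h" for s t
  proof -
    have "norm (s *\<^sub>R v + t *\<^sub>R w) \<le> s * norm v + t * norm w"
      using norm_triangle_ineq[of "s *\<^sub>R v" "t *\<^sub>R w"] that by simp
    also have "\<dots> \<le> h * norm v + h * norm w"
      using that by (intro add_mono mult_right_mono) auto
    finally show ?thesis
      by (simp add: dist_norm algebra_simps norm_minus_commute flip: norm_minus_cancel[of "- _ - _"])
  qed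
  have lin: "F' (s *\<^sub>R u) = s * F' u" if "(g has_derivative F') (at y)" for g and F' :: "'a \<Rightarrow> real" and y s u
    using has_derivative_bounded_linear[OF that] by (simp add: linear_simps)
  define \<phi> where "\<phi> s = f (x + s *\<^sub>R v + h *\<^sub>R w) - f (x + s *\<^sub>R v + 0 *\<^sub>R w)" for s
  have "\<exists>z. 0 < z \<and> z < h \<and>
     \<phi> h - \<phi> 0 = (h - 0) * (f' (x + z *\<^sub>R v + h *\<^sub>R w) v - f' (x + z *\<^sub>R v + 0 *\<^sub>R w) v)"
  proof (rule MVT2[OF h])
    fix s assume s: "0 \<le> s" "s \<le> h"
    have "((\<lambda>s. f (x + s *\<^sub>R v + t *\<^sub>R w)) has_real_derivative f' (x + s *\<^sub>R v + t *\<^sub>R w) v) (at s)"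
      if "0 \<le> t" "t \<le> h" for t
    proof -
      have fd: "(f has_derivative f' (x + s *\<^sub>R v + t *\<^sub>R w)) (at (x + s *\<^sub>R v + t *\<^sub>R w))"
        using f inU[OF s that] U by blast
      have "((\<lambda>s. x + s *\<^sub>R v + t *\<^sub>R w) has_derivative (\<lambda>k. k *\<^sub>R v)) (at s)"
        by (auto intro!: derivative_eq_intros)
      from has_derivative_compose[OF this fd] show ?thesis
        unfolding has_field_derivative_def using lin[OF fd] by (simp add: mult.commute[of _ "f' _ _"])
    qed
    from DERIV_diff[OF this[of h] this[of 0]]
    show "(\<phi> has_real_derivative f' (x + s *\<^sub>R v + h *\<^sub>R w) v - f' (x + s *\<^sub>R v + 0 *\<^sub>R w) v) (at s)"
      using h by (simp add: \<phi>_def[abs_def])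
  qed
  then obtain \<sigma> where \<sigma>: "0 < \<sigma>" "\<sigma> < h"
    "f (x + h *\<^sub>R v + h *\<^sub>R w) - f (x + h *\<^sub>R v) - f (x + h *\<^sub>R w) + f x =
      h * (f' (x + \<sigma> *\<^sub>R v + h *\<^sub>R w) v - f' (x + \<sigma> *\<^sub>R v + 0 *\<^sub>R w) v)"
    by (auto simp: \<phi>_def)
  have "\<exists>z. 0 < z \<and> z < h \<and>
     (\<lambda>t. f' (x + \<sigma> *\<^sub>R v + t *\<^sub>R w) v) h - (\<lambda>t. f' (x + \<sigma> *\<^sub>R v + t *\<^sub>R w) v) 0
     = (h - 0) * (F (x + \<sigma> *\<^sub>R v + z *\<^sub>R w) w)"
  proof (rule MVT2[OF h])
    fix t assume t: "0 \<le> t" "t \<le> h"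
    have fd: "((\<lambda>y. f' y v) has_derivative F (x + \<sigma> *\<^sub>R v + t *\<^sub>R w)) (at (x + \<sigma> *\<^sub>R v + t *\<^sub>R w))"
      using f' inU[of \<sigma> t] \<sigma> t U by auto
    have "((\<lambda>t. x + \<sigma> *\<^sub>R v + t *\<^sub>R w) has_derivative (\<lambda>k. k *\<^sub>R w)) (at t)"
      by (auto intro!: derivative_eq_intros)
    from has_derivative_compose[OF this fd]
    show "((\<lambda>t. f' (x + \<sigma> *\<^sub>R v + t *\<^sub>R w) v) has_real_derivative F (x + \<sigma> *\<^sub>R v + t *\<^sub>R w) w) (at t)"
      unfolding has_field_derivative_def using lin[OF fd] by (simp add: mult.commute[of _ "F _ _"])
  qed
  then obtain \<tau> where \<tau>: "0 < \<tau>" "\<tau> < h"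
    "f' (x + \<sigma> *\<^sub>R v + h *\<^sub>R w) v - f' (x + \<sigma> *\<^sub>R v + 0 *\<^sub>R w) v = h * F (x + \<sigma> *\<^sub>R v + \<tau> *\<^sub>R w) w"
    by auto
  show ?thesis
    using inU[of \<sigma> \<tau>] \<sigma> \<tau> by (intro bexI[of _ "x + \<sigma> *\<^sub>R v + \<tau> *\<^sub>R w"]) auto
qed

lemma symmetric_second_derivative:
  fixes f :: "'a::real_normed_vector \<Rightarrow> real"
  assumes U: "open U" "x \<in> U"
    and f: "\<And>y. y \<in> U \<Longrightarrow> (f has_derivative f' y) (at y)"
    and f': "\<And>y v. y \<in> U \<Longrightarrow> ((\<lambda>y. f' y v) has_derivative F v y) (at y)"
    and cont: "\<And>v w. continuous_on U (\<lambda>y. F v y w)"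
  shows "F v x w = F w x v"
proof (rule ccontr)
  assume ne: "F v x w \<noteq> F w x v"
  define e where "e = \<bar>F v x w - F w x v\<bar> / 2"
  have e: "e > 0"
    using ne by (simp add: e_def)
  have "isCont (\<lambda>y. F v y w) x" "isCont (\<lambda>y. F w y v) x"
    using cont U continuous_on_eq_continuous_at by blast+
  then obtain d1 d2 where d: "d1 > 0" "\<And>y. dist y x < d1 \<Longrightarrow> dist (F v y w) (F v x w) < e"
     "d2 > 0" "\<And>y. dist y x < d2 \<Longrightarrow> dist (F w y v) (F w x v) < e"
    unfolding continuous_at_eps_delta using e by (metis dist_commute)
  obtain d3 where d3: "d3 > 0" "ball x d3 \<subseteq> U"
    using U open_contains_ball by blast
  define d where "d = min d1 (min d2 d3)"
  have dpos: "d > 0"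
    using d d3 by (simp add: d_def)
  \<comment> \<open>The summand 1 only excludes a division by zero when \<open>v = w = 0\<close>.\<close>
  define m where "m = norm v + norm w + 1"
  define h where "h = d / (2 * m)"
  have nn: "m > 0"
    unfolding m_def by (smt (verit) norm_ge_zero)
  have h: "h > 0"
    using dpos nn by (simp add: h_def)
  have "h * (norm v + norm w) \<le> h * m"
    using h by (simp add: m_def)
  also have "\<dots> = d / 2"
    using nn by (simp add: h_def)
  also have "\<dots> < d"
    using dpos by simp
  finally have hd: "h * (norm v + norm w) < d" .
  then have sub: "cball x (h * (norm v + norm w)) \<subseteq> ball x d"
    by auto
  then have subU: "cball x (h * (norm v + norm w)) \<subseteq> U"
    using subset_ball[of d d3 x] d3(2) unfolding d_def by force
  obtain z where z: "z \<in> ball x d"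
     "f (x + h *\<^sub>R v + h *\<^sub>R w) - f (x + h *\<^sub>R v) - f (x + h *\<^sub>R w) + f x = h * h * F v z w"
    using second_difference_mean_value[OF h subU f f'] sub by blast
  obtain z' where z': "z' \<in> ball x d"
     "f (x + h *\<^sub>R w + h *\<^sub>R v) - f (x + h *\<^sub>R w) - f (x + h *\<^sub>R v) + f x = h * h * F w z' v"
    using second_difference_mean_value[of h x w v U, OF h _ f f'] subU sub
    unfolding add.commute[of "norm w"] by blast
  have eq: "x + h *\<^sub>R w + h *\<^sub>R v = x + h *\<^sub>R v + h *\<^sub>R w"
    by simp
  have "h * h * F v z w = h * h * F w z' v"
    using z(2) z'(2)[unfolded eq] by linarith
  then have "F v z w = F w z' v"
    using h by simp
  moreover have "\<bar>F v z w - F v x w\<bar> < e"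
    using d(2)[of z] z(1) by (simp add: d_def dist_commute dist_real_def)
  moreover have "\<bar>F w z' v - F w x v\<bar> < e"
    using d(4)[of z'] z'(1) by (simp add: d_def dist_commute dist_real_def)
  ultimately show False
    unfolding e_def by (simp add: abs_if field_simps split: if_splits)
qed

section \<open>Curves with bounded measurable velocity\<close>

definition bounded_measurable :: "real \<Rightarrow> (real \<Rightarrow> 'b::euclidean_space) \<Rightarrow> bool" where
  "bounded_measurable T w \<longleftrightarrow>
     w \<in> borel_measurable (lebesgue_on {0..T}) \<and> (\<exists>B. \<forall>t\<in>{0..T}. norm (w t) \<le> B)"

lemma bounded_measurable_continuous:
  "continuous_on {0..T} f \<Longrightarrow> bounded_measurable T f"
  unfolding bounded_measurable_def
  using compact_imp_bounded[OF compact_continuous_image[OF _ compact_Icc], of 0 T f]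
  by (auto simp: bounded_iff intro: continuous_imp_measurable_on_sets_lebesgue)

lemma bounded_measurable_scaleR:
  assumes "bounded_measurable T f" "bounded_measurable T g"
  shows "bounded_measurable T (\<lambda>t. f t *\<^sub>R g t)"
proof -
  obtain A B where "\<forall>t\<in>{0..T}. norm (f t) \<le> A" "\<forall>t\<in>{0..T}. norm (g t) \<le> B"
    using assms unfolding bounded_measurable_def by blast
  then have "\<forall>t\<in>{0..T}. norm (f t *\<^sub>R g t) \<le> A * B"
    by (auto intro!: mult_mono intro: order_trans[OF abs_ge_zero])
  then show ?thesis
    using assms unfolding bounded_measurable_def by auto
qed

lemma bounded_measurable_cmul:
  "bounded_measurable T f \<Longrightarrow> bounded_measurable T (\<lambda>t. c *\<^sub>R f t)"
  by (rule bounded_measurable_scaleR) (simp add: bounded_measurable_continuous)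

lemma bounded_measurable_add:
  assumes "bounded_measurable T f" "bounded_measurable T g"
  shows "bounded_measurable T (\<lambda>t. f t + g t)"
proof -
  obtain A B where "\<forall>t\<in>{0..T}. norm (f t) \<le> A" "\<forall>t\<in>{0..T}. norm (g t) \<le> B"
    using assms unfolding bounded_measurable_def by blast
  then have "\<forall>t\<in>{0..T}. norm (f t + g t) \<le> A + B"
    by (auto intro!: norm_triangle_mono)
  then show ?thesis
    using assms unfolding bounded_measurable_def by auto
qed

lemma bounded_measurable_sum:
  "(\<And>i. i \<in> I \<Longrightarrow> bounded_measurable T (f i)) \<Longrightarrow> bounded_measurable T (\<lambda>t. \<Sum>i\<in>I. f i t)"
  by (induction I rule: infinite_finite_induct)
     (auto intro: bounded_measurable_add bounded_measurable_continuous)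

lemma bounded_measurable_inner:
  assumes "bounded_measurable T f"
  shows "bounded_measurable T (\<lambda>t. f t \<bullet> b)"
proof -
  obtain A where "\<forall>t\<in>{0..T}. norm (f t) \<le> A"
    using assms unfolding bounded_measurable_def by blast
  then have "\<forall>t\<in>{0..T}. norm (f t \<bullet> b) \<le> A * norm b"
    using Cauchy_Schwarz_ineq2 by (fastforce intro: order_trans mult_right_mono)
  then show ?thesis
    using assms unfolding bounded_measurable_def by auto
qed

lemma borel_measurable_L2_set:
  assumes "\<And>k. k < p \<Longrightarrow> f k \<in> borel_measurable M"
  shows "(\<lambda>t. L2_set (\<lambda>k. f k t) {..<p :: nat}) \<in> borel_measurable M"
proof -
  have "(\<lambda>t. \<Sum>k<p. (f k t)\<^sup>2) \<in> borel_measurable M"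
    using assms by (intro borel_measurable_sum borel_measurable_power) auto
  moreover have "sqrt \<in> borel_measurable borel"
    by (intro borel_measurable_continuous_onI continuous_intros)
  ultimately show ?thesis
    unfolding L2_set_def by (rule measurable_compose)
qed

lemma bounded_measurable_L2_set:
  assumes "\<And>k. k < p \<Longrightarrow> bounded_measurable T (f k)"
  shows "bounded_measurable T (\<lambda>t. L2_set (\<lambda>k. f k t) {..<p :: nat})"
proof -
  have "\<forall>k\<in>{..<p}. \<exists>B. \<forall>t\<in>{0..T}. norm (f k t) \<le> B"
    using assms unfolding bounded_measurable_def by blast
  then obtain B where B: "\<And>k t. k < p \<Longrightarrow> t \<in> {0..T} \<Longrightarrow> norm (f k t) \<le> B k"
    by (metis lessThan_iff)
  have "norm (L2_set (\<lambda>k. f k t) {..<p}) \<le> (\<Sum>k<p. B k)" if "t \<in> {0..T}" for t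
  proof -
    have "norm (L2_set (\<lambda>k. f k t) {..<p}) \<le> (\<Sum>k<p. \<bar>f k t\<bar>)"
      by (simp add: L2_set_le_sum_abs)
    also have "\<dots> \<le> (\<Sum>k<p. B k)"
      using B that by (intro sum_mono) auto
    finally show ?thesis .
  qed
  moreover have "(\<lambda>t. L2_set (\<lambda>k. f k t) {..<p}) \<in> borel_measurable (lebesgue_on {0..T})"
    using assms by (intro borel_measurable_L2_set) (simp add: bounded_measurable_def)
  ultimately show ?thesis
    unfolding bounded_measurable_def by blast
qed

lemma bounded_measurable_absolutely_integrable:
  assumes "bounded_measurable T w" "0 \<le> a" "b \<le> T"
  shows "w absolutely_integrable_on {a..b}"
proof (cases "a \<le> b")
  case True
  obtain B where "\<forall>t\<in>{0..T}. norm (w t) \<le> B"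
    using assms unfolding bounded_measurable_def by blast
  then have "w absolutely_integrable_on {0..T}"
    using assms(1) unfolding bounded_measurable_def
    by (intro measurable_bounded_by_integrable_imp_absolutely_integrable[where g="\<lambda>_. B"]) auto
  then show ?thesis
    by (rule absolutely_integrable_on_subinterval) (use assms in auto)
qed (simp add: absolutely_integrable_on_def)

lemma bounded_measurable_integrable:
  "bounded_measurable T w \<Longrightarrow> 0 \<le> a \<Longrightarrow> b \<le> T \<Longrightarrow> w integrable_on {a..b}"
  using bounded_measurable_absolutely_integrable absolutely_integrable_on_def by blast

text \<open>
  Curves are given by their velocity, which is the natural regularity for essentially bounded
  controls: a scaling of the curve is a scaling of the velocity.
\<close>

definition curve :: "'b::euclidean_space \<Rightarrow> (real \<Rightarrow> 'b) \<Rightarrow> real \<Rightarrow> 'b" where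
  "curve x0 w t = x0 + integral {0..t} w"

lemma curve_0 [simp]: "curve x0 w 0 = x0"
  by (simp add: curve_def)

lemma curve_diff:
  assumes "bounded_measurable T w" "0 \<le> s" "s \<le> t" "t \<le> T"
  shows "curve x0 w t - curve x0 w s = integral {s..t} w"
  using Henstock_Kurzweil_Integration.integral_combine[OF assms(2,3) bounded_measurable_integrable[OF assms(1) _ assms(4)]]
  by (simp add: curve_def algebra_simps)

lemma curve_continuous_on:
  "bounded_measurable T w \<Longrightarrow> continuous_on {0..T} (curve x0 w)"
  unfolding curve_def[abs_def]
  by (intro continuous_intros indefinite_integral_continuous_1 bounded_measurable_integrable) auto

lemma curve_scale: "curve x0 (\<lambda>t. \<mu> *\<^sub>R w t) t = x0 + \<mu> *\<^sub>R (curve x0 w t - x0)"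
  by (simp add: curve_def)

text \<open>
  The problem in a coordinate ball around the initial shape \<open>x0\<close>: \<open>\<theta> 0, \<dots>, \<theta> (p - 1)\<close> is the coframe dual
  to an orthonormal frame, so that \<open>L2_set (\<lambda>k. \<theta> k x v) {..<p}\<close> is the Riemannian length of \<open>v\<close> at
  \<open>x\<close>, and \<open>\<omega>\<close> is the displacement form.  A single constant \<open>C\<close> bounds the Lipschitz constants, the
  size of the forms and the comparison with the Euclidean norm.
\<close>

locale local_frame =
  fixes x0 :: "'e::euclidean_space" and R C :: real and p :: nat
    and \<theta> :: "nat \<Rightarrow> 'e \<Rightarrow> 'e \<Rightarrow> real" and \<omega> :: "'e \<Rightarrow> 'e \<Rightarrow> real"
  assumes R: "R > 0" and C: "C > 0"
    and linear_\<theta>: "k < p \<Longrightarrow> x \<in> cball x0 R \<Longrightarrow> linear (\<theta> k x)"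
    and linear_\<omega>: "x \<in> cball x0 R \<Longrightarrow> linear (\<omega> x)"
    and lipschitz_\<theta>: "k < p \<Longrightarrow> x \<in> cball x0 R \<Longrightarrow> y \<in> cball x0 R \<Longrightarrow>
      \<bar>\<theta> k x v - \<theta> k y v\<bar> \<le> C * norm (x - y) * norm v"
    and lipschitz_\<omega>: "x \<in> cball x0 R \<Longrightarrow> y \<in> cball x0 R \<Longrightarrow>
      \<bar>\<omega> x v - \<omega> y v\<bar> \<le> C * norm (x - y) * norm v"
    and norm_le_speed: "x \<in> cball x0 R \<Longrightarrow> norm v \<le> C * L2_set (\<lambda>k. \<theta> k x v) {..<p}"
    and speed_le_norm: "x \<in> cball x0 R \<Longrightarrow> L2_set (\<lambda>k. \<theta> k x v) {..<p} \<le> C * norm v"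
    and \<omega>_le_norm: "x \<in> cball x0 R \<Longrightarrow> \<bar>\<omega> x v\<bar> \<le> C * norm v"
begin

definition speed :: "'e \<Rightarrow> 'e \<Rightarrow> real" where
  "speed x v = L2_set (\<lambda>k. \<theta> k x v) {..<p}"

definition loop :: "real \<Rightarrow> real \<Rightarrow> (real \<Rightarrow> 'e) \<Rightarrow> bool" where
  "loop T \<rho> w \<longleftrightarrow> bounded_measurable T w \<and> (\<forall>t\<in>{0..T}. curve x0 w t \<in> cball x0 \<rho>) \<and> curve x0 w T = x0"

definition cost :: "real \<Rightarrow> (real \<Rightarrow> 'e) \<Rightarrow> real" where
  "cost T w = integral {0..T} (\<lambda>t. speed (curve x0 w t) (w t))"

definition holonomy :: "real \<Rightarrow> (real \<Rightarrow> 'e) \<Rightarrow> real" where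
  "holonomy T w = integral {0..T} (\<lambda>t. \<omega> (curve x0 w t) (w t))"

text \<open>
  Only the coordinates of the velocity are merely measurable; the coefficients of the form along the
  curve are continuous.
\<close>

lemma bounded_measurable_form:
  assumes lin: "\<And>x. x \<in> cball x0 R \<Longrightarrow> linear (A x)"
    and lip: "\<And>x y v. x \<in> cball x0 R \<Longrightarrow> y \<in> cball x0 R \<Longrightarrow> \<bar>A x v - A y v\<bar> \<le> C * norm (x - y) * norm v"
    and w: "bounded_measurable T w" and x: "continuous_on {0..T} x" "x ` {0..T} \<subseteq> cball x0 R"
  shows "bounded_measurable T (\<lambda>t. A (x t) (w t) :: real)"
proof -
  have cont: "continuous_on (cball x0 R) (\<lambda>x. A x b)" for b
  proof (rule continuous_onI)
    fix z and e :: real assume z: "z \<in> cball x0 R" and e: "e > 0"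
    have pos: "C * norm b + 1 > 0"
      using C by (smt (verit) mult_nonneg_nonneg norm_ge_zero)
    show "\<exists>d>0. \<forall>z'\<in>cball x0 R. dist z' z < d \<longrightarrow> dist (A z' b) (A z b) \<le> e"
    proof (intro exI[of _ "e / (C * norm b + 1)"] conjI ballI impI)
      show "0 < e / (C * norm b + 1)"
        using e pos by simp
      fix z' assume z': "z' \<in> cball x0 R" "dist z' z < e / (C * norm b + 1)"
      have "dist (A z' b) (A z b) \<le> norm (z' - z) * (C * norm b)"
        using lip[OF z'(1) z, of b] by (simp add: dist_real_def mult_ac)
      also have "\<dots> \<le> norm (z' - z) * (C * norm b + 1)"
        by (intro mult_left_mono) auto
      also have "\<dots> \<le> e"
        using z'(2) pos by (simp add: dist_norm pos_less_divide_eq)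
      finally show "dist (A z' b) (A z b) \<le> e" .
    qed
  qed
  have "bounded_measurable T (\<lambda>t. A (x t) b)" for b
    by (rule bounded_measurable_continuous, rule continuous_on_compose2[OF cont x])
  then have bm: "bounded_measurable T (\<lambda>t. \<Sum>b\<in>Basis. (w t \<bullet> b) *\<^sub>R A (x t) b)"
    by (intro bounded_measurable_sum bounded_measurable_scaleR bounded_measurable_inner w)
  have eq: "(\<Sum>b\<in>Basis. (w t \<bullet> b) *\<^sub>R A (x t) b) = A (x t) (w t)" if "t \<in> {0..T}" for t
    by (rule linear_basis_expansion[OF lin]) (use x(2) that in blast)
  have "(\<lambda>t. A (x t) (w t)) \<in> borel_measurable (lebesgue_on {0..T})"
    by (rule measurable_cong[THEN iffD1, of _ "\<lambda>t. \<Sum>b\<in>Basis. (w t \<bullet> b) *\<^sub>R A (x t) b"])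
       (use bm eq in \<open>auto simp: bounded_measurable_def\<close>)
  moreover obtain B where "\<forall>t\<in>{0..T}. norm (\<Sum>b\<in>Basis. (w t \<bullet> b) *\<^sub>R A (x t) b) \<le> B"
    using bm unfolding bounded_measurable_def by blast
  then have "\<forall>t\<in>{0..T}. norm (A (x t) (w t)) \<le> B"
    using eq by metis
  ultimately show ?thesis
    unfolding bounded_measurable_def by blast
qed

lemma bounded_measurable_along:
  assumes "bounded_measurable T w" "\<And>t. t \<in> {0..T} \<Longrightarrow> curve x0 w t \<in> cball x0 R"
  shows bounded_measurable_\<theta>: "k < p \<Longrightarrow> bounded_measurable T (\<lambda>t. \<theta> k (curve x0 w t) (w t))"
    and bounded_measurable_\<omega>: "bounded_measurable T (\<lambda>t. \<omega> (curve x0 w t) (w t))"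
    and bounded_measurable_speed: "bounded_measurable T (\<lambda>t. speed (curve x0 w t) (w t))"
proof -
  have sub: "curve x0 w ` {0..T} \<subseteq> cball x0 R"
    using assms(2) by blast
  show \<theta>: "bounded_measurable T (\<lambda>t. \<theta> k (curve x0 w t) (w t))" if "k < p" for k
    by (rule bounded_measurable_form[OF linear_\<theta>[OF that] lipschitz_\<theta>[OF that] assms(1)
          curve_continuous_on[OF assms(1)] sub])
  show "bounded_measurable T (\<lambda>t. \<omega> (curve x0 w t) (w t))"
    by (rule bounded_measurable_form[OF linear_\<omega> lipschitz_\<omega> assms(1)
          curve_continuous_on[OF assms(1)] sub])
  show "bounded_measurable T (\<lambda>t. speed (curve x0 w t) (w t))"
    unfolding speed_def by (rule bounded_measurable_L2_set) (rule \<theta>)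
qed

lemma speed_scale:
  assumes "x \<in> cball x0 R" "\<mu> \<ge> 0"
  shows "speed x (\<mu> *\<^sub>R v) = \<mu> * speed x v"
  unfolding speed_def L2_set_right_distrib[OF assms(2)]
  by (rule L2_set_cong) (use linear_\<theta> assms in \<open>auto simp: linear_scale\<close>)

lemma speed_nonneg: "speed x v \<ge> 0"
  by (simp add: speed_def)

lemma speed_perturb:
  assumes x: "x \<in> cball x0 R" and y: "y \<in> cball x0 R"
  shows "speed y v \<le> (1 + real p * C\<^sup>2 * norm (x - y)) * speed x v"
proof -
  have "speed y v \<le> L2_set (\<lambda>k. \<theta> k x v + (\<theta> k y v - \<theta> k x v)) {..<p}"
    by (simp add: speed_def)
  also have "\<dots> \<le> speed x v + L2_set (\<lambda>k. \<theta> k y v - \<theta> k x v) {..<p}"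
    unfolding speed_def by (rule L2_set_triangle_ineq)
  also have "L2_set (\<lambda>k. \<theta> k y v - \<theta> k x v) {..<p} \<le> (\<Sum>k<p. \<bar>\<theta> k y v - \<theta> k x v\<bar>)"
    by (rule L2_set_le_sum_abs)
  also have "\<dots> \<le> (\<Sum>k<p. C * norm (x - y) * norm v)"
    using lipschitz_\<theta>[OF _ y x] by (intro sum_mono) (simp add: norm_minus_commute)
  also have "\<dots> = real p * (C * norm (x - y)) * norm v"
    by simp
  also have "\<dots> \<le> real p * (C * norm (x - y)) * (C * speed x v)"
    using norm_le_speed[OF x] C unfolding speed_def by (intro mult_left_mono) auto
  finally show ?thesis
    by (simp add: algebra_simps power2_eq_square)
qed

lemma scale_in_cball:
  assumes "x \<in> cball x0 \<rho>" "0 \<le> \<mu>" "\<mu> \<le> 1"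
  shows "x0 + \<mu> *\<^sub>R (x - x0) \<in> cball x0 \<rho>"
proof -
  have "\<mu> * norm (x - x0) \<le> 1 * norm (x - x0)"
    using assms by (intro mult_right_mono) auto
  then show ?thesis
    using assms by (simp add: dist_norm norm_minus_commute)
qed

lemma loop_scale:
  assumes "loop T \<rho> w" "0 \<le> \<mu>" "\<mu> \<le> 1"
  shows "loop T \<rho> (\<lambda>t. \<mu> *\<^sub>R w t)"
  using assms unfolding loop_def
  by (auto simp: curve_scale simp del: mem_cball intro!: scale_in_cball bounded_measurable_cmul)

lemma loop_in_cball: "loop T \<rho> w \<Longrightarrow> \<rho> \<le> R \<Longrightarrow> t \<in> {0..T} \<Longrightarrow> curve x0 w t \<in> cball x0 R"
  unfolding loop_def using subset_cball[of \<rho> R x0] by blast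

lemma loop_integrable:
  assumes "loop T \<rho> w" "\<rho> \<le> R"
  shows "(\<lambda>t. speed (curve x0 w t) (w t)) integrable_on {0..T}"
    and "(\<lambda>t. \<omega> (curve x0 w t) (w t)) integrable_on {0..T}"
  using assms loop_in_cball[OF assms]
  by (auto intro!: bounded_measurable_integrable bounded_measurable_along simp: loop_def)

lemma cost_nonneg: "cost T w \<ge> 0"
  unfolding cost_def
  by (cases "(\<lambda>t. speed (curve x0 w t) (w t)) integrable_on {0..T}")
     (auto simp: speed_nonneg not_integrable_integral intro: Henstock_Kurzweil_Integration.integral_nonneg)

end

section \<open>Homotheties of loops\<close>

context local_frame
begin

text \<open>
  The scaled curve has the velocity \<open>\<mu> w\<close> at a point at distance at most \<open>(1 - \<mu>) \<rho>\<close> from the original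
  one.  So the speed is multiplied by at most \<open>\<mu> (1 + p C\<^sup>2 (1 - \<mu>) \<rho>)\<close>, and the smallness of
  \<open>\<rho>\<close> makes the gain \<open>\<mu>\<close> win over the variation of the metric.
\<close>

lemma cost_scale:
  assumes l: "loop T \<rho> w" and \<rho>: "\<rho> \<le> R" "real p * C\<^sup>2 * \<rho> \<le> 1 / 2" and \<mu>: "0 \<le> \<mu>" "\<mu> \<le> 1"
  shows "cost T (\<lambda>t. \<mu> *\<^sub>R w t) \<le> (1 - (1 - \<mu>) / 2) * cost T w"
proof -
  have "speed (x0 + \<mu> *\<^sub>R (curve x0 w t - x0)) (\<mu> *\<^sub>R w t) \<le> (1 - (1 - \<mu>) / 2) * speed (curve x0 w t) (w t)"
    if t: "t \<in> {0..T}" for t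
  proof -
    define x y where "x = curve x0 w t" and "y = x0 + \<mu> *\<^sub>R (x - x0)"
    have x: "x \<in> cball x0 \<rho>" "x \<in> cball x0 R"
      using l t loop_in_cball[OF l \<rho>(1) t] by (auto simp: loop_def x_def)
    have y: "y \<in> cball x0 R"
      unfolding y_def by (rule scale_in_cball[OF x(2) \<mu>])
    have "x - y = (1 - \<mu>) *\<^sub>R (x - x0)"
      by (simp add: y_def algebra_simps)
    then have "norm (x - y) = (1 - \<mu>) * norm (x - x0)"
      using \<mu> by simp
    also have "\<dots> \<le> (1 - \<mu>) * \<rho>"
      using \<mu> x(1) by (intro mult_left_mono) (auto simp: dist_norm norm_minus_commute)
    finally have "real p * C\<^sup>2 * norm (x - y) \<le> real p * C\<^sup>2 * ((1 - \<mu>) * \<rho>)"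
      by (intro mult_left_mono) auto
    also have "\<dots> = (1 - \<mu>) * (real p * C\<^sup>2 * \<rho>)"
      by simp
    also have "\<dots> \<le> (1 - \<mu>) * (1 / 2)"
      using \<mu> \<rho>(2) by (intro mult_left_mono) auto
    finally have "speed y (w t) \<le> (1 + (1 - \<mu>) * (1 / 2)) * speed x (w t)"
      using speed_perturb[OF x(2) y, of "w t"]
        mult_right_mono[of "1 + real p * C\<^sup>2 * norm (x - y)" "1 + (1 - \<mu>) * (1 / 2)" "speed x (w t)"]
        speed_nonneg[of x "w t"] by linarith
    then have "\<mu> * speed y (w t) \<le> \<mu> * ((1 + (1 - \<mu>) * (1 / 2)) * speed x (w t))"
      using \<mu> by (intro mult_left_mono) auto
    also have "\<dots> = (\<mu> * (1 + (1 - \<mu>) * (1 / 2))) * speed x (w t)"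
      by simp
    also have "\<dots> \<le> (1 - (1 - \<mu>) / 2) * speed x (w t)"
    proof (rule mult_right_mono[OF _ speed_nonneg])
      have "\<mu> * (1 - \<mu>) \<le> 1 * (1 - \<mu>)"
        using \<mu> by (intro mult_right_mono) auto
      then show "\<mu> * (1 + (1 - \<mu>) * (1 / 2)) \<le> 1 - (1 - \<mu>) / 2"
        by (simp add: field_simps)
    qed
    finally show ?thesis
      using speed_scale[OF y \<mu>(1), of "w t"] by (simp add: x_def y_def)
  qed
  then have "cost T (\<lambda>t. \<mu> *\<^sub>R w t) \<le> integral {0..T} (\<lambda>t. (1 - (1 - \<mu>) / 2) * speed (curve x0 w t) (w t))"
    unfolding cost_def curve_scale
    using loop_integrable(1)[OF loop_scale[OF l \<mu>] \<rho>(1)] loop_integrable(1)[OF l \<rho>(1)]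
    by (intro integral_le integrable_on_mult_right) (auto simp: curve_scale)
  then show ?thesis
    by (simp add: cost_def)
qed

text \<open>
  Scaling changes both the base point, by at most \<open>\<bar>\<mu> - \<nu>\<bar> R\<close>, and the velocity.  Each change costs a
  multiple of \<open>\<bar>\<mu> - \<nu>\<bar> \<cdot> norm (w t)\<close>, and \<open>norm (w t)\<close> is at most \<open>C\<close> times the speed.
\<close>

lemma holonomy_scale_lipschitz:
  assumes l: "loop T \<rho> w" and \<rho>: "\<rho> \<le> R" and \<mu>: "0 \<le> \<mu>" "\<mu> \<le> 1" and \<nu>: "0 \<le> \<nu>" "\<nu> \<le> 1"
  shows "\<bar>holonomy T (\<lambda>t. \<mu> *\<^sub>R w t) - holonomy T (\<lambda>t. \<nu> *\<^sub>R w t)\<bar> \<le> C\<^sup>2 * (R + 1) * \<bar>\<mu> - \<nu>\<bar> * cost T w"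
proof -
  define h where "h \<mu> t = \<omega> (x0 + \<mu> *\<^sub>R (curve x0 w t - x0)) (\<mu> *\<^sub>R w t)" for \<mu> t
  have int: "h \<mu> integrable_on {0..T}" if "0 \<le> \<mu>" "\<mu> \<le> 1" for \<mu>
    using loop_integrable(2)[OF loop_scale[OF l that] \<rho>] by (simp add: curve_scale h_def[abs_def])
  have bound: "norm (h \<mu> t - h \<nu> t) \<le> (C\<^sup>2 * (R + 1) * \<bar>\<mu> - \<nu>\<bar>) * speed (curve x0 w t) (w t)"
    if t: "t \<in> {0..T}" for t
  proof -
    define x where "x = curve x0 w t"
    define y where "y \<mu> = x0 + \<mu> *\<^sub>R (x - x0)" for \<mu>
    have x: "x \<in> cball x0 R"
      using loop_in_cball[OF l \<rho> t] by (simp add: x_def)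
    have y: "y \<mu> \<in> cball x0 R" "y \<nu> \<in> cball x0 R"
      unfolding y_def by (rule scale_in_cball[OF x] \<mu> \<nu>)+
    have "norm (y \<mu> - y \<nu>) = norm ((\<mu> - \<nu>) *\<^sub>R (x - x0))"
      by (simp add: y_def algebra_simps)
    also have "\<dots> \<le> \<bar>\<mu> - \<nu>\<bar> * R"
      using x by (auto simp: dist_norm norm_minus_commute intro!: mult_left_mono)
    finally have "C * norm (y \<mu> - y \<nu>) * norm (w t) \<le> C * (\<bar>\<mu> - \<nu>\<bar> * R) * norm (w t)"
      using C by (intro mult_right_mono mult_left_mono) auto
    then have 1: "\<bar>\<omega> (y \<mu>) (w t) - \<omega> (y \<nu>) (w t)\<bar> \<le> C * (\<bar>\<mu> - \<nu>\<bar> * R) * norm (w t)"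
      using lipschitz_\<omega>[OF y, of "w t"] by linarith
    have "h \<mu> t - h \<nu> t = \<mu> * (\<omega> (y \<mu>) (w t) - \<omega> (y \<nu>) (w t)) + (\<mu> - \<nu>) * \<omega> (y \<nu>) (w t)"
      using linear_scale[OF linear_\<omega>[OF y(1)]] linear_scale[OF linear_\<omega>[OF y(2)]]
      by (simp add: h_def y_def x_def algebra_simps)
    then have "norm (h \<mu> t - h \<nu> t) \<le> \<mu> * \<bar>\<omega> (y \<mu>) (w t) - \<omega> (y \<nu>) (w t)\<bar> + \<bar>\<mu> - \<nu>\<bar> * \<bar>\<omega> (y \<nu>) (w t)\<bar>"
      using \<mu>(1) by (metis abs_mult abs_of_nonneg abs_triangle_ineq real_norm_def)
    also have "\<dots> \<le> 1 * (C * (\<bar>\<mu> - \<nu>\<bar> * R) * norm (w t)) + \<bar>\<mu> - \<nu>\<bar> * (C * norm (w t))"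
      by (intro add_mono mult_mono 1 \<omega>_le_norm y) (use \<mu> in auto)
    also have "\<dots> = (C * (R + 1) * \<bar>\<mu> - \<nu>\<bar>) * norm (w t)"
      by (simp add: algebra_simps)
    also have "\<dots> \<le> (C * (R + 1) * \<bar>\<mu> - \<nu>\<bar>) * (C * speed x (w t))"
      using norm_le_speed[OF x, of "w t"] C R by (intro mult_left_mono) (auto simp: speed_def)
    finally show ?thesis
      by (simp add: x_def power2_eq_square mult_ac)
  qed
  have "holonomy T (\<lambda>t. \<mu> *\<^sub>R w t) - holonomy T (\<lambda>t. \<nu> *\<^sub>R w t) = integral {0..T} (\<lambda>t. h \<mu> t - h \<nu> t)"
    unfolding holonomy_def curve_scale
    using int[OF \<mu>] int[OF \<nu>] by (subst Henstock_Kurzweil_Integration.integral_diff) (auto simp: h_def[abs_def])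
  also have "norm \<dots> \<le> integral {0..T} (\<lambda>t. (C\<^sup>2 * (R + 1) * \<bar>\<mu> - \<nu>\<bar>) * speed (curve x0 w t) (w t))"
    using int[OF \<mu>] int[OF \<nu>] loop_integrable(1)[OF l \<rho>]
    by (intro Henstock_Kurzweil_Integration.integral_norm_bound_integral bound
        Henstock_Kurzweil_Integration.integrable_diff integrable_on_mult_right) auto
  finally show ?thesis
    by (simp add: cost_def)
qed

text \<open>
  The heart of the proof.  The intermediate value theorem gives a ratio \<open>\<mu>\<close> with the prescribed
  holonomy; as the holonomy is Lipschitz in \<open>\<mu>\<close> with a constant proportional to the cost, a given
  decrease of the holonomy forces \<open>(1 - \<mu>) \<cdot> cost\<close>, and hence the saving, to be at least proportional
  to it.
\<close>

lemma loop_shrink: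
  assumes l: "loop T \<rho> w" and \<rho>: "\<rho> \<le> R" "real p * C\<^sup>2 * \<rho> \<le> 1 / 2"
    and d: "0 \<le> d" "d \<le> holonomy T w"
  obtains w' where "loop T \<rho> w'" "holonomy T w' = d"
    "cost T w' \<le> cost T w - (holonomy T w - d) / (2 * C\<^sup>2 * (R + 1))"
proof -
  define H where "H \<mu> = holonomy T (\<lambda>t. \<mu> *\<^sub>R w t)" for \<mu>
  define D where "D = C\<^sup>2 * (R + 1)"
  define L where "L = D * cost T w"
  have D: "D > 0"
    using C R by (simp add: D_def)
  have L: "L \<ge> 0"
    using D cost_nonneg by (simp add: L_def)
  have lip: "\<bar>H \<mu> - H \<nu>\<bar> \<le> L * \<bar>\<mu> - \<nu>\<bar>" if "0 \<le> \<mu>" "\<mu> \<le> 1" "0 \<le> \<nu>" "\<nu> \<le> 1" for \<mu> \<nu>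
    using holonomy_scale_lipschitz[OF l \<rho>(1) that] by (simp add: H_def L_def D_def mult_ac)
  have "continuous_on {0..1} H"
    by (rule lipschitz_on_continuous_on[OF lipschitz_onI[where L=L]])
       (use L lip in \<open>auto simp: dist_real_def\<close>)
  moreover have "H 0 = 0"
    using linear_0[OF linear_\<omega>[of x0]] R by (simp add: H_def holonomy_def curve_def)
  moreover have H1: "H 1 = holonomy T w"
    by (simp add: H_def)
  ultimately obtain \<mu> where \<mu>: "0 \<le> \<mu>" "\<mu> \<le> 1" "H \<mu> = d"
    using IVT'[of H 0 d 1] d by auto
  have "holonomy T w - d \<le> L * (1 - \<mu>)"
    using lip[of 1 \<mu>] \<mu> H1 by simp
  then have "(holonomy T w - d) / (2 * D) \<le> L * (1 - \<mu>) / (2 * D)"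
    using D by (intro divide_right_mono) auto
  also have "\<dots> = (1 - \<mu>) / 2 * cost T w"
    using D by (simp add: L_def)
  also have "2 * D = 2 * C\<^sup>2 * (R + 1)"
    by (simp add: D_def)
  finally have "cost T (\<lambda>t. \<mu> *\<^sub>R w t) \<le> cost T w - (holonomy T w - d) / (2 * C\<^sup>2 * (R + 1))"
    using cost_scale[OF l \<rho> \<mu>(1,2)] unfolding left_diff_distrib[of 1] mult_1 by linarith
  then show ?thesis
    using that[OF loop_scale[OF l \<mu>(1,2)]] \<mu>(3) by (simp add: H_def)
qed

definition segment_integral :: "'e \<Rightarrow> 'e \<Rightarrow> real" where
  "segment_integral x y = integral {0..1} (\<lambda>t. \<omega> (x + t *\<^sub>R (y - x)) (y - x))"

lemma segment_in_cball:
  assumes "x \<in> cball x0 r" "y \<in> cball x0 r" "t \<in> {0..1}"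
  shows "x + t *\<^sub>R (y - x) \<in> cball x0 r"
proof -
  have "(1 - t) *\<^sub>R x + t *\<^sub>R y \<in> cball x0 r"
    using convex_cball[of x0 r] assms by (intro convexD_alt) auto
  then show ?thesis
    by (simp add: algebra_simps)
qed

lemma segment_integrable:
  assumes "x \<in> cball x0 R" "y \<in> cball x0 R"
  shows "(\<lambda>t. \<omega> (x + t *\<^sub>R (y - x)) (y - x)) integrable_on {0..1}"
proof (rule bounded_measurable_integrable[of 1])
  show "bounded_measurable 1 (\<lambda>t. \<omega> (x + t *\<^sub>R (y - x)) (y - x))"
    by (rule bounded_measurable_form[OF linear_\<omega> lipschitz_\<omega> bounded_measurable_continuous])
       (use segment_in_cball[OF assms] in \<open>auto intro!: continuous_intros simp del: mem_cball\<close>)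
qed auto

lemma segment_integral_reverse: "segment_integral y x = - segment_integral x y"
  if xy: "x \<in> cball x0 R" "y \<in> cball x0 R"
proof -
  define f where "f = (\<lambda>t. \<omega> (x + t *\<^sub>R (y - x)) (y - x))"
  have "(f has_integral segment_integral x y) (cbox 0 1)"
    using segment_integrable[OF xy] by (simp add: f_def segment_integral_def integrable_integral)
  from has_integral_affinity[OF this, of "-1" 1]
  have "((\<lambda>t. f (1 - t)) has_integral segment_integral x y) {0..1}"
    by (simp add: image_iff add.commute)
  moreover have "\<omega> (y + t *\<^sub>R (x - y)) (x - y) = - f (1 - t)" if t: "t \<in> {0..1}" for t
  proof -
    have eq: "y + t *\<^sub>R (x - y) = x + (1 - t) *\<^sub>R (y - x)"
      by (simp add: algebra_simps)
    have "x + (1 - t) *\<^sub>R (y - x) \<in> cball x0 R"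
      by (rule segment_in_cball[OF xy]) (use t in auto)
    from linear_neg[OF linear_\<omega>[OF this], of "y - x"] show ?thesis
      unfolding eq f_def by simp
  qed
  ultimately have "((\<lambda>t. \<omega> (y + t *\<^sub>R (x - y)) (x - y)) has_integral - segment_integral x y) {0..1}"
    by (metis (no_types, lifting) has_integral_eq has_integral_neg)
  then show ?thesis
    unfolding segment_integral_def[of y x] by (rule integral_unique)
qed

text \<open>
  For one side of the triangles below.  The values of \<open>w\<close> at the two end points of the time interval
  are left open, so that consecutive sides can be joined.
\<close>

lemma linear_piece:
  assumes w: "bounded_measurable T w" and c: "0 \<le> c" "h > 0" "c + h \<le> T"
    and u: "\<And>t. c < t \<Longrightarrow> t < c + h \<Longrightarrow> w t = (1 / h) *\<^sub>R u"
    and z: "curve x0 w c = z" "z \<in> cball x0 R" "z + u \<in> cball x0 R"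
  shows linear_piece_curve: "t \<in> {c..c + h} \<Longrightarrow> curve x0 w t = z + ((t - c) / h) *\<^sub>R u"
    and linear_piece_integral:
      "integral {c..c + h} (\<lambda>t. \<omega> (curve x0 w t) (w t)) = segment_integral z (z + u)"
proof -
  show curve: "curve x0 w t = z + ((t - c) / h) *\<^sub>R u" if t: "t \<in> {c..c + h}" for t
  proof -
    have "integral {c..t} w = integral {c..t} (\<lambda>_. (1 / h) *\<^sub>R u)"
      by (rule integral_spike[of "{c, c + h}"]) (use u t in auto)
    then have "curve x0 w t - curve x0 w c = ((t - c) / h) *\<^sub>R u"
      using curve_diff[OF w c(1), of t] t c by simp
    then show ?thesis
      using z by (simp add: algebra_simps)
  qed
  define f where "f = (\<lambda>t. \<omega> (z + t *\<^sub>R u) u)"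
  have "(f has_integral segment_integral z (z + u)) (cbox 0 1)"
    using segment_integrable[OF z(2,3)] by (simp add: f_def segment_integral_def integrable_integral)
  from has_integral_affinity'[OF this, of "1 / h" "- (c / h)"] c(2)
  have "((\<lambda>t. f ((1 / h) *\<^sub>R t + - (c / h))) has_integral (h * segment_integral z (z + u)))
      {(0 - - (c / h)) /\<^sub>R (1 / h)..(1 - - (c / h)) /\<^sub>R (1 / h)}"
    by simp
  moreover have "(0 - - (c / h)) /\<^sub>R (1 / h) = c" "(1 - - (c / h)) /\<^sub>R (1 / h) = c + h"
    using c(2) by (simp_all add: field_simps)
  moreover have "(1 / h) *\<^sub>R t + - (c / h) = (t - c) / h" for t
    by (simp add: diff_divide_distrib)
  ultimately have "((\<lambda>t. f ((t - c) / h)) has_integral (h * segment_integral z (z + u))) {c..c + h}"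
    by simp
  from has_integral_mult_right[OF this, of "1 / h"]
  have A: "((\<lambda>t. (1 / h) * f ((t - c) / h)) has_integral segment_integral z (z + u)) {c..c + h}"
    using c(2) by simp
  have B: "\<omega> (curve x0 w t) (w t) = (1 / h) * f ((t - c) / h)" if t: "t \<in> {c..c + h} - {c, c + h}" for t
  proof -
    have "z + ((t - c) / h) *\<^sub>R (z + u - z) \<in> cball x0 R"
      by (rule segment_in_cball[OF z(2,3)]) (use t c in \<open>auto simp: field_simps\<close>)
    from linear_scale[OF linear_\<omega>[OF this], of "1 / h" u] show ?thesis
      using t by (simp add: curve u f_def)
  qed
  have "((\<lambda>t. \<omega> (curve x0 w t) (w t)) has_integral segment_integral z (z + u)) {c..c + h}"
    by (rule has_integral_spike[of "{c, c + h}", OF _ B A]) simp_all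
  then show "integral {c..c + h} (\<lambda>t. \<omega> (curve x0 w t) (w t)) = segment_integral z (z + u)"
    by (rule integral_unique)
qed

end

section \<open>Triangular loops\<close>

context local_frame
begin

text \<open>
  Each of the three sides has Euclidean length at most \<open>2 \<rho>\<close>, whence the factor 6.
\<close>

lemma triangle_loop:
  assumes T: "T > 0" and \<rho>: "\<rho> \<le> R" and x: "x \<in> cball x0 \<rho>" and y: "y \<in> cball x0 \<rho>"
  obtains w where "loop T \<rho> w"
    "holonomy T w = segment_integral x0 x + segment_integral x y + segment_integral y x0"
    "cost T w \<le> 6 * \<rho> * C"
proof -
  define h where "h = T / 3"
  have h: "h > 0" "T = 3 * h"
    using T by (simp_all add: h_def)
  define w where "w t = (1 / h) *\<^sub>R (if t \<le> h then x - x0 else if t \<le> 2 * h then y - x else x0 - y)" for t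
  have \<rho>0: "\<rho> \<ge> 0"
    using x by (metis dist_not_less_zero linorder_not_less mem_cball order_trans)
  have sub: "cball x0 \<rho> \<subseteq> cball x0 R"
    using \<rho> by (rule subset_cball)
  have x0: "x0 \<in> cball x0 \<rho>"
    using \<rho>0 by simp
  have wle: "norm (w t) \<le> (1 / h) * (2 * \<rho>)" for t
  proof -
    have "norm (x - x0) \<le> 2 * \<rho>" "norm (y - x) \<le> 2 * \<rho>" "norm (x0 - y) \<le> 2 * \<rho>"
      using x y \<rho>0 dist_triangle[of y x x0] by (auto simp: dist_norm norm_minus_commute)
    then show ?thesis
      using h by (auto simp: w_def intro!: divide_right_mono)
  qed
  have "w \<in> borel_measurable borel"
    unfolding w_def by measurable
  then have "w \<in> borel_measurable (lebesgue_on {0..T})"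
    by (intro measurable_restrict_space1 measurable_completion) simp
  then have bm: "bounded_measurable T w"
    using wle unfolding bounded_measurable_def by blast
  note piece1 = linear_piece_curve[OF bm, of 0 h "x - x0" x0] linear_piece_integral[OF bm, of 0 h "x - x0" x0]
  note piece2 = linear_piece_curve[OF bm, of h h "y - x" x] linear_piece_integral[OF bm, of h h "y - x" x]
  note piece3 = linear_piece_curve[OF bm, of "2 * h" h "x0 - y" y] linear_piece_integral[OF bm, of "2 * h" h "x0 - y" y]
  have R3: "x0 \<in> cball x0 R" "x \<in> cball x0 R" "y \<in> cball x0 R"
    using sub x0 x y by blast+
  have c1: "curve x0 w t = x0 + (t / h) *\<^sub>R (x - x0)" if "t \<in> {0..h}" for t
    using piece1(1)[of t] that h R3 by (simp add: w_def)
  have i1: "integral {0..h} (\<lambda>t. \<omega> (curve x0 w t) (w t)) = segment_integral x0 x"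
    using piece1(2) h R3 by (simp add: w_def)
  have v1: "curve x0 w h = x"
    using c1[of h] h by simp
  have c2: "curve x0 w t = x + ((t - h) / h) *\<^sub>R (y - x)" if "t \<in> {h..2 * h}" for t
    using piece2(1)[of t] that h R3 v1 by (simp add: w_def)
  have i2: "integral {h..2 * h} (\<lambda>t. \<omega> (curve x0 w t) (w t)) = segment_integral x y"
    using piece2(2) h R3 v1 by (simp add: w_def)
  have v2: "curve x0 w (2 * h) = y"
    using c2[of "2 * h"] h by simp
  have c3: "curve x0 w t = y + ((t - 2 * h) / h) *\<^sub>R (x0 - y)" if "t \<in> {2 * h..3 * h}" for t
    using piece3(1)[of t] that h R3 v2 by (simp add: w_def)
  have i3: "integral {2 * h..3 * h} (\<lambda>t. \<omega> (curve x0 w t) (w t)) = segment_integral y x0"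
    using piece3(2) h R3 v2 by (simp add: w_def)
  have "curve x0 w t \<in> cball x0 \<rho>" if t: "t \<in> {0..T}" for t
  proof -
    consider "t \<in> {0..h}" | "t \<in> {h..2 * h}" | "t \<in> {2 * h..3 * h}"
      using t h by fastforce
    then show ?thesis
    proof cases
      case 1
      have "x0 + (t / h) *\<^sub>R (x - x0) \<in> cball x0 \<rho>"
        by (rule segment_in_cball[OF x0 x]) (use 1 h in auto)
      then show ?thesis
        by (simp only: c1[OF 1])
    next
      case 2
      have "x + ((t - h) / h) *\<^sub>R (y - x) \<in> cball x0 \<rho>"
        by (rule segment_in_cball[OF x y]) (use 2 h in auto)
      then show ?thesis
        by (simp only: c2[OF 2])
    next
      case 3
      have "y + ((t - 2 * h) / h) *\<^sub>R (x0 - y) \<in> cball x0 \<rho>"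
        by (rule segment_in_cball[OF y x0]) (use 3 h in auto)
      then show ?thesis
        by (simp only: c3[OF 3])
    qed
  qed
  moreover have "curve x0 w T = x0"
    using c3[of T] h by simp
  ultimately have loop: "loop T \<rho> w"
    using bm by (simp add: loop_def)
  have int: "(\<lambda>t. \<omega> (curve x0 w t) (w t)) integrable_on {0..3 * h}"
    using loop_integrable(2)[OF loop \<rho>] h by simp
  have "integral {0..3 * h} (\<lambda>t. \<omega> (curve x0 w t) (w t)) =
      integral {0..h} (\<lambda>t. \<omega> (curve x0 w t) (w t)) + integral {h..3 * h} (\<lambda>t. \<omega> (curve x0 w t) (w t))"
    by (rule Henstock_Kurzweil_Integration.integral_combine[symmetric]) (use h int in auto)
  also have "integral {h..3 * h} (\<lambda>t. \<omega> (curve x0 w t) (w t)) =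
      integral {h..2 * h} (\<lambda>t. \<omega> (curve x0 w t) (w t)) + integral {2 * h..3 * h} (\<lambda>t. \<omega> (curve x0 w t) (w t))"
    by (rule Henstock_Kurzweil_Integration.integral_combine[symmetric])
       (use h int integrable_subinterval_real[OF int] in auto)
  finally have hol: "holonomy T w = segment_integral x0 x + segment_integral x y + segment_integral y x0"
    unfolding holonomy_def h(2) i1 i2 i3 by simp
  have "cost T w \<le> integral {0..T} (\<lambda>_. C * ((1 / h) * (2 * \<rho>)))"
    unfolding cost_def
  proof (intro integral_le loop_integrable(1)[OF loop \<rho>])
    fix t assume "t \<in> {0..T}"
    then have "speed (curve x0 w t) (w t) \<le> C * norm (w t)"
      using loop_in_cball[OF loop \<rho>] speed_le_norm by (simp add: speed_def)
    also have "\<dots> \<le> C * ((1 / h) * (2 * \<rho>))"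
      using wle C by (intro mult_left_mono) auto
    finally show "speed (curve x0 w t) (w t) \<le> C * ((1 / h) * (2 * \<rho>))" .
  qed auto
  also have "\<dots> = 6 * \<rho> * C"
    using h by simp
  finally show ?thesis
    using that loop hol by blast
qed

lemma segment_integral_approx:
  assumes "x \<in> cball x0 R" "y \<in> cball x0 R"
  shows "\<bar>segment_integral x y - \<omega> x (y - x)\<bar> \<le> C * norm (y - x) * norm (y - x)"
proof -
  have "segment_integral x y - \<omega> x (y - x) =
      integral {0..1} (\<lambda>t. \<omega> (x + t *\<^sub>R (y - x)) (y - x) - \<omega> x (y - x))"
    unfolding segment_integral_def
    by (subst Henstock_Kurzweil_Integration.integral_diff[OF segment_integrable[OF assms]]) auto
  also have "norm \<dots> \<le> integral {0..1::real} (\<lambda>_. C * norm (y - x) * norm (y - x))"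
  proof (rule Henstock_Kurzweil_Integration.integral_norm_bound_integral)
    fix t :: real assume t: "t \<in> {0..1}"
    have "t * norm (y - x) \<le> 1 * norm (y - x)"
      using t by (intro mult_right_mono) auto
    then have "C * norm (x + t *\<^sub>R (y - x) - x) * norm (y - x) \<le> C * norm (y - x) * norm (y - x)"
      using t C by (intro mult_right_mono mult_left_mono) auto
    then show "norm (\<omega> (x + t *\<^sub>R (y - x)) (y - x) - \<omega> x (y - x)) \<le> C * norm (y - x) * norm (y - x)"
      using lipschitz_\<omega>[OF segment_in_cball[OF assms t] assms(1), of "y - x"] by simp
  qed (auto intro!: Henstock_Kurzweil_Integration.integrable_diff segment_integrable assms)
  finally show ?thesis
    by simp
qed

text \<open>
  As in the proof of the theorem of Goursat and Morera: the integral along the segment towards \<open>x0\<close>,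
  with the opposite sign, is a primitive, because closing a triangle turns its increment into the
  integral along the short side.
\<close>

lemma zero_triangles_imp_primitive:
  assumes \<rho>: "\<rho> \<le> R" and x: "x \<in> ball x0 \<rho>"
    and zero: "\<And>x y. x \<in> ball x0 \<rho> \<Longrightarrow> y \<in> ball x0 \<rho> \<Longrightarrow>
       segment_integral x0 x + segment_integral x y + segment_integral y x0 = 0"
  shows "((\<lambda>z. - segment_integral z x0) has_derivative \<omega> x) (at x)"
proof -
  have sub: "ball x0 \<rho> \<subseteq> cball x0 R"
    using \<rho> by auto
  have xR: "x \<in> cball x0 R"
    using x sub by blast
  obtain e where e: "e > 0" "ball x e \<subseteq> ball x0 \<rho>"
    using x open_contains_ball[of "ball x0 \<rho>"] open_ball by blast
  have xx: "segment_integral x x = 0"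
    using linear_0[OF linear_\<omega>[OF xR]] by (simp add: segment_integral_def)
  show ?thesis
  proof (rule has_derivativeI_sandwich[OF e(1), of _ _ _ _ "\<lambda>y. C * norm (y - x)"])
    show "bounded_linear (\<omega> x)"
      using linear_\<omega>[OF xR] linear_conv_bounded_linear by blast
    fix y assume y: "y \<noteq> x" "dist y x < e"
    then have y0: "y \<in> ball x0 \<rho>"
      using e(2) by (auto simp: dist_commute)
    have "- segment_integral y x0 - - segment_integral x x0 = segment_integral x y"
      using zero[OF x y0] zero[OF x x] xx by linarith
    then have "norm (- segment_integral y x0 - - segment_integral x x0 - \<omega> x (y - x))
         \<le> C * norm (y - x) * norm (y - x)"
      using segment_integral_approx[OF xR, of y] y0 sub by auto
    then show "norm (- segment_integral y x0 - - segment_integral x x0 - \<omega> x (y - x)) / norm (y - x)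
         \<le> C * norm (y - x)"
      using y(1) by (simp add: divide_le_eq)
  next
    show "((\<lambda>y. C * norm (y - x)) \<longlongrightarrow> 0) (at x)"
      by (auto intro!: tendsto_eq_intros)
  qed
qed

text \<open>
  A triangle of negative holonomy becomes one of positive holonomy when its orientation is reversed.
\<close>

lemma positive_loop_or_primitive:
  assumes T: "T > 0" and \<rho>: "\<rho> \<le> R"
  shows "(\<exists>w. loop T \<rho> w \<and> holonomy T w > 0 \<and> cost T w \<le> 6 * \<rho> * C) \<or>
     (\<exists>f. \<forall>x\<in>ball x0 \<rho>. (f has_derivative \<omega> x) (at x))"
proof (cases "\<forall>x\<in>ball x0 \<rho>. \<forall>y\<in>ball x0 \<rho>.
       segment_integral x0 x + segment_integral x y + segment_integral y x0 = 0")
  case True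
  then show ?thesis
    using zero_triangles_imp_primitive[OF \<rho>] by blast
next
  case False
  define H where "H x y = segment_integral x0 x + segment_integral x y + segment_integral y x0" for x y
  from False obtain x y where xy: "x \<in> ball x0 \<rho>" "y \<in> ball x0 \<rho>" "H x y \<noteq> 0"
    unfolding H_def by blast
  have c: "x0 \<in> cball x0 R" "x \<in> cball x0 R" "y \<in> cball x0 R"
    using xy(1,2) \<rho> R by auto
  have "H y x = - H x y"
    unfolding H_def using segment_integral_reverse[OF c(1,2)] segment_integral_reverse[OF c(2,3)]
      segment_integral_reverse[OF c(3,1)] by linarith
  then obtain x' y' where "x' \<in> cball x0 \<rho>" "y' \<in> cball x0 \<rho>" "H x' y' > 0"
    using xy by (metis ball_subset_cball neg_0_less_iff_less neqE subsetD)
  then show ?thesis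
    using triangle_loop[OF T \<rho>, of x' y'] unfolding H_def by metis
qed

end

section \<open>Closedness of the displacement form\<close>

definition analytic_components :: "'a::euclidean_space set \<Rightarrow> ('a \<Rightarrow> 'b::euclidean_space) \<Rightarrow> bool" where
  "analytic_components U f \<longleftrightarrow> (\<forall>b\<in>Basis. (\<lambda>x. f x \<bullet> b) \<in> analytic_algebra U)"

lemma real_analytic_on_inner:
  assumes "f real_analytic_on U"
  shows "(\<lambda>x. f x \<bullet> b) real_analytic_on U"
  unfolding real_analytic_on_def
proof
  fix x0 assume "x0 \<in> U"
  then obtain r c where r: "r > 0"
    and c: "\<And>x. x \<in> ball x0 r \<Longrightarrow>
      ((\<lambda>\<alpha>. (\<Prod>b\<in>Basis. ((x - x0) \<bullet> b) ^ \<alpha> b) *\<^sub>R c \<alpha>) has_sum f x) multi_indices"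
    using assms unfolding real_analytic_on_def by blast
  have "((\<lambda>\<alpha>. (\<Prod>b\<in>Basis. ((x - x0) \<bullet> b) ^ \<alpha> b) *\<^sub>R (c \<alpha> \<bullet> b)) has_sum f x \<bullet> b) multi_indices"
    if "x \<in> ball x0 r" for x
    using has_sum_bounded_linear[OF bounded_linear_inner_left[of b] c[OF that]] by simp
  then show "\<exists>r>0. \<exists>c. \<forall>x\<in>ball x0 r.
      ((\<lambda>\<alpha>. (\<Prod>b\<in>Basis. ((x - x0) \<bullet> b) ^ \<alpha> b) *\<^sub>R c \<alpha>) has_sum f x \<bullet> b) multi_indices"
    using r by (intro exI[of _ r] conjI exI[of _ "\<lambda>\<alpha>. c \<alpha> \<bullet> b"] ballI) auto
qed

lemma real_analytic_on_diff:
  fixes f g :: "'a::euclidean_space \<Rightarrow> real"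
  assumes "f real_analytic_on U" "g real_analytic_on U"
  shows "(\<lambda>x. f x - g x) real_analytic_on U"
  unfolding real_analytic_on_iff_power_series
proof
  fix x0 assume "x0 \<in> U"
  then obtain r c r' c' where f: "has_power_series f c x0 r" and g: "has_power_series g c' x0 r'"
    using assms unfolding real_analytic_on_iff_power_series by blast
  have "((\<lambda>\<alpha>. monomial_at x0 \<alpha> x * (c \<alpha> - c' \<alpha>)) has_sum f x - g x) multi_indices"
    if "x \<in> ball x0 (min r r')" for x
  proof -
    have "((\<lambda>\<alpha>. monomial_at x0 \<alpha> x * c \<alpha>) has_sum f x) multi_indices"
      "((\<lambda>\<alpha>. monomial_at x0 \<alpha> x * c' \<alpha>) has_sum g x) multi_indices"
      using f g that by (auto simp: has_power_series_def)
    from has_sum_add[OF this(1) has_sum_uminusI[OF this(2)]] show ?thesis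
      by (simp add: right_diff_distrib)
  qed
  then have "has_power_series (\<lambda>x. f x - g x) (\<lambda>\<alpha>. c \<alpha> - c' \<alpha>) x0 (min r r')"
    using f g by (simp add: has_power_series_def)
  then show "\<exists>r c. has_power_series (\<lambda>x. f x - g x) c x0 r"
    by blast
qed

lemma analytic_components_of_analytic: "f real_analytic_on U \<Longrightarrow> analytic_components U f"
  unfolding analytic_components_def by (intro ballI analytic_algebra.analytic real_analytic_on_inner)

lemma analytic_components_inner:
  assumes "analytic_components U f" "analytic_components U g"
  shows "(\<lambda>x. f x \<bullet> g x) \<in> analytic_algebra U"
proof -
  have "(\<lambda>x. f x \<bullet> g x) = (\<lambda>x. \<Sum>b\<in>Basis. (f x \<bullet> b) * (g x \<bullet> b))"
    by (rule ext, rule euclidean_inner)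
  also have "\<dots> \<in> analytic_algebra U"
    using assms by (intro analytic_algebra_sum analytic_algebra.mult) (auto simp: analytic_components_def)
  finally show ?thesis .
qed

lemma analytic_components_const: "analytic_components U (\<lambda>x. c)"
  unfolding analytic_components_def by (intro ballI analytic_algebra.const)

lemma analytic_components_derivative:
  assumes "analytic_components U f"
  obtains F where "\<And>x. x \<in> U \<Longrightarrow> (f has_derivative F x) (at x)"
    and "\<And>v. analytic_components U (\<lambda>x. F x v)"
proof -
  have "\<forall>b\<in>Basis. \<exists>F. (\<forall>x\<in>U. ((\<lambda>x. f x \<bullet> b) has_derivative F x) (at x)) \<and>
      (\<forall>v. (\<lambda>x. F x v) \<in> analytic_algebra U)"
  proof
    fix b :: 'b assume "b \<in> Basis"
    then have "(\<lambda>x. f x \<bullet> b) \<in> analytic_algebra U"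
      using assms by (simp add: analytic_components_def)
    then obtain F where "\<And>x. x \<in> U \<Longrightarrow> ((\<lambda>x. f x \<bullet> b) has_derivative F x) (at x)"
      "\<And>v. (\<lambda>x. F x v) \<in> analytic_algebra U"
      by (rule analytic_algebra_derivative) blast
    then show "\<exists>F. (\<forall>x\<in>U. ((\<lambda>x. f x \<bullet> b) has_derivative F x) (at x)) \<and>
      (\<forall>v. (\<lambda>x. F x v) \<in> analytic_algebra U)"
      by (intro exI[of _ F]) auto
  qed
  from bchoice[OF this] obtain F where F: "\<forall>b\<in>Basis. (\<forall>x\<in>U. ((\<lambda>x. f x \<bullet> b) has_derivative F b x) (at x)) \<and>
      (\<forall>v. (\<lambda>x. F b x v) \<in> analytic_algebra U)" ..
  define G where "G x v = (\<Sum>b\<in>Basis. F b x v *\<^sub>R b)" for x v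
  have G: "G x v \<bullet> b = F b x v" if "b \<in> Basis" for b x v
    using that by (simp add: G_def inner_sum_left inner_Basis if_distrib cong: if_cong)
  show ?thesis
  proof (rule that[of G])
    fix x assume "x \<in> U"
    then show "(f has_derivative G x) (at x)"
      unfolding has_derivative_componentwise_within[of f] using F by (simp add: G)
  next
    fix v
    show "analytic_components U (\<lambda>x. G x v)"
      unfolding analytic_components_def using F by (simp add: G)
  qed
qed

lemma analytic_components_has_derivative:
  assumes "analytic_components U f" "x \<in> U"
  shows "(f has_derivative frechet_derivative f (at x)) (at x)"
proof -
  obtain F where F: "\<And>x. x \<in> U \<Longrightarrow> (f has_derivative F x) (at x)"
    "\<And>v. analytic_components U (\<lambda>x. F x v)"
    using analytic_components_derivative[OF assms(1)] by blast
  show ?thesis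
    using F(1)[OF assms(2)] frechet_derivative_at[OF F(1)[OF assms(2)]] by simp
qed

lemma analytic_components_continuous_on:
  "analytic_components U f \<Longrightarrow> continuous_on U f"
  using has_derivative_continuous[OF analytic_components_has_derivative[of U f]]
  by (simp add: continuous_at_imp_continuous_on)

definition chart_image :: "('i, 's, 'e, 'n::finite) swimmer \<Rightarrow> 'i \<Rightarrow> 'e set" where
  "chart_image S i = chart_map (shape S) i ` chart_dom (shape S) i"

text \<open>
  The displacement form in a chart, represented by a vector field through the inner product.
\<close>

definition covector :: "('i, 's, 'e::euclidean_space, 'n::finite) swimmer \<Rightarrow> 'i \<Rightarrow> 'e \<Rightarrow> 'e" where
  "covector S i x = (\<Sum>b\<in>Basis. displ S i (chart_inv (shape S) i x) b *\<^sub>R b)"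

text \<open>
  The exterior derivative of the displacement form vanishes at the point with coordinates \<open>x\<close>: the
  Jacobian matrix of its coefficients is symmetric there.
\<close>

definition closed_at :: "('i, 's, 'e::euclidean_space, 'n::finite) swimmer \<Rightarrow> 'i \<Rightarrow> 'e \<Rightarrow> bool" where
  "closed_at S i x \<longleftrightarrow> (\<forall>v w. frechet_derivative (covector S i) (at x) v \<bullet> w =
     frechet_derivative (covector S i) (at x) w \<bullet> v)"

locale analytic_swimmer =
  fixes S :: "('i, 's::{t2_space, second_countable_topology}, 'e::euclidean_space, 'n::finite) swimmer"
  assumes swimmer: "is_swimmer S"
begin

abbreviation "A \<equiv> shape S"

lemma manifold: "analytic_manifold A"
  and displ_form: "analytic_one_form A (displ S)"
  and metric: "analytic_riemannian_metric A (metric S)"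
  and connected_shapes: "connected (UNIV :: 's set)"
  using swimmer by (simp_all add: is_swimmer_def)

lemma chart:
  assumes i: "i \<in> charts A"
  shows open_chart_dom: "open (chart_dom A i)"
    and open_chart_image: "open (chart_image S i)"
    and chart_inv_map [simp]: "s \<in> chart_dom A i \<Longrightarrow> chart_inv A i (chart_map A i s) = s"
    and chart_map_inv [simp]: "x \<in> chart_image S i \<Longrightarrow> chart_map A i (chart_inv A i x) = x"
    and chart_inv_in [intro]: "x \<in> chart_image S i \<Longrightarrow> chart_inv A i x \<in> chart_dom A i"
    and chart_map_in [intro]: "s \<in> chart_dom A i \<Longrightarrow> chart_map A i s \<in> chart_image S i"
    and chart_map_continuous: "continuous_on (chart_dom A i) (chart_map A i)"
    and chart_inv_continuous: "continuous_on (chart_image S i) (chart_inv A i)"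
proof -
  have "open (chart_dom A i) \<and> open (chart_image S i) \<and>
      homeomorphism (chart_dom A i) (chart_image S i) (chart_map A i) (chart_inv A i)"
    using manifold i unfolding analytic_manifold_def chart_image_def by blast
  then show "open (chart_dom A i)" "open (chart_image S i)"
    "s \<in> chart_dom A i \<Longrightarrow> chart_inv A i (chart_map A i s) = s"
    "x \<in> chart_image S i \<Longrightarrow> chart_map A i (chart_inv A i x) = x"
    "x \<in> chart_image S i \<Longrightarrow> chart_inv A i x \<in> chart_dom A i"
    "s \<in> chart_dom A i \<Longrightarrow> chart_map A i s \<in> chart_image S i"
    "continuous_on (chart_dom A i) (chart_map A i)"
    "continuous_on (chart_image S i) (chart_inv A i)"
    unfolding homeomorphism_def by auto
qed

lemma chart_cover: "\<exists>i\<in>charts A. s \<in> chart_dom A i"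
  using manifold unfolding analytic_manifold_def by blast

lemma open_chart_overlap:
  assumes "i \<in> charts A" "j \<in> charts A"
  shows "open (chart_map A i ` (chart_dom A i \<inter> chart_dom A j))"
proof -
  have "chart_map A i ` (chart_dom A i \<inter> chart_dom A j) =
      chart_image S i \<inter> chart_inv A i -` chart_dom A j"
    using chart_map_in[OF assms(1)] chart_inv_in[OF assms(1)] by (force simp: assms)
  then show ?thesis
    using continuous_open_preimage[OF chart_inv_continuous[OF assms(1)] open_chart_image[OF assms(1)]
        open_chart_dom[OF assms(2)]] by simp
qed

lemma transition_components:
  assumes "i \<in> charts A" "j \<in> charts A"
  shows "analytic_components (chart_map A i ` (chart_dom A i \<inter> chart_dom A j)) (transition A i j)"
proof (rule analytic_components_of_analytic)
  show "transition A i j real_analytic_on chart_map A i ` (chart_dom A i \<inter> chart_dom A j)"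
    using manifold assms unfolding analytic_manifold_def by blast
qed

lemma linear_displ: "i \<in> charts A \<Longrightarrow> s \<in> chart_dom A i \<Longrightarrow> linear (displ S i s)"
  using displ_form unfolding analytic_one_form_def by blast

lemma displ_eq_covector:
  assumes "i \<in> charts A" "x \<in> chart_image S i"
  shows "displ S i (chart_inv A i x) v = covector S i x \<bullet> v"
proof -
  have lin: "linear (displ S i (chart_inv A i x))"
    using assms linear_displ by blast
  show ?thesis
    unfolding linear_basis_expansion[OF lin, of v, symmetric]
    by (simp add: covector_def inner_sum_left inner_sum_right inner_commute[of _ v] mult.commute)
qed

lemma covector_inner_Basis: "b \<in> Basis \<Longrightarrow> covector S i x \<bullet> b = displ S i (chart_inv A i x) b"
  by (simp add: covector_def inner_sum_left inner_Basis if_distrib cong: if_cong)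

lemma covector_analytic:
  assumes "i \<in> charts A" "b \<in> Basis"
  shows "(\<lambda>x. covector S i x \<bullet> b) real_analytic_on chart_image S i"
proof -
  have "(\<lambda>x. displ S i (chart_inv A i x) b) real_analytic_on chart_map A i ` chart_dom A i"
    using displ_form assms(1) by (simp add: analytic_one_form_def)
  then show ?thesis
    unfolding covector_inner_Basis[OF assms(2)] chart_image_def .
qed

lemma covector_components: "i \<in> charts A \<Longrightarrow> analytic_components (chart_image S i) (covector S i)"
  unfolding analytic_components_def by (intro ballI covector_analytic analytic_algebra.analytic)

lemmas covector_has_derivative = analytic_components_has_derivative[OF covector_components]

lemma closed_at_iff:
  assumes "(covector S i has_derivative D) (at x)"
  shows "closed_at S i x \<longleftrightarrow> (\<forall>v w. D v \<bullet> w = D w \<bullet> v)"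
  unfolding closed_at_def frechet_derivative_at[OF assms, symmetric] ..

text \<open>
  Naturality of the exterior derivative.  Differentiating the pullback
  \<open>covector S k y \<bullet> v = covector S i (\<tau> y) \<bullet> D y v\<close> along the transition map \<open>\<tau>\<close> produces a term with
  the second derivative of \<open>\<tau>\<close>, which is symmetric and so does not contribute to the antisymmetric
  part.
\<close>

lemma closed_at_chart_change:
  assumes i: "i \<in> charts A" and k: "k \<in> charts A" and s: "s \<in> chart_dom A i" "s \<in> chart_dom A k"
    and closed: "closed_at S i (chart_map A i s)"
  shows "closed_at S k (chart_map A k s)"
proof -
  define W where "W = chart_map A k ` (chart_dom A k \<inter> chart_dom A i)"
  define \<tau> where "\<tau> = transition A k i"
  define y where "y = chart_map A k s"
  have W: "open W" "y \<in> W"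
    using open_chart_overlap[OF k i] s by (auto simp: W_def y_def)
  have \<tau>y: "\<tau> y = chart_map A i s"
    using s k by (simp add: \<tau>_def y_def transition_def)
  have \<tau>_eq: "\<tau> y' \<in> chart_image S i" "chart_inv A i (\<tau> y') = chart_inv A k y'"
     "chart_inv A k y' \<in> chart_dom A k \<inter> chart_dom A i" "y' \<in> chart_image S k"
     "chart_map A k (chart_inv A k y') = y'" if "y' \<in> W" for y'
    using that i k unfolding W_def \<tau>_def transition_def by auto
  obtain D where D: "\<And>y'. y' \<in> W \<Longrightarrow> (\<tau> has_derivative D y') (at y')"
      "\<And>v. analytic_components W (\<lambda>y'. D y' v)"
    using analytic_components_derivative[OF transition_components[OF k i]] unfolding W_def \<tau>_def by blast
  have "\<forall>v. \<exists>E. (\<forall>y'\<in>W. ((\<lambda>y'. D y' v) has_derivative E y') (at y')) \<and>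
      (\<forall>w. analytic_components W (\<lambda>y'. E y' w))"
  proof
    fix v
    obtain E where "\<And>y'. y' \<in> W \<Longrightarrow> ((\<lambda>y'. D y' v) has_derivative E y') (at y')"
      "\<And>w. analytic_components W (\<lambda>y'. E y' w)"
      using analytic_components_derivative[OF D(2)[of v]] by blast
    then show "\<exists>E. (\<forall>y'\<in>W. ((\<lambda>y'. D y' v) has_derivative E y') (at y')) \<and>
      (\<forall>w. analytic_components W (\<lambda>y'. E y' w))"
      by (intro exI[of _ E]) auto
  qed
  from choice[OF this] obtain E where
    E': "\<forall>v. (\<forall>y'\<in>W. ((\<lambda>y'. D y' v) has_derivative E v y') (at y')) \<and>
      (\<forall>w. analytic_components W (\<lambda>y'. E v y' w))" ..
  have E: "((\<lambda>y'. D y' v) has_derivative E v y') (at y')" if "y' \<in> W" for v y'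
    using E' that by blast
  have E_an: "(\<lambda>y'. E v y' w \<bullet> b) \<in> analytic_algebra W" if "b \<in> Basis" for v w b
    using E' that by (simp add: analytic_components_def)
  have E_sym: "E v y w = E w y v" for v w
  proof (rule euclidean_eqI)
    fix b :: 'e assume b: "b \<in> Basis"
    show "E v y w \<bullet> b = E w y v \<bullet> b"
    proof (rule symmetric_second_derivative[OF W, of "\<lambda>y. \<tau> y \<bullet> b" "\<lambda>y v. D y v \<bullet> b" "\<lambda>v y w. E v y w \<bullet> b"])
      show "((\<lambda>y. \<tau> y \<bullet> b) has_derivative (\<lambda>v. D y' v \<bullet> b)) (at y')" if "y' \<in> W" for y'
        by (rule has_derivative_inner_left[OF D(1)[OF that]])
      show "((\<lambda>y. D y v \<bullet> b) has_derivative (\<lambda>w. E v y' w \<bullet> b)) (at y')" if "y' \<in> W" for y' v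
        by (rule has_derivative_inner_left[OF E[OF that]])
      show "continuous_on W (\<lambda>y. E v y w \<bullet> b)" for v w
        by (rule analytic_algebra_continuous_on[OF E_an[OF b]])
    qed
  qed
  have pullback: "covector S k y' \<bullet> v = covector S i (\<tau> y') \<bullet> D y' v" if y': "y' \<in> W" for y' v
  proof -
    define s' where "s' = chart_inv A k y'"
    have s': "s' \<in> chart_dom A k \<inter> chart_dom A i" "chart_map A k s' = y'"
      using \<tau>_eq[OF y'] by (simp_all add: s'_def)
    have "change_coords A k i s' = D y'"
      unfolding change_coords_def s'(2) using frechet_derivative_at[OF D(1)[OF y']] by (simp add: \<tau>_def)
    then have "displ S i s' (D y' v) = displ S k s' v"
      using displ_form i k s'(1) unfolding analytic_one_form_def by metis
    moreover have "displ S i s' (D y' v) = covector S i (\<tau> y') \<bullet> D y' v"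
      using displ_eq_covector[OF i \<tau>_eq(1)[OF y'], of "D y' v"] \<tau>_eq(2)[OF y'] by (simp add: s'_def)
    moreover have "displ S k s' v = covector S k y' \<bullet> v"
      using displ_eq_covector[OF k \<tau>_eq(4)[OF y'], of v] by (simp add: s'_def)
    ultimately show ?thesis
      by simp
  qed
  define \<Lambda>i where "\<Lambda>i x = frechet_derivative (covector S i) (at x)" for x
  define \<Lambda>k where "\<Lambda>k x = frechet_derivative (covector S k) (at x)" for x
  note \<Lambda>iy = covector_has_derivative[OF i \<tau>_eq(1)[OF W(2)], folded \<Lambda>i_def]
    and \<Lambda>ky = covector_has_derivative[OF k \<tau>_eq(4)[OF W(2)], folded \<Lambda>k_def]
  have \<Lambda>: "\<Lambda>k y w \<bullet> v = \<Lambda>i (\<tau> y) (D y w) \<bullet> D y v + covector S i (\<tau> y) \<bullet> E v y w" for v w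
  proof -
    have "((\<lambda>y'. covector S i (\<tau> y') \<bullet> D y' v) has_derivative
        (\<lambda>w. covector S i (\<tau> y) \<bullet> E v y w + \<Lambda>i (\<tau> y) (D y w) \<bullet> D y v)) (at y)"
      by (rule has_derivative_inner[OF has_derivative_compose[OF D(1)[OF W(2)] \<Lambda>iy] E[OF W(2)]])
    then have 1: "((\<lambda>y'. covector S k y' \<bullet> v) has_derivative
        (\<lambda>w. covector S i (\<tau> y) \<bullet> E v y w + \<Lambda>i (\<tau> y) (D y w) \<bullet> D y v)) (at y)"
      by (rule has_derivative_transform_within_open[OF _ W]) (simp add: pullback)
    have 2: "((\<lambda>y'. covector S k y' \<bullet> v) has_derivative (\<lambda>w. \<Lambda>k y w \<bullet> v)) (at y)"
      by (rule has_derivative_inner_left[OF \<Lambda>ky])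
    show ?thesis
      using fun_cong[OF has_derivative_unique[OF 2 1], of w] by simp
  qed
  have "\<Lambda>i (\<tau> y) v \<bullet> w = \<Lambda>i (\<tau> y) w \<bullet> v" for v w
    using closed closed_at_iff[OF \<Lambda>iy] unfolding \<tau>y by blast
  then have "\<Lambda>k y v \<bullet> w = \<Lambda>k y w \<bullet> v" for v w
    unfolding \<Lambda> by (simp add: E_sym)
  then show ?thesis
    using closed_at_iff[OF \<Lambda>ky] by (simp add: y_def)
qed

lemma closed_at_identity:
  assumes i: "i \<in> charts A" and U: "open U" "connected U" "U \<subseteq> chart_image S i"
    and V: "open V" "V \<noteq> {}" "V \<subseteq> U" and closed: "\<And>x. x \<in> V \<Longrightarrow> closed_at S i x" and x: "x \<in> U"
  shows "closed_at S i x"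
proof -
  define q where "q b c = partial_deriv b (\<lambda>x. covector S i x \<bullet> c)" for b c
  define \<Lambda> where "\<Lambda> x = frechet_derivative (covector S i) (at x)" for x
  note \<Lambda> = covector_has_derivative[OF i, folded \<Lambda>_def]
  have q: "q b c y = \<Lambda> y b \<bullet> c" if "y \<in> chart_image S i" for b c y
  proof -
    have "((\<lambda>x. covector S i x \<bullet> c) has_derivative (\<lambda>v. \<Lambda> y v \<bullet> c)) (at y)"
      by (rule has_derivative_inner_left[OF \<Lambda>[OF that]])
    then show ?thesis
      unfolding q_def partial_deriv_def by (simp add: frechet_derivative_at[symmetric])
  qed
  have zero: "q b c x - q c b x = 0" if bc: "b \<in> Basis" "c \<in> Basis" for b c
  proof (rule real_analytic_identity[OF _ U(1,2) V _ x])
    have "(\<lambda>x. q b c x - q c b x) real_analytic_on chart_image S i"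
      unfolding q_def using bc
      by (intro real_analytic_on_diff real_analytic_on_partial_deriv covector_analytic i)
    then show "(\<lambda>x. q b c x - q c b x) real_analytic_on U"
      using U(3) unfolding real_analytic_on_def by blast
    fix y assume "y \<in> V"
    then have "y \<in> chart_image S i" "closed_at S i y"
      using V U closed by blast+
    then show "q b c y - q c b y = 0"
      using closed_at_iff[OF \<Lambda>] by (simp add: q)
  qed
  have xU: "x \<in> chart_image S i"
    using x U by blast
  have "bilinear (\<lambda>v w. \<Lambda> x v \<bullet> w)" "bilinear (\<lambda>v w. \<Lambda> x w \<bullet> v)"
    using has_derivative_linear[OF \<Lambda>[OF xU]]
    by (auto simp: bilinear_def linear_add linear_scale inner_simps intro!: linearI)
  then have "(\<lambda>v w. \<Lambda> x v \<bullet> w) = (\<lambda>v w. \<Lambda> x w \<bullet> v)"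
    by (rule bilinear_eq_stdbasis) (use zero q xU in auto)
  then show ?thesis
    unfolding closed_at_iff[OF \<Lambda>[OF xU]] by metis
qed

text \<open>
  Let \<open>W\<close> be the set of shapes around which the displacement form is closed in all charts.  It is
  open by definition.  It is closed because a chart around a limit point contains a ball that meets
  \<open>W\<close>, on which the identity theorem applies.
\<close>

lemma closed_everywhere:
  assumes i0: "i0 \<in> charts A" and V0: "open V0" "V0 \<noteq> {}" "V0 \<subseteq> chart_image S i0"
    and closed: "\<And>x. x \<in> V0 \<Longrightarrow> closed_at S i0 x"
    and i: "i \<in> charts A" and x: "x \<in> chart_image S i"
  shows "closed_at S i x"
proof -
  define W where "W = {s. \<exists>V. open V \<and> s \<in> V \<and>
     (\<forall>s'\<in>V. \<forall>j\<in>charts A. s' \<in> chart_dom A j \<longrightarrow> closed_at S j (chart_map A j s'))}"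
  have preimage: "open (chart_dom A j \<inter> chart_map A j -` B)" if "j \<in> charts A" "open B" for j B
    by (rule continuous_open_preimage[OF chart_map_continuous[OF that(1)] open_chart_dom[OF that(1)] that(2)])
  have in_W: "s \<in> W" if j: "j \<in> charts A" and B: "open B" and cl: "\<And>y. y \<in> B \<Longrightarrow> closed_at S j y"
    and s: "s \<in> chart_dom A j" "chart_map A j s \<in> B" for j B s
  proof -
    have "closed_at S k (chart_map A k s')"
      if "s' \<in> chart_dom A j \<inter> chart_map A j -` B" "k \<in> charts A" "s' \<in> chart_dom A k" for k s'
      using that closed_at_chart_change[OF j that(2), of s'] cl by blast
    then show ?thesis
      unfolding W_def using preimage[OF j B] s by blast
  qed
  have "open W"
    unfolding W_def open_subopen[of "{s. _ s}"] by blast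
  moreover have "closed W"
  proof -
    have "s \<in> W" if s: "s \<in> closure W" for s
    proof -
      obtain j where j: "j \<in> charts A" "s \<in> chart_dom A j"
        using chart_cover by blast
      obtain r where r: "r > 0" "ball (chart_map A j s) r \<subseteq> chart_image S j"
        using open_chart_image[OF j(1)] chart_map_in[OF j] open_contains_ball by metis
      define B where "B = ball (chart_map A j s) r"
      define N where "N = chart_dom A j \<inter> chart_map A j -` B"
      have N: "open N" "s \<in> N"
        using preimage[OF j(1), of B] j(2) r(1) by (auto simp: N_def B_def)
      obtain s1 where s1: "s1 \<in> W" "s1 \<in> N"
        using s N by (metis closure_iff_nhds_not_empty disjoint_iff subset_refl)
      then obtain V where V: "open V" "s1 \<in> V"
        "\<And>s' j. s' \<in> V \<Longrightarrow> j \<in> charts A \<Longrightarrow> s' \<in> chart_dom A j \<Longrightarrow> closed_at S j (chart_map A j s')"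
        unfolding W_def by blast
      \<comment> \<open>Near \<open>s1\<close>, the ball \<open>B\<close> contains an open set on which the form is already known to be closed.\<close>
      define V' where "V' = B \<inter> chart_inv A j -` V"
      have V': "open V'"
        unfolding V'_def
        by (rule continuous_open_preimage[OF continuous_on_subset[OF chart_inv_continuous[OF j(1)]] _ V(1)])
           (use r(2) in \<open>auto simp: B_def\<close>)
      have "chart_map A j s1 \<in> V'"
        using s1 V(2) j(1) by (auto simp: V'_def N_def)
      then have ne: "V' \<noteq> {}"
        by blast
      have cl: "closed_at S j y" if "y \<in> V'" for y
      proof -
        have "y \<in> chart_image S j"
          using that r(2) by (auto simp: V'_def B_def)
        then show ?thesis
          using V(3)[of "chart_inv A j y" j] that j(1) chart_inv_in[OF j(1)] by (simp add: V'_def)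
      qed
      have B: "open B" "connected B" "B \<subseteq> chart_image S j"
        using r(2) by (simp_all add: B_def)
      have "V' \<subseteq> B"
        by (auto simp: V'_def)
      then have clB: "closed_at S j y" if "y \<in> B" for y
        by (rule closed_at_identity[OF j(1) B V' ne _ cl that])
      have "chart_map A j s \<in> B"
        using r(1) by (simp add: B_def)
      with clB show ?thesis
        by (intro in_W[OF j(1) B(1) _ j(2)])
    qed
    then show ?thesis
      using closure_subset_eq by blast
  qed
  moreover have "W \<noteq> {}"
  proof -
    obtain y where "y \<in> V0"
      using V0 by blast
    then have y: "y \<in> V0" "y \<in> chart_image S i0"
      using V0 by blast+
    have "chart_inv A i0 y \<in> W"
      by (rule in_W[OF i0 V0(1) closed]) (use y i0 in \<open>auto simp: chart_inv_in\<close>)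
    then show ?thesis
      by blast
  qed
  ultimately have "W = UNIV"
    using connected_shapes unfolding connected_clopen by auto
  then have "chart_inv A i x \<in> W"
    by simp
  then have "closed_at S i (chart_map A i (chart_inv A i x))"
    unfolding W_def using i chart_inv_in[OF i x] by blast
  then show ?thesis
    using i x by simp
qed

end

section \<open>The Lie algebra of the lifted fields\<close>

lemma analytic_components_add:
  assumes "analytic_components U f" "analytic_components U g"
  shows "analytic_components U (\<lambda>x. f x + g x)"
  using assms unfolding analytic_components_def inner_add_left
  by (auto intro: analytic_algebra.add)

lemma analytic_components_diff:
  assumes "analytic_components U f" "analytic_components U g"
  shows "analytic_components U (\<lambda>x. f x - g x)"
  using assms unfolding analytic_components_def inner_diff_left
  by (auto intro: analytic_algebra_diff)

lemma analytic_components_scaleR: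
  assumes "f \<in> analytic_algebra U" "analytic_components U g"
  shows "analytic_components U (\<lambda>x. f x *\<^sub>R g x)"
  using assms unfolding analytic_components_def inner_scaleR_left
  by (auto intro: analytic_algebra.mult)

lemma analytic_components_sum:
  assumes "\<And>i. i \<in> I \<Longrightarrow> analytic_components U (f i)"
  shows "analytic_components U (\<lambda>x. \<Sum>i\<in>I. f i x)"
  using assms unfolding analytic_components_def inner_sum_left
  by (auto intro: analytic_algebra_sum)

context analytic_swimmer
begin

text \<open>
  The inverse is chosen by \<open>inv_into\<close>, so this needs the injectivity of the product chart.
\<close>

lemma chart_inv_times_real:
  assumes i: "i \<in> charts A" and x: "x \<in> chart_image S i"
  shows "chart_inv (times_real A) i (x, r) = (chart_inv A i x, r)"
proof -
  have inj: "inj_on (chart_map A i) (chart_dom A i)"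
    by (rule inj_on_inverseI[of _ "chart_inv A i"]) (simp add: i)
  show ?thesis
    unfolding chart_inv_def[of "times_real A"]
  proof (rule inv_into_f_eq)
    show "inj_on (chart_map (times_real A) i) (chart_dom (times_real A) i)"
      using inj by (auto simp: times_real_def inj_on_def)
    show "(chart_inv A i x, r) \<in> chart_dom (times_real A) i"
      using i x by (simp add: times_real_def chart_inv_in)
    show "chart_map (times_real A) i (chart_inv A i x, r) = (x, r)"
      using i x by (simp add: times_real_def)
  qed
qed

text \<open>
  In the chart \<open>i\<close> the field is \<open>(G, L G)\<close>, that is, its values lie in the graph of the displacement form
  and are the same for all values of the real coordinate.  The condition on \<open>G\<close> makes iterated brackets
  differentiable.
\<close>

definition graph_field :: "'i \<Rightarrow> ('i, 's \<times> real, 'e \<times> real) vfield \<Rightarrow> bool" where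
  "graph_field i W \<longleftrightarrow> (\<exists>G. analytic_components (chart_image S i) G \<and>
     (\<forall>x\<in>chart_image S i. \<forall>r. W i (chart_inv A i x, r) = (G x, covector S i x \<bullet> G x)))"

text \<open>
  The second component of the bracket is \<open>L [G1, G2] + dL(G1, G2)\<close>.
\<close>

lemma graph_field_lie_bracket:
  assumes i: "i \<in> charts A" and closed: "\<And>x. x \<in> chart_image S i \<Longrightarrow> closed_at S i x"
    and W1: "graph_field i W1" and W2: "graph_field i W2"
  shows "graph_field i (lie_bracket (times_real A) W1 W2)"
proof -
  define U where "U = chart_image S i"
  define \<Lambda> where "\<Lambda> x = frechet_derivative (covector S i) (at x)" for x
  have U: "open U"
    using open_chart_image[OF i] by (simp add: U_def)
  obtain G1 G2 where G1: "analytic_components U G1"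
      "\<And>x r. x \<in> U \<Longrightarrow> W1 i (chart_inv A i x, r) = (G1 x, covector S i x \<bullet> G1 x)"
    and G2: "analytic_components U G2"
      "\<And>x r. x \<in> U \<Longrightarrow> W2 i (chart_inv A i x, r) = (G2 x, covector S i x \<bullet> G2 x)"
    using W1 W2 unfolding graph_field_def U_def by blast
  obtain D1 where D1: "\<And>x. x \<in> U \<Longrightarrow> (G1 has_derivative D1 x) (at x)"
      "\<And>v. analytic_components U (\<lambda>x. D1 x v)"
    using analytic_components_derivative[OF G1(1)] by blast
  obtain D2 where D2: "\<And>x. x \<in> U \<Longrightarrow> (G2 has_derivative D2 x) (at x)"
      "\<And>v. analytic_components U (\<lambda>x. D2 x v)"
    using analytic_components_derivative[OF G2(1)] by blast
  have der: "frechet_derivative (\<lambda>z. W i (chart_inv (times_real A) i z)) (at (x, r)) h =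
      (D x (fst h), covector S i x \<bullet> D x (fst h) + \<Lambda> x (fst h) \<bullet> G x)"
    if x: "x \<in> U" and W: "\<And>x r. x \<in> U \<Longrightarrow> W i (chart_inv A i x, r) = (G x, covector S i x \<bullet> G x)"
      and D: "(G has_derivative D x) (at x)" for W G D x r h
  proof -
    have fst: "(fst has_derivative fst) (at (x, r))"
      by (rule bounded_linear_imp_has_derivative[OF bounded_linear_fst])
    have G: "((\<lambda>z. G (fst z)) has_derivative (\<lambda>h. D x (fst h))) (at (x, r))"
      by (rule has_derivative_compose[OF fst]) (simp add: D)
    have c: "((\<lambda>z. covector S i (fst z)) has_derivative (\<lambda>h. \<Lambda> x (fst h))) (at (x, r))"
      by (rule has_derivative_compose[OF fst])
         (use covector_has_derivative[OF i] x in \<open>simp add: \<Lambda>_def U_def\<close>)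
    have eq: "(G (fst z), covector S i (fst z) \<bullet> G (fst z)) = W i (chart_inv (times_real A) i z)"
      if "z \<in> U \<times> UNIV" for z
      using that W chart_inv_times_real[OF i] by (cases z) (simp add: U_def)
    have "((\<lambda>z. W i (chart_inv (times_real A) i z)) has_derivative
        (\<lambda>h. (D x (fst h), covector S i x \<bullet> D x (fst h) + \<Lambda> x (fst h) \<bullet> G x))) (at (x, r))"
      by (rule has_derivative_transform_within_open[OF _ open_Times[OF U open_UNIV] _ eq])
         (use has_derivative_Pair[OF G has_derivative_inner[OF c G]] x in auto)
    then show ?thesis
      by (simp add: frechet_derivative_at[symmetric])
  qed
  define G where "G x = (\<Sum>b\<in>Basis. (G1 x \<bullet> b) *\<^sub>R D2 x b) - (\<Sum>b\<in>Basis. (G2 x \<bullet> b) *\<^sub>R D1 x b)" for x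
  have G_eq: "G x = D2 x (G1 x) - D1 x (G2 x)" if "x \<in> U" for x
    unfolding G_def linear_basis_expansion[OF has_derivative_linear[OF D1(1)[OF that]]]
      linear_basis_expansion[OF has_derivative_linear[OF D2(1)[OF that]]] ..
  have inner: "(\<lambda>x. G1 x \<bullet> b) \<in> analytic_algebra U" "(\<lambda>x. G2 x \<bullet> b) \<in> analytic_algebra U" for b
    by (intro analytic_components_inner G1(1) G2(1) analytic_components_const)+
  have "analytic_components U G"
    unfolding G_def
    by (intro analytic_components_diff analytic_components_sum analytic_components_scaleR inner D1(2) D2(2))
  moreover have "lie_bracket (times_real A) W1 W2 i (chart_inv A i x, r) = (G x, covector S i x \<bullet> G x)"
    if x: "x \<in> U" for x r
  proof -
    have map: "chart_map (times_real A) i (chart_inv A i x, r) = (x, r)"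
      using i x by (simp add: times_real_def U_def)
    have "\<Lambda> x (G1 x) \<bullet> G2 x = \<Lambda> x (G2 x) \<bullet> G1 x"
      using closed[of x] x unfolding closed_at_def \<Lambda>_def U_def by blast
    moreover have "frechet_derivative (\<lambda>z. W2 i (chart_inv (times_real A) i z)) (at (x, r)) h =
        (D2 x (fst h), covector S i x \<bullet> D2 x (fst h) + \<Lambda> x (fst h) \<bullet> G2 x)" for h
      by (rule der[where W=W2 and G=G2 and D=D2]) (use x G2(2) D2(1) in simp_all)
    moreover have "frechet_derivative (\<lambda>z. W1 i (chart_inv (times_real A) i z)) (at (x, r)) h =
        (D1 x (fst h), covector S i x \<bullet> D1 x (fst h) + \<Lambda> x (fst h) \<bullet> G1 x)" for h
      by (rule der[where W=W1 and G=G1 and D=D1]) (use x G1(2) D1(1) in simp_all)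
    ultimately show ?thesis
      unfolding lie_bracket_def map G1(2)[OF x] G2(2)[OF x] G_eq[OF x]
      by (simp add: inner_diff_right)
  qed
  ultimately show ?thesis
    unfolding graph_field_def U_def by blast
qed

lemma graph_field_lie_algebra:
  assumes i: "i \<in> charts A" and closed: "\<And>x. x \<in> chart_image S i \<Longrightarrow> closed_at S i x"
    and F: "\<And>W. W \<in> F \<Longrightarrow> graph_field i W" and W: "W \<in> lie_algebra (times_real A) F"
  shows "graph_field i W"
  using W
proof induction
  case (gen W)
  then show ?case
    by (rule F)
next
  case zero
  show ?case
    unfolding graph_field_def
    by (intro exI[of _ "\<lambda>_. 0"] conjI analytic_components_const) (simp add: zero_prod_def)
next
  case (add W1 W2)
  then obtain G1 G2 where "analytic_components (chart_image S i) G1"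
      "\<forall>x\<in>chart_image S i. \<forall>r. W1 i (chart_inv A i x, r) = (G1 x, covector S i x \<bullet> G1 x)"
      "analytic_components (chart_image S i) G2"
      "\<forall>x\<in>chart_image S i. \<forall>r. W2 i (chart_inv A i x, r) = (G2 x, covector S i x \<bullet> G2 x)"
    unfolding graph_field_def by blast
  then show ?case
    unfolding graph_field_def
    by (intro exI[of _ "\<lambda>x. G1 x + G2 x"] conjI analytic_components_add) (auto simp: inner_add_right)
next
  case (scale W a)
  then obtain G where "analytic_components (chart_image S i) G"
      "\<forall>x\<in>chart_image S i. \<forall>r. W i (chart_inv A i x, r) = (G x, covector S i x \<bullet> G x)"
    unfolding graph_field_def by blast
  then show ?case
    unfolding graph_field_def
    by (intro exI[of _ "\<lambda>x. a *\<^sub>R G x"] conjI analytic_components_scaleR analytic_algebra.const) auto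
next
  case (bracket W1 W2)
  then show ?case
    by (intro graph_field_lie_bracket i closed)
qed

lemma graph_field_lift:
  assumes i: "i \<in> charts A" and Y: "analytic_vector_field A Y"
  shows "graph_field i (lift_field S Y)"
proof -
  have "(\<lambda>x. Y i (chart_inv A i x)) real_analytic_on chart_image S i"
    using Y i by (simp add: analytic_vector_field_def chart_image_def)
  then have "analytic_components (chart_image S i) (\<lambda>x. Y i (chart_inv A i x))"
    by (rule analytic_components_of_analytic)
  moreover have "lift_field S Y i (chart_inv A i x, r) =
      (Y i (chart_inv A i x), covector S i x \<bullet> Y i (chart_inv A i x))" if "x \<in> chart_image S i" for x r
    using displ_eq_covector[OF i that] by (simp add: lift_field_def)
  ultimately show ?thesis
    unfolding graph_field_def by blast
qed

text \<open>
  If the form were closed on a nonempty open set, it would be closed everywhere, and the Lie algebra of the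
  lifted fields would at every point be contained in a graph of dimension \<open>dim S\<close>.
\<close>

lemma controllable_imp_not_closed:
  assumes contr: "controllable S"
    and i0: "i0 \<in> charts A" and V: "open V" "V \<noteq> {}" "V \<subseteq> chart_image S i0"
  shows "\<exists>x\<in>V. \<not> closed_at S i0 x"
proof (rule ccontr)
  assume "\<not> (\<exists>x\<in>V. \<not> closed_at S i0 x)"
  then have closed: "closed_at S i x" if "i \<in> charts A" "x \<in> chart_image S i" for i x
    using closed_everywhere[OF i0 V _ that] by blast
  obtain p X i \<xi> where X: "spanning_family S p X" and i: "i \<in> charts A"
    and \<xi>: "\<xi> \<in> chart_dom (times_real A) i"
    and dim: "dim (lie_at (times_real A) ((\<lambda>j. lift_field S (X j)) ` {..<p}) i \<xi>) = DIM('e \<times> real)"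
    using contr unfolding controllable_def by blast
  obtain s r where s: "\<xi> = (s, r)" "s \<in> chart_dom A i"
    using \<xi> by (auto simp: times_real_def)
  define x where "x = chart_map A i s"
  have x: "x \<in> chart_image S i" "chart_inv A i x = s"
    using s i by (auto simp: x_def)
  define L where "L v = (v, covector S i x \<bullet> v)" for v
  have "linear L"
    by (rule linearI) (simp_all add: L_def inner_add_right)
  have "lie_at (times_real A) ((\<lambda>j. lift_field S (X j)) ` {..<p}) i \<xi> \<subseteq> L ` UNIV"
  proof
    fix v assume "v \<in> lie_at (times_real A) ((\<lambda>j. lift_field S (X j)) ` {..<p}) i \<xi>"
    then obtain W where W: "v = W i \<xi>" "W \<in> lie_algebra (times_real A) ((\<lambda>j. lift_field S (X j)) ` {..<p})"
      unfolding lie_at_def by blast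
    have "graph_field i W"
    proof (rule graph_field_lie_algebra[OF i closed[OF i] _ W(2)])
      fix W' assume "W' \<in> (\<lambda>j. lift_field S (X j)) ` {..<p}"
      then show "graph_field i W'"
        using graph_field_lift[OF i] X unfolding spanning_family_def by auto
    qed
    then show "v \<in> L ` UNIV"
      unfolding graph_field_def W(1) s(1) L_def using x by auto
  qed
  then have "DIM('e \<times> real) \<le> dim (L ` UNIV)"
    using dim_subset unfolding dim[symmetric] by blast
  also have "\<dots> \<le> dim (UNIV :: 'e set)"
    by (rule dim_image_le[OF \<open>linear L\<close>])
  finally show False
    by simp
qed

end

section \<open>The chain rule along curves with bounded velocity\<close>

lemma linear_family_absolutely_integrable:
  fixes D :: "'a::euclidean_space \<Rightarrow> 'a \<Rightarrow> 'b::euclidean_space"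
  assumes w: "bounded_measurable T w" and ab: "0 \<le> a" "b \<le> T"
    and x: "continuous_on {a..b} x" "x ` {a..b} \<subseteq> W"
    and lin: "\<And>y. y \<in> W \<Longrightarrow> linear (D y)" and D: "\<And>v. continuous_on W (\<lambda>y. D y v)"
  shows "(\<lambda>t. D (x t) (w t)) absolutely_integrable_on {a..b}"
proof -
  have prod: "(\<lambda>t. (w t \<bullet> e) *\<^sub>R D (x t) e) absolutely_integrable_on {a..b}" for e
  proof -
    have cont: "continuous_on {a..b} (\<lambda>t. D (x t) e)"
      by (rule continuous_on_compose2[OF D x])
    have "(\<lambda>t. (\<lambda>u s. s *\<^sub>R u) (D (x t) e) (w t \<bullet> e)) absolutely_integrable_on {a..b}"
    proof (rule absolutely_integrable_bounded_measurable_product[where h="\<lambda>u s. s *\<^sub>R u"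
          and f="\<lambda>t. D (x t) e" and g="\<lambda>t. w t \<bullet> e"])
      show "bilinear (\<lambda>(u::'b) s. s *\<^sub>R u)"
        by (auto simp: bilinear_def algebra_simps intro!: linearI)
      show "(\<lambda>t. D (x t) e) \<in> borel_measurable (lebesgue_on {a..b})"
        by (rule continuous_imp_measurable_on_sets_lebesgue[OF cont]) auto
      show "bounded ((\<lambda>t. D (x t) e) ` {a..b})"
        by (intro compact_imp_bounded compact_continuous_image cont) auto
      show "(\<lambda>t. w t \<bullet> e) absolutely_integrable_on {a..b}"
        by (rule bounded_measurable_absolutely_integrable[OF bounded_measurable_inner[OF w] ab])
    qed auto
    then show ?thesis
      by simp
  qed
  have eq: "(\<Sum>e\<in>Basis. (w t \<bullet> e) *\<^sub>R D (x t) e) = D (x t) (w t)" if "t \<in> {a..b}" for t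
    by (rule linear_basis_expansion[OF lin]) (use x(2) that in blast)
  have "(\<lambda>t. \<Sum>e\<in>Basis. (w t \<bullet> e) *\<^sub>R D (x t) e) absolutely_integrable_on {a..b}"
    by (intro absolutely_integrable_sum prod) auto
  then show ?thesis
    by (rule absolutely_integrable_spike[OF _ negligible_empty]) (use eq in auto)
qed

lemma linear_family_operator_continuous:
  fixes D :: "'a::euclidean_space \<Rightarrow> 'a \<Rightarrow> 'b::euclidean_space"
  assumes W: "open W" "y0 \<in> W" and lin: "\<And>y. y \<in> W \<Longrightarrow> linear (D y)"
    and D: "\<And>v. continuous_on W (\<lambda>y. D y v)" and e: "e > 0"
  obtains d where "d > 0" "\<And>y v. norm (y - y0) < d \<Longrightarrow> y \<in> W \<and> norm (D y v - D y0 v) \<le> e * norm v"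
proof -
  define e' where "e' = e / real DIM('a)"
  have e': "e' > 0"
    using e by (simp add: e'_def)
  have "\<forall>\<^sub>F y in nhds y0. y \<in> W \<and> (\<forall>b\<in>Basis. dist (D y b) (D y0 b) < e')"
  proof (intro eventually_conj eventually_ball_finite ballI)
    show "\<forall>\<^sub>F y in nhds y0. y \<in> W"
      using W by (rule eventually_nhds_in_open)
    fix b :: 'a
    have "isCont (\<lambda>y. D y b) y0"
      using D W continuous_on_eq_continuous_at by blast
    then have "((\<lambda>y. D y b) \<longlongrightarrow> D y0 b) (nhds y0)"
      unfolding isCont_def by (rule tendsto_at_iff_tendsto_nhds[THEN iffD1])
    then show "\<forall>\<^sub>F y in nhds y0. dist (D y b) (D y0 b) < e'"
      using e' by (rule tendstoD)
  qed auto
  then obtain d where d: "d > 0"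
    "\<And>y. dist y y0 < d \<Longrightarrow> y \<in> W \<and> (\<forall>b\<in>Basis. dist (D y b) (D y0 b) < e')"
    unfolding eventually_nhds_metric by blast
  have "norm (D y v - D y0 v) \<le> e * norm v" if y: "norm (y - y0) < d" for y v
  proof -
    have dy: "y \<in> W" "\<And>b. b \<in> Basis \<Longrightarrow> dist (D y b) (D y0 b) < e'"
      using d(2)[of y] y by (auto simp: dist_norm)
    have "linear (\<lambda>v. D y v - D y0 v)"
      by (intro linear_compose_sub lin dy W)
    moreover have "norm (D y b - D y0 b) \<le> e'" if "b \<in> Basis" for b
      using dy(2)[OF that] by (simp add: dist_norm)
    ultimately have "norm (D y v - D y0 v) \<le> (\<Sum>b\<in>(Basis::'a set). e') * norm v"
      by (rule linear_norm_le_basis_sum)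
    then show ?thesis
      by (simp add: e'_def)
  qed
  then show ?thesis
    using that[of d] d by (auto simp: dist_norm)
qed

text \<open>
  The difference \<open>F\<close> of the two sides satisfies \<open>\<bar>F d - F c\<bar> \<le> e (d - c)\<close> on short intervals \<open>[c, d]\<close> with
  one end at a given time \<open>t\<close>: there \<open>\<tau>\<close> is close to its linearisation at \<open>x t\<close>, \<open>D (x r)\<close> is close to
  \<open>D (x t)\<close>, and the velocity is bounded.  So \<open>F\<close> has derivative zero everywhere, although the curve
  itself need not be differentiable at every time.
\<close>

lemma curve_chain_rule:
  fixes \<tau> :: "'a::euclidean_space \<Rightarrow> 'b::euclidean_space"
  assumes w: "bounded_measurable T w" and ab: "0 \<le> a" "b \<le> T"
    and x: "curve x0 w ` {a..b} \<subseteq> W" and W: "open W"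
    and \<tau>: "\<And>y. y \<in> W \<Longrightarrow> (\<tau> has_derivative D y) (at y)"
    and D: "\<And>v. continuous_on W (\<lambda>y. D y v)"
  shows "(\<lambda>t. D (curve x0 w t) (w t)) absolutely_integrable_on {a..b}"
    and "t \<in> {a..b} \<Longrightarrow> integral {a..t} (\<lambda>t. D (curve x0 w t) (w t)) = \<tau> (curve x0 w t) - \<tau> (curve x0 w a)"
proof -
  define x where "x = curve x0 w"
  define f where "f t = D (x t) (w t)" for t
  have lin: "linear (D y)" if "y \<in> W" for y
    using \<tau>[OF that] by (rule has_derivative_linear)
  have xW: "x r \<in> W" if "r \<in> {a..b}" for r
    using assms(4) that by (auto simp: x_def)
  have xc: "continuous_on {a..b} x"
    using continuous_on_subset[OF curve_continuous_on[OF w]] ab by (simp add: x_def)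
  show int: "(\<lambda>t. D (curve x0 w t) (w t)) absolutely_integrable_on {a..b}"
    by (rule linear_family_absolutely_integrable[OF w ab xc[unfolded x_def] assms(4) lin D])
  then have fint: "f integrable_on {a..b}"
    unfolding f_def x_def absolutely_integrable_on_def by blast
  obtain B where B: "\<And>t. t \<in> {0..T} \<Longrightarrow> norm (w t) \<le> B"
    using w unfolding bounded_measurable_def by blast
  define M where "M = \<bar>B\<bar> + 1"
  have M: "M > 0" "\<And>t. t \<in> {0..T} \<Longrightarrow> norm (w t) \<le> M"
  proof -
    show "M > 0"
      by (simp add: M_def)
    show "norm (w t) \<le> M" if "t \<in> {0..T}" for t
      using B[OF that] by (simp add: M_def)
  qed
  have x_diff: "x d - x c = integral {c..d} w" if "a \<le> c" "c \<le> d" "d \<le> b" for c d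
    using curve_diff[OF w] that ab by (simp add: x_def)
  have x_lip: "norm (x d - x c) \<le> M * (d - c)" if "a \<le> c" "c \<le> d" "d \<le> b" for c d
  proof -
    have "norm (integral {c..d} w) \<le> integral {c..d} (\<lambda>_. M)"
      using that ab M
      by (intro Henstock_Kurzweil_Integration.integral_norm_bound_integral bounded_measurable_integrable[OF w]) auto
    then show ?thesis
      using that x_diff by (simp add: mult.commute)
  qed
  define F where "F t = \<tau> (x t) - integral {a..t} f" for t
  have F_diff: "F d - F c = \<tau> (x d) - \<tau> (x c) - integral {c..d} f" if "a \<le> c" "c \<le> d" "d \<le> b" for c d
  proof -
    have "integral {a..c} f + integral {c..d} f = integral {a..d} f"
      using that fint integrable_subinterval_real[OF fint, of a d]
      by (intro Henstock_Kurzweil_Integration.integral_combine) auto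
    then show ?thesis
      by (simp add: F_def algebra_simps)
  qed
  have local: "\<exists>\<delta>>0. \<forall>c d. a \<le> c \<and> c \<le> d \<and> d \<le> b \<and> d - c < \<delta> \<and> t \<in> {c, d} \<longrightarrow>
      norm (F d - F c) \<le> e * (d - c)" if t: "t \<in> {a..b}" and e: "e > 0" for t e
  proof -
    \<comment> \<open>Linearising \<open>\<tau>\<close> and freezing \<open>D\<close> at \<open>x t\<close> each contribute an error \<open>e' M (d - c)\<close>.\<close>
    define e' where "e' = e / (2 * M)"
    have e': "e' > 0"
      using e M by (simp add: e'_def)
    obtain d1 where d1: "d1 > 0"
      "\<And>y v. norm (y - x t) < d1 \<Longrightarrow> y \<in> W \<and> norm (D y v - D (x t) v) \<le> e' * norm v"
      using linear_family_operator_continuous[OF W xW[OF t] lin D e'] by blast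
    obtain d2 where d2: "d2 > 0"
      "\<And>y. norm (y - x t) < d2 \<Longrightarrow> norm (\<tau> y - \<tau> (x t) - D (x t) (y - x t)) \<le> e' * norm (y - x t)"
      using \<tau>[OF xW[OF t]] e' unfolding has_derivative_at_alt by blast
    define \<delta> where "\<delta> = min d1 d2 / M"
    have \<delta>: "\<delta> > 0"
      using d1 d2 M by (simp add: \<delta>_def)
    have "norm (F d - F c) \<le> e * (d - c)"
      if cd: "a \<le> c" "c \<le> d" "d \<le> b" "d - c < \<delta>" "t \<in> {c, d}" for c d
    proof -
      have close: "norm (x r - x t) < min d1 d2" if r: "r \<in> {c..d}" for r
      proof -
        have "norm (x r - x t) \<le> M * (d - c)"
        proof (cases "r \<le> t")
          case True
          then have "norm (x t - x r) \<le> M * (t - r)"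
            using cd r by (intro x_lip) auto
          also have "\<dots> \<le> M * (d - c)"
            using cd r M by (intro mult_left_mono) auto
          finally show ?thesis
            by (simp add: norm_minus_commute)
        next
          case False
          then have "norm (x r - x t) \<le> M * (r - t)"
            using cd r by (intro x_lip) auto
          also have "\<dots> \<le> M * (d - c)"
            using cd r M by (intro mult_left_mono) auto
          finally show ?thesis .
        qed
        also have "\<dots> < M * \<delta>"
          using cd(4) M by simp
        also have "\<dots> = min d1 d2"
          using M by (simp add: \<delta>_def)
        finally show ?thesis .
      qed
      have linT: "linear (D (x t))"
        using lin xW[OF t] .
      have wint: "w integrable_on {c..d}"
        using cd ab by (intro bounded_measurable_integrable[OF w]) auto
      have 1: "norm (\<tau> (x d) - \<tau> (x c) - D (x t) (x d - x c)) \<le> e' * norm (x d - x c)"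
      proof (cases "t = c")
        case True
        then show ?thesis
          using d2(2)[of "x d"] close[of d] cd by simp
      next
        case False
        then have "t = d"
          using cd by simp
        moreover have "norm (\<tau> (x c) - \<tau> (x d) - D (x d) (x c - x d)) \<le> e' * norm (x c - x d)"
          using d2(2)[of "x c"] close[of c] cd \<open>t = d\<close> by simp
        moreover have "\<tau> (x c) - \<tau> (x d) - D (x d) (x c - x d) = - (\<tau> (x d) - \<tau> (x c) - D (x d) (x d - x c))"
          using linear_neg[OF linT, of "x d - x c"] \<open>t = d\<close> by simp
        ultimately show ?thesis
          by (metis norm_minus_cancel norm_minus_commute)
      qed
      have Dw: "((\<lambda>r. D (x t) (w r)) has_integral D (x t) (x d - x c)) {c..d}"
        using has_integral_linear[OF integrable_integral[OF wint], of "D (x t)"] linT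
        unfolding x_diff[OF cd(1-3)] by (simp add: o_def linear_conv_bounded_linear)
      have fcd: "f integrable_on {c..d}"
        using integrable_subinterval_real[OF fint, of c d] cd by auto
      have "integral {c..d} f - D (x t) (x d - x c) = integral {c..d} (\<lambda>r. f r - D (x t) (w r))"
        using Henstock_Kurzweil_Integration.integral_diff[OF fcd has_integral_integrable[OF Dw]]
          integral_unique[OF Dw] by simp
      also have "norm \<dots> \<le> integral {c..d} (\<lambda>_. e' * M)"
      proof (rule Henstock_Kurzweil_Integration.integral_norm_bound_integral)
        show "(\<lambda>r. f r - D (x t) (w r)) integrable_on {c..d}"
          by (intro Henstock_Kurzweil_Integration.integrable_diff fcd has_integral_integrable[OF Dw])
        fix r assume r: "r \<in> {c..d}"
        have "norm (f r - D (x t) (w r)) \<le> e' * norm (w r)"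
          using d1(2)[of "x r"] close[OF r] by (simp add: f_def)
        also have "\<dots> \<le> e' * M"
          using M(2)[of r] r cd ab e' by (intro mult_left_mono) auto
        finally show "norm (f r - D (x t) (w r)) \<le> e' * M" .
      qed auto
      also have "\<dots> = e' * M * (d - c)"
        using cd by simp
      finally have 2: "norm (integral {c..d} f - D (x t) (x d - x c)) \<le> e' * M * (d - c)" .
      have "norm (F d - F c) = norm ((\<tau> (x d) - \<tau> (x c) - D (x t) (x d - x c)) -
          (integral {c..d} f - D (x t) (x d - x c)))"
        by (simp add: F_diff[OF cd(1-3)])
      also have "\<dots> \<le> e' * norm (x d - x c) + e' * M * (d - c)"
        by (intro order_trans[OF norm_triangle_ineq4] add_mono 1 2)
      also have "\<dots> \<le> e' * (M * (d - c)) + e' * M * (d - c)"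
        using x_lip[OF cd(1-3)] e' by (intro add_right_mono mult_left_mono) auto
      also have "\<dots> = e * (d - c)"
        using M by (simp add: e'_def)
      finally show ?thesis .
    qed
    then show ?thesis
      using \<delta> by blast
  qed
  have "(F has_derivative (\<lambda>_. 0)) (at t within {a..b})" if t: "t \<in> {a..b}" for t
    unfolding has_derivative_within_alt
  proof (intro conjI allI impI)
    fix e :: real assume "e > 0"
    then obtain \<delta> where \<delta>: "\<delta> > 0" "\<And>c d. a \<le> c \<Longrightarrow> c \<le> d \<Longrightarrow> d \<le> b \<Longrightarrow> d - c < \<delta> \<Longrightarrow> t \<in> {c, d} \<Longrightarrow>
      norm (F d - F c) \<le> e * (d - c)"
      using local[OF t] by meson
    have "norm (F y - F t - 0) \<le> e * norm (y - t)" if "y \<in> {a..b}" "norm (y - t) < \<delta>" for y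
    proof (cases "y \<le> t")
      case True
      then show ?thesis
        using \<delta>(2)[of y t] that t by (simp add: norm_minus_commute)
    next
      case False
      then show ?thesis
        using \<delta>(2)[of t y] that t by simp
    qed
    then show "\<exists>d>0. \<forall>y\<in>{a..b}. norm (y - t) < d \<longrightarrow> norm (F y - F t - 0) \<le> e * norm (y - t)"
      using \<delta>(1) by blast
  qed simp
  then have const: "F t = F a" if "t \<in> {a..b}" for t
    using that by (intro has_derivative_zero_unique[of "{a..b}" F]) auto
  show "integral {a..t} (\<lambda>t. D (curve x0 w t) (w t)) = \<tau> (curve x0 w t) - \<tau> (curve x0 w a)"
    if "t \<in> {a..b}" for t
    using const[OF that] unfolding F_def f_def x_def by (simp add: algebra_simps)
qed

section \<open>Orthonormal frames in a chart\<close>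

text \<open>
  The coefficients are only required to agree on \<open>U\<close> with members of the algebra, since a form
  in a chart is linear, hence a combination of its coefficients, only at points of the chart.
\<close>

lemma linear_family_lipschitz:
  fixes A :: "'a::euclidean_space \<Rightarrow> 'a \<Rightarrow> real"
  assumes R: "R \<ge> 0" and sub: "cball x0 R \<subseteq> U" and lin: "\<And>x. x \<in> U \<Longrightarrow> linear (A x)"
    and A: "\<And>v. \<exists>f\<in>analytic_algebra U. \<forall>x\<in>U. A x v = f x"
  obtains C where "C \<ge> 0"
    and "\<And>x y v. x \<in> cball x0 R \<Longrightarrow> y \<in> cball x0 R \<Longrightarrow> \<bar>A x v - A y v\<bar> \<le> C * norm (x - y) * norm v"
    and "\<And>x v. x \<in> cball x0 R \<Longrightarrow> \<bar>A x v\<bar> \<le> C * norm v"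
proof -
  have "\<exists>c\<ge>0. \<forall>x\<in>cball x0 R. \<forall>y\<in>cball x0 R. \<bar>A x b - A y b\<bar> \<le> c * norm (x - y)" for b
  proof -
    obtain f where f: "f \<in> analytic_algebra U" "\<And>x. x \<in> U \<Longrightarrow> A x b = f x"
      using A[of b] by blast
    obtain c where "c \<ge> 0"
      "\<And>x y. x \<in> cball x0 R \<Longrightarrow> y \<in> cball x0 R \<Longrightarrow> \<bar>f x - f y\<bar> \<le> c * norm (x - y)"
      using analytic_algebra_lipschitz[OF f(1) sub] by blast
    then show ?thesis
      using f(2) sub by (intro exI[of _ c]) (auto simp: subset_iff)
  qed
  then obtain c where c: "\<And>b. c b \<ge> 0"
    "\<And>b x y. x \<in> cball x0 R \<Longrightarrow> y \<in> cball x0 R \<Longrightarrow> \<bar>A x b - A y b\<bar> \<le> c b * norm (x - y)"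
    by metis
  define C1 where "C1 = (\<Sum>b\<in>Basis. c b)"
  have C1: "C1 \<ge> 0"
    using c(1) by (simp add: C1_def sum_nonneg)
  have lip: "\<bar>A x v - A y v\<bar> \<le> C1 * norm (x - y) * norm v" if xy: "x \<in> cball x0 R" "y \<in> cball x0 R" for x y v
  proof -
    have l: "linear (\<lambda>v. A x v - A y v)"
      using xy sub by (intro linear_compose_sub lin) auto
    have "norm (A x v - A y v) \<le> (\<Sum>b\<in>Basis. c b * norm (x - y)) * norm v"
      by (rule linear_norm_le_basis_sum[OF l]) (use c(2)[OF xy] in simp)
    then show ?thesis
      by (simp add: C1_def sum_distrib_right)
  qed
  have x0: "x0 \<in> cball x0 R"
    using R by simp
  have "linear (A x0)"
    using x0 sub by (intro lin) blast
  then obtain B where B: "B > 0" "\<And>v. norm (A x0 v) \<le> B * norm v"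
    using linear_bounded_pos by blast
  define C where "C = C1 + C1 * R + B"
  show ?thesis
  proof (rule that[of C])
    show "C \<ge> 0"
      using C1 R B by (simp add: C_def)
    fix x v assume x: "x \<in> cball x0 R"
    show "\<bar>A x v - A y v\<bar> \<le> C * norm (x - y) * norm v" if "y \<in> cball x0 R" for y
    proof -
      have "C1 * norm (x - y) * norm v \<le> C * norm (x - y) * norm v"
        using C1 R B by (intro mult_right_mono) (auto simp: C_def)
      then show ?thesis
        using lip[OF x that, of v] by linarith
    qed
    have "C1 * norm (x - x0) * norm v \<le> C1 * R * norm v"
      using x C1 by (intro mult_right_mono mult_left_mono) (auto simp: dist_norm norm_minus_commute)
    then have "\<bar>A x v\<bar> \<le> C1 * R * norm v + B * norm v"
      using lip[OF x x0, of v] B(2)[of v] by simp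
    also have "\<dots> \<le> C * norm v"
      using C1 by (simp add: C_def algebra_simps)
    finally show "\<bar>A x v\<bar> \<le> C * norm v" .
  qed
qed

locale framed_swimmer = analytic_swimmer S
  for S :: "('i, 's::{t2_space, second_countable_topology}, 'e::euclidean_space, 'n::finite) swimmer" +
  fixes p :: nat and X :: "nat \<Rightarrow> ('i, 's, 'e) vfield"
  assumes unconstrained: "unconstrained S" and orthonormal: "orthonormal_basis S p X"
begin

definition frame :: "'i \<Rightarrow> nat \<Rightarrow> 'e \<Rightarrow> 'e" where
  "frame i k x = X k i (chart_inv A i x)"

definition coframe :: "'i \<Rightarrow> nat \<Rightarrow> 'e \<Rightarrow> 'e \<Rightarrow> real" where
  "coframe i k x v = metric S i (chart_inv A i x) v (frame i k x)"

lemma frame_field: "k < p \<Longrightarrow> analytic_vector_field A (X k)"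
  using orthonormal unfolding orthonormal_basis_def basis_family_def spanning_family_def by blast

lemma frame_components:
  assumes "k < p" "i \<in> charts A"
  shows "analytic_components (chart_image S i) (frame i k)"
proof (rule analytic_components_of_analytic)
  show "frame i k real_analytic_on chart_image S i"
    using frame_field[OF assms(1)] assms(2)
    unfolding analytic_vector_field_def frame_def[abs_def] chart_image_def by blast
qed

lemma frame_spans:
  assumes "i \<in> charts A" "x \<in> chart_image S i"
  shows "span ((\<lambda>k. frame i k x) ` {..<p}) = UNIV"
proof -
  define s where "s = chart_inv A i x"
  have s: "s \<in> chart_dom A i"
    using assms chart_inv_in by (simp add: s_def)
  have "distr S i s = UNIV"
    using unconstrained assms(1) s by (auto simp: unconstrained_def distr_def)
  moreover have "span ((\<lambda>k. X k i s) ` {..<p}) = distr S i s"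
    using orthonormal assms(1) s
    unfolding orthonormal_basis_def basis_family_def spanning_family_def by blast
  ultimately show ?thesis
    by (simp add: frame_def s_def)
qed

lemma bilinear_metric: "i \<in> charts A \<Longrightarrow> s \<in> chart_dom A i \<Longrightarrow> bilinear (metric S i s)"
  using metric unfolding analytic_riemannian_metric_def by blast

lemma linear_coframe:
  assumes "i \<in> charts A" "x \<in> chart_image S i"
  shows "linear (coframe i k x)"
  using bilinear_metric[OF assms(1) chart_inv_in[OF assms]]
  unfolding bilinear_def coframe_def[abs_def] by blast

lemma coframe_frame:
  assumes "i \<in> charts A" "x \<in> chart_image S i" "j < p" "k < p"
  shows "coframe i k x (frame i j x) = (if j = k then 1 else 0)"
  using orthonormal assms chart_inv_in[OF assms(1,2)]
  unfolding orthonormal_basis_def coframe_def frame_def by blast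

lemma coframe_sum:
  assumes i: "i \<in> charts A" "x \<in> chart_image S i" and k: "k < p"
  shows "coframe i k x (\<Sum>j<p. c j *\<^sub>R frame i j x) = c k"
proof -
  note l = linear_coframe[OF i, of k]
  have "coframe i k x (\<Sum>j<p. c j *\<^sub>R frame i j x) = (\<Sum>j<p. c j * coframe i k x (frame i j x))"
    by (simp add: linear_sum[OF l] linear_scale[OF l])
  also have "\<dots> = (\<Sum>j<p. if j = k then c j else 0)"
    by (intro sum.cong) (auto simp: coframe_frame[OF i _ k])
  also have "\<dots> = c k"
    using k by simp
  finally show ?thesis .
qed

text \<open>
  The vectors that satisfy the identity form a subspace; it contains the frame, which spans the
  tangent space because there is no constraint.
\<close>

lemma coframe_expansion:
  assumes i: "i \<in> charts A" "x \<in> chart_image S i"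
  shows "(\<Sum>k<p. coframe i k x v *\<^sub>R frame i k x) = v"
proof -
  define V where "V = {v. (\<Sum>k<p. coframe i k x v *\<^sub>R frame i k x) = v}"
  note l = linear_coframe[OF i]
  have "subspace V"
    unfolding subspace_def V_def
    by (auto simp: linear_add[OF l] linear_scale[OF l] linear_0[OF l] scaleR_add_left sum.distrib
        scaleR_scaleR[symmetric] scaleR_sum_right[symmetric] simp del: scaleR_scaleR)
  moreover have "(\<lambda>k. frame i k x) ` {..<p} \<subseteq> V"
  proof
    fix v assume "v \<in> (\<lambda>k. frame i k x) ` {..<p}"
    then obtain j where j: "j < p" "v = frame i j x"
      by blast
    have "(\<Sum>k<p. coframe i k x v *\<^sub>R frame i k x) = (\<Sum>k<p. if k = j then frame i k x else 0)"
      unfolding j(2) by (intro sum.cong) (auto simp: coframe_frame[OF i j(1)])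
    then show "v \<in> V"
      using j by (simp add: V_def)
  qed
  ultimately have "span ((\<lambda>k. frame i k x) ` {..<p}) \<subseteq> V"
    by (intro span_minimal)
  then show ?thesis
    unfolding frame_spans[OF i] V_def by blast
qed

lemma coframe_algebra:
  assumes i: "i \<in> charts A" and k: "k < p"
  shows "\<exists>f\<in>analytic_algebra (chart_image S i). \<forall>x\<in>chart_image S i. coframe i k x v = f x"
proof (intro bexI ballI)
  have g: "(\<lambda>x. metric S i (chart_inv A i x) v b) \<in> analytic_algebra (chart_image S i)" for b
    using metric i unfolding analytic_riemannian_metric_def chart_image_def
    by (intro analytic_algebra.analytic) blast
  show "(\<lambda>x. \<Sum>b\<in>Basis. (frame i k x \<bullet> b) * metric S i (chart_inv A i x) v b)
      \<in> analytic_algebra (chart_image S i)"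
    using frame_components[OF k i]
    by (intro analytic_algebra_sum analytic_algebra.mult g) (auto simp: analytic_components_def)
  fix x assume x: "x \<in> chart_image S i"
  have l: "linear (metric S i (chart_inv A i x) v)"
    using bilinear_metric[OF i chart_inv_in[OF i x]] unfolding bilinear_def by blast
  show "coframe i k x v = (\<Sum>b\<in>Basis. (frame i k x \<bullet> b) * metric S i (chart_inv A i x) v b)"
    using linear_basis_expansion[OF l, of "frame i k x"] by (simp add: coframe_def)
qed

lemma local_frame_exists:
  assumes i: "i \<in> charts A" and R: "R > 0" "cball x0 R \<subseteq> chart_image S i"
  obtains C where "local_frame x0 R C p (coframe i) (\<lambda>x v. covector S i x \<bullet> v)"
proof -
  define B where "B = cball x0 R"
  have "\<exists>c\<ge>0. \<forall>x\<in>B. norm (frame i k x) \<le> c \<and> (\<forall>v. \<bar>coframe i k x v\<bar> \<le> c * norm v \<and>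
      (\<forall>y\<in>B. \<bar>coframe i k x v - coframe i k y v\<bar> \<le> c * norm (x - y) * norm v))"
    if k: "k \<in> {..<p}" for k
  proof -
    have k: "k < p"
      using k by simp
    obtain c where c: "c \<ge> 0"
      "\<And>x y v. x \<in> cball x0 R \<Longrightarrow> y \<in> cball x0 R \<Longrightarrow>
        \<bar>coframe i k x v - coframe i k y v\<bar> \<le> c * norm (x - y) * norm v"
      "\<And>x v. x \<in> cball x0 R \<Longrightarrow> \<bar>coframe i k x v\<bar> \<le> c * norm v"
      using linear_family_lipschitz[OF less_imp_le[OF R(1)] R(2) linear_coframe[OF i, of _ k]
          coframe_algebra[OF i k]] by blast
    have "continuous_on (cball x0 R) (frame i k)"
      by (rule continuous_on_subset[OF analytic_components_continuous_on[OF frame_components[OF k i]] R(2)])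
    then have "bounded (frame i k ` cball x0 R)"
      by (intro compact_imp_bounded compact_continuous_image compact_cball)
    then obtain b where b: "\<And>x. x \<in> cball x0 R \<Longrightarrow> norm (frame i k x) \<le> b"
      unfolding bounded_iff by blast
    have le: "c * norm (x - y) * norm v \<le> (c + \<bar>b\<bar>) * norm (x - y) * norm v"
      "c * norm v \<le> (c + \<bar>b\<bar>) * norm v" for x y v
      by (intro mult_right_mono; simp)+
    show ?thesis
      unfolding B_def
    proof (intro exI[of _ "c + \<bar>b\<bar>"] conjI ballI allI)
      fix x v assume x: "x \<in> cball x0 R"
      show "norm (frame i k x) \<le> c + \<bar>b\<bar>"
        using b[OF x] c(1) by simp
      show "\<bar>coframe i k x v\<bar> \<le> (c + \<bar>b\<bar>) * norm v"
        by (rule order_trans[OF c(3)[OF x] le(2)])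
      show "\<bar>coframe i k x v - coframe i k y v\<bar> \<le> (c + \<bar>b\<bar>) * norm (x - y) * norm v"
        if "y \<in> cball x0 R" for y
        by (rule order_trans[OF c(2)[OF x that] le(1)])
    qed (use c(1) in simp)
  qed
  from bchoice[OF ballI[OF this]] obtain c where
    "\<forall>k\<in>{..<p}. c k \<ge> 0 \<and> (\<forall>x\<in>B. norm (frame i k x) \<le> c k \<and> (\<forall>v. \<bar>coframe i k x v\<bar> \<le> c k * norm v \<and>
      (\<forall>y\<in>B. \<bar>coframe i k x v - coframe i k y v\<bar> \<le> c k * norm (x - y) * norm v)))" ..
  note c = this[unfolded B_def]
  obtain C0 where C0: "C0 \<ge> 0"
    "\<And>x y v. x \<in> cball x0 R \<Longrightarrow> y \<in> cball x0 R \<Longrightarrow>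
        \<bar>covector S i x \<bullet> v - covector S i y \<bullet> v\<bar> \<le> C0 * norm (x - y) * norm v"
    "\<And>x v. x \<in> cball x0 R \<Longrightarrow> \<bar>covector S i x \<bullet> v\<bar> \<le> C0 * norm v"
  proof (rule linear_family_lipschitz[OF less_imp_le[OF R(1)] R(2), of "\<lambda>x v. covector S i x \<bullet> v"])
    show "linear ((\<bullet>) (covector S i x))" for x
      by (rule bounded_linear.linear[OF bounded_linear_inner_right])
    show "\<exists>f\<in>analytic_algebra (chart_image S i). \<forall>x\<in>chart_image S i. covector S i x \<bullet> v = f x" for v
      by (intro bexI[of _ "\<lambda>x. covector S i x \<bullet> v"] analytic_components_inner covector_components i
          analytic_components_const) auto
  qed blast
  define C where "C = (\<Sum>k<p. c k) + C0 + 1"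
  have cn: "c k \<ge> 0" if "k < p" for k
    using c that by blast
  have sum_c: "(\<Sum>k<p. c k) \<ge> 0"
    using cn by (auto intro: sum_nonneg)
  have Cpos: "C > 0"
    using sum_c C0(1) by (simp add: C_def)
  have cC: "c k \<le> C" if "k < p" for k
  proof -
    have "c k \<le> (\<Sum>k<p. c k)"
      using that cn by (intro member_le_sum) auto
    then show ?thesis
      using C0(1) by (simp add: C_def)
  qed
  have C0C: "C0 \<le> C" "(\<Sum>k<p. c k) \<le> C"
    using sum_c C0(1) by (simp_all add: C_def)
  have "local_frame x0 R C p (coframe i) (\<lambda>x v. covector S i x \<bullet> v)"
  proof (rule local_frame.intro)
    show "R > 0" "C > 0"
      by fact+
    show "linear (coframe i k x)" if "x \<in> cball x0 R" for k x
      using that R(2) by (intro linear_coframe i) blast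
    show "linear ((\<bullet>) (covector S i x))" for x
      by (rule bounded_linear.linear[OF bounded_linear_inner_right])
    show "\<bar>coframe i k x v - coframe i k y v\<bar> \<le> C * norm (x - y) * norm v"
      if "k < p" "x \<in> cball x0 R" "y \<in> cball x0 R" for k x y v
    proof -
      have "\<bar>coframe i k x v - coframe i k y v\<bar> \<le> c k * norm (x - y) * norm v"
        using c that by blast
      also have "\<dots> \<le> C * norm (x - y) * norm v"
        using cC[OF that(1)] by (intro mult_right_mono) auto
      finally show ?thesis .
    qed
    show "\<bar>covector S i x \<bullet> v - covector S i y \<bullet> v\<bar> \<le> C * norm (x - y) * norm v"
      if "x \<in> cball x0 R" "y \<in> cball x0 R" for x y v
    proof -
      have "C0 * norm (x - y) * norm v \<le> C * norm (x - y) * norm v"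
        using C0C by (intro mult_right_mono) auto
      then show ?thesis
        using C0(2)[OF that, of v] by linarith
    qed
    fix x v assume x: "x \<in> cball x0 R"
    then have xi: "x \<in> chart_image S i"
      using R(2) by blast
    show "\<bar>covector S i x \<bullet> v\<bar> \<le> C * norm v"
      using C0(3)[OF x, of v] mult_right_mono[OF C0C(1) norm_ge_zero[of v]] by linarith
    have "norm v = norm (\<Sum>k<p. coframe i k x v *\<^sub>R frame i k x)"
      by (simp add: coframe_expansion[OF i xi])
    also have "\<dots> \<le> (\<Sum>k<p. L2_set (\<lambda>k. coframe i k x v) {..<p} * c k)"
    proof (rule order_trans[OF norm_sum], rule sum_mono)
      fix k assume k: "k \<in> {..<p}"
      have "\<bar>coframe i k x v\<bar> \<le> L2_set (\<lambda>k. \<bar>coframe i k x v\<bar>) {..<p}"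
        using k by (intro member_le_L2_set) auto
      then have "\<bar>coframe i k x v\<bar> \<le> L2_set (\<lambda>k. coframe i k x v) {..<p}"
        by (simp add: L2_set_def)
      then show "norm (coframe i k x v *\<^sub>R frame i k x) \<le> L2_set (\<lambda>k. coframe i k x v) {..<p} * c k"
        unfolding norm_scaleR using c x k by (intro mult_mono) auto
    qed
    also have "\<dots> = (\<Sum>k<p. c k) * L2_set (\<lambda>k. coframe i k x v) {..<p}"
      by (simp add: sum_distrib_right mult.commute)
    also have "\<dots> \<le> C * L2_set (\<lambda>k. coframe i k x v) {..<p}"
      using C0C by (intro mult_right_mono) auto
    finally show "norm v \<le> C * L2_set (\<lambda>k. coframe i k x v) {..<p}" .
    have "L2_set (\<lambda>k. coframe i k x v) {..<p} \<le> (\<Sum>k<p. \<bar>coframe i k x v\<bar>)"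
      by (rule L2_set_le_sum_abs)
    also have "\<dots> \<le> (\<Sum>k<p. c k * norm v)"
      using c x by (intro sum_mono) auto
    also have "\<dots> = (\<Sum>k<p. c k) * norm v"
      by (simp add: sum_distrib_right)
    also have "\<dots> \<le> C * norm v"
      using C0C by (intro mult_right_mono) auto
    finally show "L2_set (\<lambda>k. coframe i k x v) {..<p} \<le> C * norm v" .
  qed
  then show ?thesis
    by (rule that)
qed

end

section \<open>Loops give admissible controls\<close>

lemma absolutely_integrable_Pair:
  fixes f :: "real \<Rightarrow> 'a::euclidean_space" and g :: "real \<Rightarrow> 'b::euclidean_space"
  assumes f: "f absolutely_integrable_on I" and g: "g absolutely_integrable_on I"
  shows "(\<lambda>t. (f t, g t)) absolutely_integrable_on I"
    and "integral I (\<lambda>t. (f t, g t)) = (integral I f, integral I g)"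
proof -
  have lin: "bounded_linear (\<lambda>x::'a. (x, 0::'b))" "bounded_linear (\<lambda>y::'b. (0::'a, y))"
    by (intro bounded_linear_Pair bounded_linear_ident bounded_linear_zero)+
  have eq: "(\<lambda>t. (f t, g t)) = (\<lambda>t. ((\<lambda>x::'a. (x, 0::'b)) \<circ> f) t + ((\<lambda>y::'b. (0::'a, y)) \<circ> g) t)"
    by auto
  show "(\<lambda>t. (f t, g t)) absolutely_integrable_on I"
    unfolding eq
    by (intro set_integral_add(1) absolutely_integrable_linear[OF f lin(1)] absolutely_integrable_linear[OF g lin(2)])
  have "f integrable_on I" "g integrable_on I"
    using f g by (simp_all add: absolutely_integrable_on_def)
  then have "((\<lambda>x::'a. (x, 0::'b)) \<circ> f has_integral (integral I f, 0)) I"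
    "((\<lambda>y::'b. (0::'a, y)) \<circ> g has_integral (0, integral I g)) I"
    using has_integral_linear[OF _ lin(1)] has_integral_linear[OF _ lin(2)] by blast+
  from has_integral_add[OF this] show "integral I (\<lambda>t. (f t, g t)) = (integral I f, integral I g)"
    unfolding eq by (simp add: integral_unique)
qed

lemma bounded_measurable_lebesgue_integral:
  fixes f :: "real \<Rightarrow> real"
  assumes "bounded_measurable T f"
  shows "(LINT t|lebesgue_on {0..T}. f t) = integral {0..T} f"
proof (rule lebesgue_integral_eq_integral)
  have "f absolutely_integrable_on {0..T}"
    by (rule bounded_measurable_absolutely_integrable[OF assms]) auto
  then show "integrable (lebesgue_on {0..T}) f"
    by (simp add: integrable_restrict_space set_integrable_def)
qed auto

locale framed_chart = framed_swimmer S p X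
  for S :: "('i, 's::{t2_space, second_countable_topology}, 'e::euclidean_space, 'n::finite) swimmer"
    and p X +
  fixes i0 :: 'i and R C :: real
  assumes i0: "i0 \<in> charts A" and init_dom: "init S \<in> chart_dom A i0"
    and cball_image: "cball (chart_map A i0 (init S)) R \<subseteq> chart_image S i0"
    and frame_constants:
      "local_frame (chart_map A i0 (init S)) R C p (coframe i0) (\<lambda>x v. covector S i0 x \<bullet> v)"

sublocale framed_chart \<subseteq> local_frame "chart_map A i0 (init S)" R C p "coframe i0" "\<lambda>x v. covector S i0 x \<bullet> v"
  by (rule frame_constants)

context framed_chart
begin

abbreviation "origin \<equiv> chart_map A i0 (init S)"

lemma loop_in_chart: "loop T \<rho> w \<Longrightarrow> \<rho> \<le> R \<Longrightarrow> t \<in> {0..T} \<Longrightarrow> curve origin w t \<in> chart_image S i0"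
  using loop_in_cball cball_image by blast

text \<open>
  The control whose components are the coordinates of the velocity in the frame drives the loop in
  every chart \<open>j\<close>.  The three parts are the ingredients of the integral equation in \<open>M = S \<times> \<real>\<close>; they come
  from the chain rule for the transition map from \<open>i0\<close> to \<open>j\<close>.
\<close>

lemma loop_lift_in_chart:
  assumes l: "loop T \<rho> w" and \<rho>: "\<rho> \<le> R" and j: "j \<in> charts A"
    and ab: "0 \<le> a" "b \<le> T" and dom: "\<And>t. t \<in> {a..b} \<Longrightarrow> chart_inv A i0 (curve origin w t) \<in> chart_dom A j"
  defines "f \<equiv> \<lambda>t. \<Sum>k<p. coframe i0 k (curve origin w t) (w t) *\<^sub>R X k j (chart_inv A i0 (curve origin w t))"
  shows "f absolutely_integrable_on {a..b}"
    and "t \<in> {a..b} \<Longrightarrow> integral {a..t} f = chart_map A j (chart_inv A i0 (curve origin w t)) -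
       chart_map A j (chart_inv A i0 (curve origin w a))"
    and "t \<in> {a..b} \<Longrightarrow> (\<Sum>k<p. coframe i0 k (curve origin w t) (w t) *
         displ S j (chart_inv A i0 (curve origin w t)) (X k j (chart_inv A i0 (curve origin w t))))
       = covector S i0 (curve origin w t) \<bullet> w t"
proof -
  define x where "x = curve origin w"
  define W where "W = chart_map A i0 ` (chart_dom A i0 \<inter> chart_dom A j)"
  define \<tau> where "\<tau> = transition A i0 j"
  obtain D where D: "\<And>y. y \<in> W \<Longrightarrow> (\<tau> has_derivative D y) (at y)"
      "\<And>v. analytic_components W (\<lambda>y. D y v)"
    using analytic_components_derivative[OF transition_components[OF i0 j]] unfolding W_def \<tau>_def by blast
  have W: "open W"
    unfolding W_def by (rule open_chart_overlap[OF i0 j])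
  have xi: "x t \<in> chart_image S i0" if "t \<in> {a..b}" for t
    unfolding x_def by (rule loop_in_chart[OF l \<rho>]) (use that ab in auto)
  have s: "chart_inv A i0 (x t) \<in> chart_dom A i0 \<inter> chart_dom A j"
    "chart_map A i0 (chart_inv A i0 (x t)) = x t" if "t \<in> {a..b}" for t
    using xi[OF that] dom[OF that] i0 by (auto simp: x_def chart_inv_in)
  have xW: "x t \<in> W" if "t \<in> {a..b}" for t
    unfolding W_def using s[OF that] by (metis image_eqI)
  have coords: "change_coords A i0 j (chart_inv A i0 (x t)) = D (x t)" if "t \<in> {a..b}" for t
    unfolding change_coords_def s(2)[OF that] using frechet_derivative_at[OF D(1)[OF xW[OF that]]]
    by (simp add: \<tau>_def)
  have X_eq: "X k j (chart_inv A i0 (x t)) = D (x t) (frame i0 k (x t))" if "k < p" "t \<in> {a..b}" for k t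
    using frame_field[OF that(1)] i0 j s(1)[OF that(2)] coords[OF that(2)]
    unfolding analytic_vector_field_def frame_def by metis
  have f_eq: "D (x t) (w t) = f t" if t: "t \<in> {a..b}" for t
  proof -
    have l: "linear (D (x t))"
      by (rule has_derivative_linear[OF D(1)[OF xW[OF t]]])
    have "f t = (\<Sum>k<p. coframe i0 k (x t) (w t) *\<^sub>R D (x t) (frame i0 k (x t)))"
      unfolding f_def x_def[symmetric] using X_eq t by simp
    also have "\<dots> = D (x t) (\<Sum>k<p. coframe i0 k (x t) (w t) *\<^sub>R frame i0 k (x t))"
      by (simp add: linear_sum[OF l] linear_scale[OF l])
    also have "\<dots> = D (x t) (w t)"
      by (simp add: coframe_expansion[OF i0 xi[OF t]])
    finally show ?thesis ..
  qed
  have bm: "bounded_measurable T w"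
    using l by (simp add: loop_def)
  have img: "curve origin w ` {a..b} \<subseteq> W"
    using xW by (auto simp: x_def)
  have chain1: "(\<lambda>t. D (x t) (w t)) absolutely_integrable_on {a..b}"
    unfolding x_def
    by (rule curve_chain_rule(1)[OF bm ab img W]) (rule D(1) analytic_components_continuous_on[OF D(2)], assumption?)+
  have chain2: "integral {a..t} (\<lambda>t. D (x t) (w t)) = \<tau> (x t) - \<tau> (x a)" if "t \<in> {a..b}" for t
    unfolding x_def
    by (rule curve_chain_rule(2)[OF bm ab img W _ _ that]) (rule D(1) analytic_components_continuous_on[OF D(2)], assumption?)+
  show "f absolutely_integrable_on {a..b}"
    by (rule absolutely_integrable_spike[OF chain1 negligible_empty]) (rule f_eq[symmetric], simp)
  show "integral {a..t} f = chart_map A j (chart_inv A i0 (curve origin w t)) -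
       chart_map A j (chart_inv A i0 (curve origin w a))" if t: "t \<in> {a..b}" for t
  proof -
    have "integral {a..t} f = integral {a..t} (\<lambda>t. D (x t) (w t))"
      by (rule Henstock_Kurzweil_Integration.integral_cong) (use f_eq t in auto)
    then show ?thesis
      unfolding chain2[OF t] by (simp add: \<tau>_def transition_def x_def)
  qed
  show "(\<Sum>k<p. coframe i0 k (curve origin w t) (w t) *
         displ S j (chart_inv A i0 (curve origin w t)) (X k j (chart_inv A i0 (curve origin w t))))
       = covector S i0 (curve origin w t) \<bullet> w t" if t: "t \<in> {a..b}" for t
  proof -
    have "displ S j (chart_inv A i0 (x t)) (X k j (chart_inv A i0 (x t))) =
        covector S i0 (x t) \<bullet> frame i0 k (x t)" if k: "k < p" for k
    proof -
      have "displ S j (chart_inv A i0 (x t)) (X k j (chart_inv A i0 (x t))) =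
          displ S i0 (chart_inv A i0 (x t)) (frame i0 k (x t))"
        unfolding X_eq[OF k t] using displ_form i0 j s(1)[OF t] coords[OF t]
        unfolding analytic_one_form_def by metis
      also have "\<dots> = covector S i0 (x t) \<bullet> frame i0 k (x t)"
        by (rule displ_eq_covector[OF i0 xi[OF t]])
      finally show ?thesis .
    qed
    then have "(\<Sum>k<p. coframe i0 k (x t) (w t) * displ S j (chart_inv A i0 (x t)) (X k j (chart_inv A i0 (x t))))
        = covector S i0 (x t) \<bullet> (\<Sum>k<p. coframe i0 k (x t) (w t) *\<^sub>R frame i0 k (x t))"
      by (simp add: inner_sum_right)
    then show ?thesis
      by (simp add: coframe_expansion[OF i0 xi[OF t]] x_def[symmetric])
  qed
qed

lemma loop_admissible:
  assumes T: "T > 0" and \<rho>: "\<rho> \<le> R" and l: "loop T \<rho> w" and K: "chart_inv A i0 ` cball origin \<rho> \<subseteq> K"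
  obtains u where "u \<in> admissible_controls S p X T K (holonomy T w)"
    "(LINT t|lebesgue_on {0..T}. L2_set (u t) {..<p}) = cost T w"
proof -
  define x where "x = curve origin w"
  define s where "s t = chart_inv A i0 (x t)" for t
  define u where "u t k = coframe i0 k (x t) (w t)" for t k
  define h where "h t = covector S i0 (x t) \<bullet> w t" for t
  define r where "r t = integral {0..t} h" for t
  define \<xi> where "\<xi> t = (s t, r t)" for t
  have bm: "bounded_measurable T w"
    using l by (simp add: loop_def)
  note along = bounded_measurable_along[OF bm loop_in_cball[OF l \<rho>]]
  have h: "bounded_measurable T h"
    unfolding h_def x_def by (rule along(2))
  have xi: "x t \<in> chart_image S i0" if "t \<in> {0..T}" for t
    unfolding x_def by (rule loop_in_chart[OF l \<rho> that])
  have LINT: "(LINT t|lebesgue_on {0..T}. L2_set (u t) {..<p}) = cost T w"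
    using bounded_measurable_lebesgue_integral[OF along(3)]
    by (simp add: cost_def speed_def u_def[abs_def] x_def)
  have Linf: "Linf_control p T u"
    unfolding Linf_control_def
  proof (intro allI impI conjI)
    fix k assume k: "k < p"
    have "bounded_measurable T (\<lambda>t. u t k)"
      unfolding u_def x_def by (rule bounded_measurable_\<theta>[OF bm loop_in_cball[OF l \<rho>] k])
    then obtain B where "(\<lambda>t. u t k) \<in> borel_measurable (lebesgue_on {0..T})"
      and B: "\<forall>t\<in>{0..T}. \<bar>u t k\<bar> \<le> B"
      unfolding bounded_measurable_def real_norm_def by blast
    then show "(\<lambda>t. u t k) \<in> borel_measurable (lebesgue_on {0..T})"
      by blast
    show "\<exists>B. AE t in lebesgue_on {0..T}. \<bar>u t k\<bar> \<le> B"
      by (rule exI[of _ B], rule AE_I2) (use B in simp)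
  qed
  have x0: "x 0 = origin" "x T = origin"
    using l by (simp_all add: x_def loop_def)
  have cont: "continuous_on {0..T} \<xi>"
    unfolding \<xi>_def[abs_def]
  proof (rule continuous_on_Pair)
    show "continuous_on {0..T} s"
      unfolding s_def[abs_def]
      by (rule continuous_on_compose2[OF chart_inv_continuous[OF i0]])
         (use curve_continuous_on[OF bm] xi in \<open>auto simp: x_def\<close>)
    show "continuous_on {0..T} r"
      unfolding r_def[abs_def]
      by (rule indefinite_integral_continuous_1) (rule bounded_measurable_integrable[OF h], auto)
  qed
  have chart_eq: "(\<lambda>t. \<Sum>k<p. u t k *\<^sub>R lift_field S (X k) j (\<xi> t)) absolutely_integrable_on {a..b} \<and>
      (\<forall>t\<in>{a..b}. chart_map (times_real A) j (\<xi> t) = chart_map (times_real A) j (\<xi> a) +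
         integral {a..t} (\<lambda>t. \<Sum>k<p. u t k *\<^sub>R lift_field S (X k) j (\<xi> t)))"
    if j: "j \<in> charts A" and ab: "0 \<le> a" "a \<le> b" "b \<le> T"
      and dom: "\<xi> ` {a..b} \<subseteq> chart_dom (times_real A) j" for j a b
  proof -
    have sj: "chart_inv A i0 (curve origin w t) \<in> chart_dom A j" if "t \<in> {a..b}" for t
      using subsetD[OF dom imageI[OF that]] by (simp add: \<xi>_def times_real_def s_def x_def)
    define f where "f = (\<lambda>t. \<Sum>k<p. u t k *\<^sub>R X k j (s t))"
    have chart1: "f absolutely_integrable_on {a..b}"
      unfolding f_def u_def s_def x_def by (rule loop_lift_in_chart(1)[OF l \<rho> j ab(1,3)]) (rule sj)
    have chart2: "integral {a..t} f = chart_map A j (s t) - chart_map A j (s a)" if "t \<in> {a..b}" for t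
      unfolding f_def u_def s_def x_def
      by (rule loop_lift_in_chart(2)[OF l \<rho> j ab(1,3) _ that]) (rule sj)
    have chart3: "(\<Sum>k<p. u t k * displ S j (s t) (X k j (s t))) = h t" if "t \<in> {a..b}" for t
      unfolding u_def s_def x_def h_def
      by (rule loop_lift_in_chart(3)[OF l \<rho> j ab(1,3) _ that]) (rule sj)
    have eq: "(\<Sum>k<p. u t k *\<^sub>R lift_field S (X k) j (\<xi> t)) = (f t, h t)" if "t \<in> {a..b}" for t
      using chart3[OF that]
      by (intro prod_eqI) (simp_all add: f_def lift_field_def \<xi>_def fst_sum snd_sum)
    have hab: "h absolutely_integrable_on {a..b}"
      by (rule bounded_measurable_absolutely_integrable[OF h ab(1,3)])
    have "(\<lambda>t. \<Sum>k<p. u t k *\<^sub>R lift_field S (X k) j (\<xi> t)) absolutely_integrable_on {a..b}"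
      by (rule absolutely_integrable_spike[OF absolutely_integrable_Pair(1)[OF chart1 hab] negligible_empty])
         (simp add: eq)
    moreover have "chart_map (times_real A) j (\<xi> t) = chart_map (times_real A) j (\<xi> a) +
         integral {a..t} (\<lambda>t. \<Sum>k<p. u t k *\<^sub>R lift_field S (X k) j (\<xi> t))" if t: "t \<in> {a..b}" for t
    proof -
      have sub: "{a..t} \<subseteq> {a..b}"
        using t by auto
      have "integral {a..t} (\<lambda>t. \<Sum>k<p. u t k *\<^sub>R lift_field S (X k) j (\<xi> t)) = integral {a..t} (\<lambda>t. (f t, h t))"
        by (rule Henstock_Kurzweil_Integration.integral_cong) (use eq sub in blast)
      also have "\<dots> = (integral {a..t} f, integral {a..t} h)"
        by (intro absolutely_integrable_Pair(2) absolutely_integrable_on_subinterval[OF _ sub] chart1 hab)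
      also have "integral {a..t} f = chart_map A j (s t) - chart_map A j (s a)"
        by (rule chart2[OF t])
      also have "integral {a..t} h = r t - r a"
        using Henstock_Kurzweil_Integration.integral_combine[OF ab(1), of t h]
          bounded_measurable_integrable[OF h, of 0 t] t ab by (simp add: r_def algebra_simps)
      finally show ?thesis
        by (simp add: times_real_def \<xi>_def)
    qed
    ultimately show ?thesis
      by blast
  qed
  have charts_eq: "charts (times_real A) = charts A"
    by (simp add: times_real_def)
  have "caratheodory_solution (times_real A) p (\<lambda>j. lift_field S (X j)) T u (init S, 0) \<xi>"
    unfolding caratheodory_solution_def charts_eq
    using cont chart_eq x0(1) i0 init_dom by (auto simp: \<xi>_def s_def r_def)
  moreover have "fst (\<xi> t) \<in> K" if "t \<in> {0..T}" for t
    using l K that by (auto simp: \<xi>_def s_def x_def loop_def)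
  moreover have "\<xi> T = (init S, holonomy T w)"
    using x0(2) i0 init_dom by (simp add: \<xi>_def s_def r_def holonomy_def h_def[abs_def] x_def)
  ultimately have "u \<in> admissible_controls S p X T K (holonomy T w)"
    unfolding admissible_controls_def using Linf by blast
  then show ?thesis
    using that LINT by blast
qed

end

section \<open>Cheap admissible controls give loops\<close>

text \<open>
  Clamping the components of \<open>u\<close> between their essential bounds changes them on a null set only, and
  makes them bounded at every time.
\<close>

lemma Linf_control_bounded_version:
  assumes u: "Linf_control p T u"
  obtains u' N where "\<And>k. k < p \<Longrightarrow> bounded_measurable T (\<lambda>t. u' t k)"
    and "negligible N" and "\<And>t k. t \<in> {0..T} - N \<Longrightarrow> k < p \<Longrightarrow> u' t k = u t k"
    and "(LINT t|lebesgue_on {0..T}. L2_set (u t) {..<p}) = integral {0..T} (\<lambda>t. L2_set (u' t) {..<p})"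
proof -
  have meas: "(\<lambda>t. u t k) \<in> borel_measurable (lebesgue_on {0..T})" if "k < p" for k
    using u that unfolding Linf_control_def by blast
  have "\<forall>k\<in>{..<p}. \<exists>BN. (\<forall>t\<in>{0..T} - snd BN. \<bar>u t k\<bar> \<le> fst BN) \<and> snd BN \<in> null_sets (lebesgue_on {0..T})"
  proof
    fix k assume "k \<in> {..<p}"
    then obtain B where "AE t in lebesgue_on {0..T}. \<bar>u t k\<bar> \<le> B"
      using u unfolding Linf_control_def by blast
    then obtain N where "\<And>t. t \<in> space (lebesgue_on {0..T}) - N \<Longrightarrow> \<bar>u t k\<bar> \<le> B" "N \<in> null_sets (lebesgue_on {0..T})"
      by (rule AE_E3) blast
    then show "\<exists>BN. (\<forall>t\<in>{0..T} - snd BN. \<bar>u t k\<bar> \<le> fst BN) \<and> snd BN \<in> null_sets (lebesgue_on {0..T})"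
      by (intro exI[of _ "(B, N)"]) simp
  qed
  from bchoice[OF this] obtain BN where BN: "\<forall>k\<in>{..<p}. (\<forall>t\<in>{0..T} - snd (BN k). \<bar>u t k\<bar> \<le> fst (BN k)) \<and>
     snd (BN k) \<in> null_sets (lebesgue_on {0..T})" ..
  define N where "N = (\<Union>k\<in>{..<p}. snd (BN k))"
  define B where "B k = \<bar>fst (BN k)\<bar>" for k
  define u' where "u' t k = max (- B k) (min (B k) (u t k))" for t k
  have N_null: "N \<in> null_sets (lebesgue_on {0..T})"
    unfolding N_def using BN by (intro null_sets_UN') auto
  then have "N \<in> null_sets lebesgue"
    by (simp add: null_sets_restrict_space)
  then have N: "negligible N"
    by (simp add: negligible_iff_null_sets)
  have bm: "bounded_measurable T (\<lambda>t. u' t k)" if "k < p" for k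
  proof -
    have "(\<lambda>t. u' t k) \<in> borel_measurable (lebesgue_on {0..T})"
      unfolding u'_def by (intro borel_measurable_max borel_measurable_min borel_measurable_const meas that)
    moreover have "norm (u' t k) \<le> B k" for t
      by (auto simp: u'_def B_def)
    ultimately show ?thesis
      unfolding bounded_measurable_def by blast
  qed
  have eq: "u' t k = u t k" if "t \<in> {0..T} - N" "k < p" for t k
  proof -
    have "\<bar>u t k\<bar> \<le> B k"
      using BN that by (force simp: N_def B_def)
    then show ?thesis
      by (auto simp: u'_def abs_le_iff)
  qed
  have "(LINT t|lebesgue_on {0..T}. L2_set (u t) {..<p}) = (LINT t|lebesgue_on {0..T}. L2_set (u' t) {..<p})"
  proof (rule integral_cong_AE)
    show "(\<lambda>t. L2_set (u t) {..<p}) \<in> borel_measurable (lebesgue_on {0..T})"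
      by (rule borel_measurable_L2_set[where f="\<lambda>k t. u t k"]) (rule meas)
    show "(\<lambda>t. L2_set (u' t) {..<p}) \<in> borel_measurable (lebesgue_on {0..T})"
      by (rule borel_measurable_L2_set[where f="\<lambda>k t. u' t k"]) (use bm in \<open>simp add: bounded_measurable_def\<close>)
    show "AE t in lebesgue_on {0..T}. L2_set (u t) {..<p} = L2_set (u' t) {..<p}"
    proof (rule AE_I'[OF N_null], safe)
      fix t assume t: "t \<in> space (lebesgue_on {0..T})" "L2_set (u t) {..<p} \<noteq> L2_set (u' t) {..<p}"
      show "t \<in> N"
      proof (rule ccontr)
        assume "t \<notin> N"
        then have "L2_set (u t) {..<p} = L2_set (u' t) {..<p}"
          using t(1) eq[of t] by (intro L2_set_cong) auto
        then show False
          using t(2) by blast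
      qed
    qed
  qed
  also have "\<dots> = integral {0..T} (\<lambda>t. L2_set (u' t) {..<p})"
    by (rule bounded_measurable_lebesgue_integral, rule bounded_measurable_L2_set[where f="\<lambda>k t. u' t k"]) (rule bm)
  finally show ?thesis
    using that[of u' N] bm N eq by blast
qed

context framed_chart
begin

lemma norm_frame_sum_le:
  assumes "x \<in> cball origin R"
  shows "norm (\<Sum>k<p. c k *\<^sub>R frame i0 k x) \<le> C * L2_set c {..<p}"
proof -
  have "L2_set (\<lambda>k. coframe i0 k x (\<Sum>k<p. c k *\<^sub>R frame i0 k x)) {..<p} = L2_set c {..<p}"
    using assms cball_image by (intro L2_set_cong) (auto simp: coframe_sum[OF i0])
  then show ?thesis
    using norm_le_speed[OF assms, of "\<Sum>k<p. c k *\<^sub>R frame i0 k x"] by simp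
qed

lemma solution_in_chart:
  assumes sol: "caratheodory_solution (times_real A) p (\<lambda>j. lift_field S (X j)) T u (init S, 0) \<xi>"
    and t1: "t1 \<in> {0..T}" and dom: "\<And>t. t \<in> {0..t1} \<Longrightarrow> fst (\<xi> t) \<in> chart_dom A i0" and t: "t \<in> {0..t1}"
  shows "chart_map A i0 (fst (\<xi> t)) = origin + integral {0..t} (\<lambda>t. \<Sum>k<p. u t k *\<^sub>R X k i0 (fst (\<xi> t)))"
    and "snd (\<xi> t) = integral {0..t} (\<lambda>t. \<Sum>k<p. u t k * displ S i0 (fst (\<xi> t)) (X k i0 (fst (\<xi> t))))"
proof -
  define g where "g = (\<lambda>t. \<Sum>k<p. u t k *\<^sub>R lift_field S (X k) i0 (\<xi> t))"
  have sub: "\<xi> ` {0..t1} \<subseteq> chart_dom (times_real A) i0"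
    by (rule image_subsetI) (use dom in \<open>simp add: times_real_def mem_Times_iff\<close>)
  have "g absolutely_integrable_on {0..t1} \<and>
      (\<forall>t\<in>{0..t1}. chart_map (times_real A) i0 (\<xi> t) = chart_map (times_real A) i0 (\<xi> 0) + integral {0..t} g)"
  proof -
    have "i0 \<in> charts (times_real A)"
      by (simp add: times_real_def i0)
    moreover have "0 \<le> (0::real) \<and> 0 \<le> t1 \<and> t1 \<le> T \<and> \<xi> ` {0..t1} \<subseteq> chart_dom (times_real A) i0"
      using sub t1 by simp
    ultimately show ?thesis
      using sol unfolding caratheodory_solution_def g_def by blast
  qed
  then have g1: "g integrable_on {0..t1}"
    and eq: "chart_map (times_real A) i0 (\<xi> t) = chart_map (times_real A) i0 (\<xi> 0) + integral {0..t} g"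
    using t unfolding absolutely_integrable_on_def by blast+
  have g: "g integrable_on {0..t}"
    by (rule integrable_subinterval_real[OF g1]) (use t in auto)
  have init: "\<xi> 0 = (init S, 0)"
    using sol by (simp add: caratheodory_solution_def)
  have map: "chart_map (times_real A) i0 z = (chart_map A i0 (fst z), snd z)" for z
    by (simp add: times_real_def case_prod_beta)
  have "fst (integral {0..t} g) = integral {0..t} (\<lambda>t. fst (g t))"
    using integral_linear[OF g bounded_linear_fst] by (simp add: o_def)
  also have "(\<lambda>t. fst (g t)) = (\<lambda>t. \<Sum>k<p. u t k *\<^sub>R X k i0 (fst (\<xi> t)))"
    by (simp add: g_def fst_sum lift_field_def case_prod_beta)
  finally show "chart_map A i0 (fst (\<xi> t)) = origin + integral {0..t} (\<lambda>t. \<Sum>k<p. u t k *\<^sub>R X k i0 (fst (\<xi> t)))"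
    using arg_cong[OF eq, of fst] by (simp add: map init)
  have "snd (integral {0..t} g) = integral {0..t} (\<lambda>t. snd (g t))"
    using integral_linear[OF g bounded_linear_snd] by (simp add: o_def)
  also have "(\<lambda>t. snd (g t)) = (\<lambda>t. \<Sum>k<p. u t k * displ S i0 (fst (\<xi> t)) (X k i0 (fst (\<xi> t))))"
    by (simp add: g_def snd_sum lift_field_def case_prod_beta)
  finally show "snd (\<xi> t) = integral {0..t} (\<lambda>t. \<Sum>k<p. u t k * displ S i0 (fst (\<xi> t)) (X k i0 (fst (\<xi> t))))"
    using arg_cong[OF eq, of snd] by (simp add: map init)
qed

text \<open>
  The trajectory stays in the ball of radius \<open>\<rho>\<close>: as long as it does so, its distance from the origin
  is at most \<open>C\<close> times the cost spent, hence at most some \<open>\<rho>1 < \<rho>\<close>, and at a first exit time it would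
  by continuity still lie in the closed ball of radius \<open>\<rho>1\<close>.
\<close>

lemma admissible_imp_loop:
  assumes T: "T > 0" and \<rho>: "\<rho> > 0" "\<rho> \<le> R" and u: "u \<in> admissible_controls S p X T K \<delta>"
    and small: "(LINT t|lebesgue_on {0..T}. L2_set (u t) {..<p}) < \<rho> / C"
  obtains w where "loop T \<rho> w" "holonomy T w = \<delta>"
    "cost T w = (LINT t|lebesgue_on {0..T}. L2_set (u t) {..<p})"
proof -
  obtain \<xi> where Linf: "Linf_control p T u"
    and sol: "caratheodory_solution (times_real A) p (\<lambda>j. lift_field S (X j)) T u (init S, 0) \<xi>"
    and end_T: "\<xi> T = (init S, \<delta>)"
    using u unfolding admissible_controls_def by blast
  obtain u' N where bm: "\<And>k. k < p \<Longrightarrow> bounded_measurable T (\<lambda>t. u' t k)"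
    and N: "negligible N" and eq: "\<And>t k. t \<in> {0..T} - N \<Longrightarrow> k < p \<Longrightarrow> u' t k = u t k"
    and LINT: "(LINT t|lebesgue_on {0..T}. L2_set (u t) {..<p}) = integral {0..T} (\<lambda>t. L2_set (u' t) {..<p})"
    using Linf_control_bounded_version[OF Linf] by metis
  define v where "v t = L2_set (u' t) {..<p}" for t
  have v: "bounded_measurable T v"
    unfolding v_def by (rule bounded_measurable_L2_set[where f="\<lambda>k t. u' t k"]) (rule bm)
  have v_nonneg: "v t \<ge> 0" for t
    by (simp add: v_def)
  have vint: "v integrable_on {0..t}" if "t \<le> T" for t
    by (rule bounded_measurable_integrable[OF v]) (use that in auto)
  define c where "c = integral {0..T} v"
  have c: "c < \<rho> / C" "c \<ge> 0"
    using small vint[of T] unfolding LINT c_def v_def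
    by (auto intro: Henstock_Kurzweil_Integration.integral_nonneg)
  define \<rho>1 where "\<rho>1 = C * c"
  have \<rho>1: "\<rho>1 < \<rho>" "0 \<le> \<rho>1"
    using c C by (simp_all add: \<rho>1_def field_simps)
  define s where "s t = fst (\<xi> t)" for t
  define x where "x t = chart_map A i0 (s t)" for t
  have s_cont: "continuous_on {0..T} s"
    using sol unfolding s_def caratheodory_solution_def by (auto intro: continuous_on_fst)
  have s0: "s 0 = init S"
    using sol by (simp add: s_def caratheodory_solution_def)
  have key: "s t1 \<in> chart_inv A i0 ` cball origin \<rho>1"
    if t1: "t1 \<in> {0..T}" and in_ball: "\<And>t. t \<in> {0..t1} \<Longrightarrow> s t \<in> chart_inv A i0 ` cball origin R" for t1
  proof -
    have s_dom: "s t \<in> chart_dom A i0" "x t \<in> cball origin R" "chart_inv A i0 (x t) = s t"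
      if t: "t \<in> {0..t1}" for t
    proof -
      obtain y where y: "y \<in> cball origin R" "s t = chart_inv A i0 y"
        using in_ball[OF t] by blast
      then have "y \<in> chart_image S i0"
        using cball_image by blast
      then show "s t \<in> chart_dom A i0" "x t \<in> cball origin R" "chart_inv A i0 (x t) = s t"
        using y i0 by (auto simp: x_def chart_inv_in)
    qed
    have "x t1 = origin + integral {0..t1} (\<lambda>t. \<Sum>k<p. u t k *\<^sub>R X k i0 (s t))"
      unfolding x_def s_def
      by (rule solution_in_chart(1)[OF sol t1]) (use s_dom(1) t1 in \<open>auto simp: s_def\<close>)
    also have "integral {0..t1} (\<lambda>t. \<Sum>k<p. u t k *\<^sub>R X k i0 (s t)) =
        integral {0..t1} (\<lambda>t. \<Sum>k<p. u' t k *\<^sub>R X k i0 (s t))"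
      by (rule integral_spike[OF N]) (use eq t1 in auto)
    finally have x1: "x t1 = origin + integral {0..t1} (\<lambda>t. \<Sum>k<p. u' t k *\<^sub>R X k i0 (s t))" .
    have "norm (integral {0..t1} (\<lambda>t. \<Sum>k<p. u' t k *\<^sub>R X k i0 (s t))) \<le> integral {0..t1} (\<lambda>t. C * v t)"
    proof (cases "(\<lambda>t. \<Sum>k<p. u' t k *\<^sub>R X k i0 (s t)) integrable_on {0..t1}")
      case True
      then show ?thesis
      proof (rule Henstock_Kurzweil_Integration.integral_norm_bound_integral)
        show "(\<lambda>t. C * v t) integrable_on {0..t1}"
          using vint[of t1] t1 by (intro integrable_on_mult_right) auto
        fix t assume t: "t \<in> {0..t1}"
        show "norm (\<Sum>k<p. u' t k *\<^sub>R X k i0 (s t)) \<le> C * v t"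
          using norm_frame_sum_le[OF s_dom(2)[OF t], of "u' t"]
          by (simp add: frame_def s_dom(3)[OF t] v_def)
      qed
    next
      case False
      have "integral {0..t1} (\<lambda>t. C * v t) \<ge> 0"
        using vint[of t1] t1 C
        by (intro Henstock_Kurzweil_Integration.integral_nonneg integrable_on_mult_right) (auto simp: v_nonneg)
      then show ?thesis
        using False by (simp add: not_integrable_integral)
    qed
    also have "\<dots> = C * integral {0..t1} v"
      by simp
    also have "\<dots> \<le> C * c"
      unfolding c_def using t1 C vint
      by (intro mult_left_mono Henstock_Kurzweil_Integration.integral_subset_le) (auto simp: v_nonneg)
    finally have "x t1 \<in> cball origin \<rho>1"
      unfolding x1 by (simp add: \<rho>1_def dist_norm)
    then show ?thesis
      using s_dom(3)[of t1] t1 by (metis atLeastAtMost_iff image_eqI order_refl)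
  qed
  define \<Omega> where "\<Omega> = chart_inv A i0 ` ball origin \<rho>"
  have \<Omega>_sub: "ball origin \<rho> \<subseteq> chart_image S i0" "\<Omega> \<subseteq> chart_inv A i0 ` cball origin R"
    using cball_image \<rho>(2) by (auto simp: \<Omega>_def)
  have \<Omega>_eq: "\<Omega> = chart_dom A i0 \<inter> chart_map A i0 -` ball origin \<rho>"
  proof (intro equalityI subsetI)
    fix y assume "y \<in> \<Omega>"
    then obtain z where "z \<in> ball origin \<rho>" "y = chart_inv A i0 z"
      unfolding \<Omega>_def by blast
    then show "y \<in> chart_dom A i0 \<inter> chart_map A i0 -` ball origin \<rho>"
      using \<Omega>_sub(1) i0 by (auto simp: chart_inv_in subset_iff)
  next
    fix y assume "y \<in> chart_dom A i0 \<inter> chart_map A i0 -` ball origin \<rho>"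
    then show "y \<in> \<Omega>"
      unfolding \<Omega>_def using i0 by (metis IntD1 IntD2 chart_inv_map image_eqI vimageD)
  qed
  have \<Omega>_open: "open \<Omega>"
    unfolding \<Omega>_eq by (rule continuous_open_preimage[OF chart_map_continuous[OF i0] open_chart_dom[OF i0] open_ball])
  have all_in: "s t \<in> \<Omega>" if "t \<in> {0..T}" for t
  proof (rule ccontr)
    assume "s t \<notin> \<Omega>"
    \<comment> \<open>The first exit time is the least element of this compact set.\<close>
    define bad where "bad = {0..T} \<inter> s -` (- \<Omega>)"
    have "closed bad"
      unfolding bad_def by (rule continuous_closed_preimage[OF s_cont closed_atLeastAtMost]) (use \<Omega>_open in auto)
    then have "compact bad"
      by (metis bad_def compact_Icc compact_Int_closed inf_left_idem)
    moreover have "bad \<noteq> {}"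
      using \<open>s t \<notin> \<Omega>\<close> that by (auto simp: bad_def)
    ultimately have "\<exists>t0\<in>bad. \<forall>t\<in>bad. t0 \<le> t"
      by (rule compact_attains_inf)
    then obtain t0 where t0: "t0 \<in> bad" "\<And>t. t \<in> bad \<Longrightarrow> t0 \<le> t"
      by blast
    have t0T: "t0 \<in> {0..T}" "s t0 \<notin> \<Omega>"
      using t0(1) by (auto simp: bad_def)
    have before: "s t \<in> \<Omega>" if "0 \<le> t" "t < t0" for t
      using t0(2)[of t] that t0T by (force simp: bad_def)
    have "s 0 \<in> \<Omega>"
      unfolding s0 \<Omega>_eq using init_dom \<rho> by simp
    then have "t0 > 0"
      using t0T by (cases "t0 = 0") auto
    define M where "M = chart_inv A i0 ` cball origin \<rho>1"
    have "cball origin \<rho>1 \<subseteq> chart_image S i0"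
      using cball_image \<rho>1 \<rho>(2) subset_cball[of \<rho>1 R origin] by auto
    then have "compact M"
      unfolding M_def
      by (intro compact_continuous_image compact_cball continuous_on_subset[OF chart_inv_continuous[OF i0]])
    then have "closed M"
      by (rule compact_imp_closed)
    moreover have "s ` {0..<t0} \<subseteq> M"
    proof
      fix y assume "y \<in> s ` {0..<t0}"
      then obtain t1 where t1: "y = s t1" "0 \<le> t1" "t1 < t0"
        by auto
      have "s t1 \<in> M"
        unfolding M_def
      proof (rule key)
        show "t1 \<in> {0..T}"
          using t1 t0T by auto
        fix t assume "t \<in> {0..t1}"
        then have "s t \<in> \<Omega>"
          using before t1 by auto
        then show "s t \<in> chart_inv A i0 ` cball origin R"
          using \<Omega>_sub(2) by blast
      qed
      then show "y \<in> M"
        by (simp add: t1(1))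
    qed
    moreover have "closure {0..<t0} = {0..t0}"
      using \<open>t0 > 0\<close> by simp
    moreover have "continuous_on {0..t0} s"
      by (rule continuous_on_subset[OF s_cont]) (use t0T in auto)
    ultimately have "s ` {0..t0} \<subseteq> M"
      using image_closure_subset[of "{0..<t0}" s M] by simp
    then have "s t0 \<in> M"
      using \<open>t0 > 0\<close> by auto
    moreover have "M \<subseteq> \<Omega>"
      unfolding M_def \<Omega>_def using \<rho>1 by (intro image_mono) auto
    ultimately show False
      using t0T by blast
  qed
  have s_dom: "s t \<in> chart_dom A i0" "x t \<in> ball origin \<rho>" "x t \<in> chart_image S i0" "chart_inv A i0 (x t) = s t"
    if "t \<in> {0..T}" for t
    using all_in[OF that] \<Omega>_sub(1) i0 unfolding \<Omega>_eq by (auto simp: x_def)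
  have frame_s: "frame i0 k (x t) = X k i0 (s t)" if "t \<in> {0..T}" for k t
    by (simp add: frame_def s_dom(4)[OF that])
  have x_cont: "continuous_on {0..T} x"
    unfolding x_def[abs_def]
    by (rule continuous_on_compose2[OF chart_map_continuous[OF i0] s_cont]) (use s_dom(1) in auto)
  define w where "w t = (\<Sum>k<p. u' t k *\<^sub>R frame i0 k (x t))" for t
  have w: "bounded_measurable T w"
    unfolding w_def
  proof (intro bounded_measurable_sum bounded_measurable_scaleR bm)
    fix k assume k: "k \<in> {..<p}"
    then show "bounded_measurable T (\<lambda>t. frame i0 k (x t))"
      by (intro bounded_measurable_continuous continuous_on_compose2[OF analytic_components_continuous_on[OF
            frame_components[OF _ i0]] x_cont]) (use s_dom(3) in auto)
  qed simp
  have curve_x: "curve origin w t = x t" if t: "t \<in> {0..T}" for t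
  proof -
    have "x t = origin + integral {0..t} (\<lambda>t. \<Sum>k<p. u t k *\<^sub>R X k i0 (s t))"
      unfolding x_def s_def
      by (rule solution_in_chart(1)[OF sol t]) (use s_dom(1) t in \<open>auto simp: s_def\<close>)
    also have "integral {0..t} (\<lambda>t. \<Sum>k<p. u t k *\<^sub>R X k i0 (s t)) = integral {0..t} w"
      by (rule integral_spike[OF N]) (use eq t frame_s in \<open>auto simp: w_def\<close>)
    finally show ?thesis
      by (simp add: curve_def)
  qed
  have TT: "T \<in> {0..T}"
    using T by simp
  have loop: "loop T \<rho> w"
    unfolding loop_def
  proof (intro conjI ballI w)
    show "curve origin w t \<in> cball origin \<rho>" if "t \<in> {0..T}" for t
      using s_dom(2)[OF that] by (simp add: curve_x[OF that])
    show "curve origin w T = origin"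
      using end_T by (simp add: curve_x[OF TT] x_def s_def)
  qed
  have "holonomy T w = integral {0..T} (\<lambda>t. covector S i0 (x t) \<bullet> w t)"
    unfolding holonomy_def by (rule Henstock_Kurzweil_Integration.integral_cong) (simp add: curve_x)
  also have "\<dots> = integral {0..T} (\<lambda>t. \<Sum>k<p. u t k * displ S i0 (s t) (X k i0 (s t)))"
  proof (rule integral_spike[OF N])
    fix t assume t: "t \<in> {0..T} - N"
    then have t': "t \<in> {0..T}"
      by blast
    have "covector S i0 (x t) \<bullet> w t = (\<Sum>k<p. u' t k * (covector S i0 (x t) \<bullet> frame i0 k (x t)))"
      by (simp add: w_def inner_sum_right)
    also have "\<dots> = (\<Sum>k<p. u t k * displ S i0 (s t) (X k i0 (s t)))"
      using eq[OF t] displ_eq_covector[OF i0 s_dom(3)[OF t']]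
      by (intro sum.cong) (simp_all add: frame_s[OF t'] s_dom(4)[OF t'])
    finally show "(\<Sum>k<p. u t k * displ S i0 (s t) (X k i0 (s t))) = covector S i0 (x t) \<bullet> w t" ..
  qed
  also have "\<dots> = snd (\<xi> T)"
    unfolding s_def
    by (rule solution_in_chart(2)[OF sol TT, symmetric]) (use s_dom(1) T in \<open>auto simp: s_def\<close>)
  finally have hol: "holonomy T w = \<delta>"
    by (simp add: end_T)
  have "cost T w = integral {0..T} v"
    unfolding cost_def
  proof (rule Henstock_Kurzweil_Integration.integral_cong)
    fix t assume t: "t \<in> {0..T}"
    show "speed (curve origin w t) (w t) = v t"
      unfolding curve_x[OF t] speed_def v_def w_def
      by (rule L2_set_cong) (auto simp: coframe_sum[OF i0 s_dom(3)[OF t]])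
  qed
  then show ?thesis
    using that[OF loop hol] by (simp add: LINT v_def[abs_def])
qed

end

section \<open>Strict monotonicity of the optimal cost\<close>

context framed_chart
begin

lemma loop_mono: "loop T \<rho> w \<Longrightarrow> \<rho> \<le> \<rho>' \<Longrightarrow> loop T \<rho>' w"
  unfolding loop_def by auto

lemma positive_loop_exists:
  assumes contr: "controllable S" and T: "T > 0" and \<rho>: "\<rho> > 0" "\<rho> \<le> R"
  obtains w where "loop T \<rho> w" "holonomy T w > 0" "cost T w \<le> 6 * \<rho> * C"
proof -
  have sub: "ball origin \<rho> \<subseteq> chart_image S i0"
    using cball_image \<rho> by auto
  have "\<not> (\<exists>f. \<forall>x\<in>ball origin \<rho>. (f has_derivative (\<bullet>) (covector S i0 x)) (at x))"
  proof
    assume "\<exists>f. \<forall>x\<in>ball origin \<rho>. (f has_derivative (\<bullet>) (covector S i0 x)) (at x)"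
    then obtain f where f: "\<And>x. x \<in> ball origin \<rho> \<Longrightarrow> (f has_derivative (\<bullet>) (covector S i0 x)) (at x)"
      by blast
    obtain D where D: "\<And>x. x \<in> chart_image S i0 \<Longrightarrow> (covector S i0 has_derivative D x) (at x)"
      "\<And>v. analytic_components (chart_image S i0) (\<lambda>x. D x v)"
      using analytic_components_derivative[OF covector_components[OF i0]] by blast
    have "closed_at S i0 x" if x: "x \<in> ball origin \<rho>" for x
    proof -
      have xi: "x \<in> chart_image S i0"
        using x sub by blast
      have "D x w \<bullet> v = D x v \<bullet> w" for v w
      proof (rule symmetric_second_derivative[OF open_ball x, of f "\<lambda>x v. covector S i0 x \<bullet> v" "\<lambda>v x w. D x w \<bullet> v"])
        show "(f has_derivative (\<lambda>v. covector S i0 y \<bullet> v)) (at y)" if "y \<in> ball origin \<rho>" for y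
          by (rule f[OF that])
        show "((\<lambda>x. covector S i0 x \<bullet> v) has_derivative (\<lambda>w. D y w \<bullet> v)) (at y)" if "y \<in> ball origin \<rho>" for y v
          by (rule has_derivative_inner_left[OF D(1)]) (use that sub in blast)
        show "continuous_on (ball origin \<rho>) (\<lambda>x. D x w \<bullet> v)" for v w
          by (intro continuous_on_subset[OF analytic_algebra_continuous_on sub] analytic_components_inner D(2)
              analytic_components_const)
      qed
      then show ?thesis
        unfolding closed_at_iff[OF D(1)[OF xi]] by blast
    qed
    moreover have "\<exists>x\<in>ball origin \<rho>. \<not> closed_at S i0 x"
      by (rule controllable_imp_not_closed[OF contr i0 open_ball _ sub]) (use \<rho> in simp)
    ultimately show False
      by blast
  qed
  then show ?thesis
    using positive_loop_or_primitive[OF T \<rho>(2)] that by blast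
qed

lemma optimal_cost_nonneg: "optimal_cost S p X T K \<delta> \<ge> 0"
  unfolding optimal_cost_def
  by (rule INF_greatest) (simp add: zero_ereal_def Bochner_Integration.integral_nonneg)

lemma optimal_cost_le_loop:
  assumes "T > 0" "\<rho> \<le> R" "loop T \<rho> w" "chart_inv A i0 ` cball origin \<rho> \<subseteq> K"
  shows "optimal_cost S p X T K (holonomy T w) \<le> ereal (cost T w)"
proof -
  obtain u where u: "u \<in> admissible_controls S p X T K (holonomy T w)"
    "(LINT t|lebesgue_on {0..T}. L2_set (u t) {..<p}) = cost T w"
    using loop_admissible[OF assms] by blast
  show ?thesis
    unfolding optimal_cost_def u(2)[symmetric] by (rule INF_lower[OF u(1)])
qed

text \<open>
  A control for \<open>\<delta>2\<close> that costs less than \<open>\<rho> / C\<close> is a loop in the ball, which \<open>loop_shrink\<close> turns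
  into a cheaper loop for \<open>\<delta>1\<close>.  The saving is the same for all these controls, so it survives in the
  infimum.
\<close>

lemma optimal_cost_gap:
  assumes T: "T > 0" and \<rho>: "\<rho> > 0" "\<rho> \<le> R" "real p * C\<^sup>2 * \<rho> \<le> 1 / 2"
    and K: "chart_inv A i0 ` cball origin \<rho> \<subseteq> K" and \<delta>: "0 \<le> \<delta>1" "\<delta>1 \<le> \<delta>2"
    and small: "optimal_cost S p X T K \<delta>2 < ereal (\<rho> / C)"
  shows "optimal_cost S p X T K \<delta>1 + ereal ((\<delta>2 - \<delta>1) / (2 * C\<^sup>2 * (R + 1))) \<le> optimal_cost S p X T K \<delta>2"
proof (rule ccontr)
  define \<kappa> where "\<kappa> = (\<delta>2 - \<delta>1) / (2 * C\<^sup>2 * (R + 1))"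
  assume "\<not> ?thesis"
  then have "optimal_cost S p X T K \<delta>2 < min (optimal_cost S p X T K \<delta>1 + ereal \<kappa>) (ereal (\<rho> / C))"
    using small by (simp add: \<kappa>_def)
  then obtain u where u: "u \<in> admissible_controls S p X T K \<delta>2"
    and less: "ereal (LINT t|lebesgue_on {0..T}. L2_set (u t) {..<p}) <
       min (optimal_cost S p X T K \<delta>1 + ereal \<kappa>) (ereal (\<rho> / C))"
    unfolding optimal_cost_def[of S p X T K \<delta>2] INF_less_iff by blast
  define c where "c = (LINT t|lebesgue_on {0..T}. L2_set (u t) {..<p})"
  have c: "c < \<rho> / C" "ereal c < optimal_cost S p X T K \<delta>1 + ereal \<kappa>"
    using less by (simp_all add: c_def)
  obtain w where w: "loop T \<rho> w" "holonomy T w = \<delta>2" "cost T w = c"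
    using admissible_imp_loop[OF T \<rho>(1,2) u] c(1) unfolding c_def by blast
  obtain w' where w': "loop T \<rho> w'" "holonomy T w' = \<delta>1"
    "cost T w' \<le> cost T w - (holonomy T w - \<delta>1) / (2 * C\<^sup>2 * (R + 1))"
    using loop_shrink[OF w(1) \<rho>(2,3) \<delta>(1)] \<delta>(2) w(2) by blast
  have "optimal_cost S p X T K \<delta>1 \<le> ereal (cost T w')"
    using optimal_cost_le_loop[OF T \<rho>(2) w'(1) K] w'(2) by simp
  also have "\<dots> \<le> ereal (c - \<kappa>)"
    using w'(3) w by (simp add: \<kappa>_def)
  finally have "optimal_cost S p X T K \<delta>1 + ereal \<kappa> \<le> ereal (c - \<kappa>) + ereal \<kappa>"
    by (rule add_right_mono)
  then show False
    using c(2) by simp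
qed

lemma optimal_cost_strict_mono:
  assumes contr: "controllable S" and T: "T > 0" and K: "init S \<in> interior K"
  shows "\<exists>\<epsilon>>0. strict_mono_on {0..<\<epsilon>} (\<lambda>\<delta>. optimal_cost S p X T K \<delta>)"
proof -
  have "open (chart_image S i0 \<inter> chart_inv A i0 -` interior K)"
    by (rule continuous_open_preimage[OF chart_inv_continuous[OF i0] open_chart_image[OF i0] open_interior])
  moreover have "origin \<in> chart_image S i0 \<inter> chart_inv A i0 -` interior K"
    using i0 init_dom K by (simp add: chart_map_in)
  ultimately obtain r where r: "r > 0" "cball origin r \<subseteq> chart_image S i0 \<inter> chart_inv A i0 -` interior K"
    using open_contains_cball by blast
  \<comment> \<open>Small enough to stay inside \<open>K\<close> and inside the chart, and for the homotheties to shorten loops.\<close>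
  define \<rho> where "\<rho> = min (min r R) (1 / (2 * (real p * C\<^sup>2 + 1)))"
  have pos: "real p * C\<^sup>2 + 1 > 0"
    by (intro add_nonneg_pos) auto
  have \<rho>: "\<rho> > 0" "\<rho> \<le> R" "\<rho> \<le> r"
    using r(1) R pos by (auto simp: \<rho>_def)
  have "real p * C\<^sup>2 * \<rho> \<le> (real p * C\<^sup>2 + 1) * (1 / (2 * (real p * C\<^sup>2 + 1)))"
    using \<rho>(1) by (intro mult_mono) (auto simp: \<rho>_def)
  also have "\<dots> = 1 / 2"
    using pos by (simp add: divide_simps)
  finally have \<rho>p: "real p * C\<^sup>2 * \<rho> \<le> 1 / 2" .
  have K\<rho>: "chart_inv A i0 ` cball origin \<rho> \<subseteq> K"
    using r(2) \<rho>(3) interior_subset subset_cball[of \<rho> r origin] by blast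
  \<comment> \<open>Triangles of this size cost at most half of \<open>\<rho> / C\<close>, the bound below which controls are loops.\<close>
  define \<rho>' where "\<rho>' = min \<rho> (\<rho> / (12 * C\<^sup>2))"
  have \<rho>': "\<rho>' > 0" "\<rho>' \<le> R" "\<rho>' \<le> \<rho>"
    using \<rho> C by (auto simp: \<rho>'_def)
  have "6 * \<rho>' * C \<le> 6 * (\<rho> / (12 * C\<^sup>2)) * C"
    using C by (intro mult_right_mono mult_left_mono) (auto simp: \<rho>'_def)
  also have "\<dots> = \<rho> / C / 2"
    using C by (simp add: power2_eq_square)
  also have "\<dots> < \<rho> / C"
  proof -
    have "c / 2 < c" if "c > 0" for c :: real
      using that by simp
    then show ?thesis
      using divide_pos_pos[OF \<rho>(1) C] by blast
  qed
  finally have small: "6 * \<rho>' * C < \<rho> / C" .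
  obtain w0 where w0: "loop T \<rho>' w0" "holonomy T w0 > 0" "cost T w0 \<le> 6 * \<rho>' * C"
    using positive_loop_exists[OF contr T \<rho>'(1,2)] by blast
  have le_w0: "optimal_cost S p X T K \<delta> \<le> ereal (cost T w0)" if \<delta>: "0 \<le> \<delta>" "\<delta> \<le> holonomy T w0" for \<delta>
  proof -
    obtain w where w: "loop T \<rho> w" "holonomy T w = \<delta>"
      "cost T w \<le> cost T w0 - (holonomy T w0 - \<delta>) / (2 * C\<^sup>2 * (R + 1))"
      using loop_shrink[OF loop_mono[OF w0(1) \<rho>'(3)] \<rho>(2) \<rho>p \<delta>] by blast
    have "(holonomy T w0 - \<delta>) / (2 * C\<^sup>2 * (R + 1)) \<ge> 0"
      using \<delta> R by (intro divide_nonneg_nonneg mult_nonneg_nonneg) auto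
    then have "cost T w \<le> cost T w0"
      using w(3) by linarith
    then have "ereal (cost T w) \<le> ereal (cost T w0)"
      by simp
    with optimal_cost_le_loop[OF T \<rho>(2) w(1) K\<rho>] show ?thesis
      unfolding w(2) by (rule order_trans)
  qed
  have "strict_mono_on {0..<holonomy T w0} (\<lambda>\<delta>. optimal_cost S p X T K \<delta>)"
  proof (rule strict_mono_onI)
    fix \<delta>1 \<delta>2 assume \<delta>: "\<delta>1 \<in> {0..<holonomy T w0}" "\<delta>2 \<in> {0..<holonomy T w0}" "\<delta>1 < \<delta>2"
    define \<kappa> where "\<kappa> = (\<delta>2 - \<delta>1) / (2 * C\<^sup>2 * (R + 1))"
    have "\<kappa> > 0"
      using \<delta>(3) C R by (simp add: \<kappa>_def)
    have "optimal_cost S p X T K \<delta>2 \<le> ereal (cost T w0)"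
      using \<delta> by (intro le_w0) auto
    also have "\<dots> < ereal (\<rho> / C)"
      using w0(3) small by simp
    finally have "optimal_cost S p X T K \<delta>1 + ereal \<kappa> \<le> optimal_cost S p X T K \<delta>2"
      unfolding \<kappa>_def using \<delta> by (intro optimal_cost_gap[OF T \<rho>(1,2) \<rho>p K\<rho>]) auto
    moreover have "optimal_cost S p X T K \<delta>1 < optimal_cost S p X T K \<delta>1 + ereal \<kappa>"
    proof -
      have "optimal_cost S p X T K \<delta>1 \<le> ereal (cost T w0)"
        using \<delta> by (intro le_w0) auto
      then have "\<bar>optimal_cost S p X T K \<delta>1\<bar> \<noteq> \<infinity>"
        using optimal_cost_nonneg[of T K \<delta>1] by auto
      then show ?thesis
        using \<open>\<kappa> > 0\<close> by (cases "optimal_cost S p X T K \<delta>1") auto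
    qed
    ultimately show "optimal_cost S p X T K \<delta>1 < optimal_cost S p X T K \<delta>2"
      by (rule less_le_trans[rotated])
  qed
  then show ?thesis
    using w0(2) by blast
qed

end

theorem theorem2p9:
  fixes S :: "('i, 's::{t2_space, second_countable_topology}, 'e::euclidean_space, 'n::finite) swimmer"
    and K :: "'s set"
    and p :: nat
    and X :: "nat \<Rightarrow> ('i, 's, 'e) vfield"
    and T :: real
  assumes "is_swimmer S"
    and "controllable S"
    and "trivialized S"
    and "unconstrained S"
    and "compact K"
    and "init S \<in> interior K"
    and "orthonormal_basis S p X"
    and "T > 0"
  shows "\<exists>\<epsilon>>0. strict_mono_on {0..<\<epsilon>} (\<lambda>\<delta>. optimal_cost S p X T K \<delta>)"
proof -
  interpret framed_swimmer S p X
    by (intro framed_swimmer.intro analytic_swimmer.intro framed_swimmer_axioms.intro assms)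
  obtain i0 where i0: "i0 \<in> charts (shape S)" "init S \<in> chart_dom (shape S) i0"
    using chart_cover by blast
  obtain R where R: "R > 0" "cball (chart_map (shape S) i0 (init S)) R \<subseteq> chart_image S i0"
    using open_chart_image[OF i0(1)] chart_map_in[OF i0] open_contains_cball by metis
  obtain C where C: "local_frame (chart_map (shape S) i0 (init S)) R C p (coframe i0) (\<lambda>x v. covector S i0 x \<bullet> v)"
    using local_frame_exists[OF i0(1) R] by blast
  have "framed_chart S p X i0 R C"
    by (intro framed_chart.intro framed_chart_axioms.intro framed_swimmer_axioms i0 R(2) C)
  then show ?thesis
    by (rule framed_chart.optimal_cost_strict_mono) (use assms in auto)
qed

end
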